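(* (a) Let $C$ be a constant of motion of $\dot y=f(y)$. Assume that $\alpha=\alpha(h)$ satisfies, together with the associated stages, the equation $\alpha=\mathcal{N}(h)/\mathcal{D}(h)$ with $$\mathcal{N}(h)=\sum_{j=0}^{s-1}\rho_j(\sigma_1)^\top\gamma_j,\qquad \mathcal{D}(h)=\left(\rho_0(\sigma_1)-\bar\rho(\sigma_2)\right)^\top(\phi_{20}\gamma_0-\phi_{10}\gamma_1)+\sum_{j=1}^{s-1}\rho_j(\sigma_1)^\top(\phi_{2j}\gamma_0-\phi_{1j}\gamma_1),$$ and that $$f_0^\top\left((g_0')^\top f_0'-(g_0'f_0')^\top\right)f_0-\left(g_0''(f_0,f_0)\right)^\top f_0\neq0 .$$ Then $\alpha=O(h^{2(s-1)})$ as $h\to0^+$. (b) Let the problem be Hamiltonian, $f=J\nabla H$. Assume that $\alpha=\alpha(h)$ satisfies, together with the associated stages, $\alpha=\mathcal{N}(h)/\mathcal{D}(h)$ with $$\mathcal{N}(h)=\sum_{j=0}^{s-1}\gamma_j(\sigma_1)^\top J\gamma_j,\qquad \mathcal{D}(h)=\left(\gamma_0(\sigma_1)-\bar\gamma(\sigma_2)\right)^\top J(\phi_{20}\gamma_0-\phi_{10}\gamma_1)+\sum_{j=1}^{s-1}\gamma_j(\sigma_1)^\top J(\phi_{2j}\gamma_0-\phi_{1j}\gamma_1),$$ and that $\left[f_0''(f_0,f_0)\right]^\top Jf_0\ne0$. Then $\alpha=O(h^{2(s-1)})$ as $h\to0^+$.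
   Context: The problem is $\dot y=f(y)$, $y(0)=y_0\in U\subseteq\mathbb{R}^m$ ($U$ open), $f:U\to\mathbb{R}^m$ analytic, and in (a) $C:U\to\mathbb{R}$ is analytic with $\nabla C(y)^\top f(y)=0$ for all $y\in U$. In (b), $m=2d$, $J=\begin{pmatrix}O_d&I_d\\-I_d&O_d\end{pmatrix}$, $H:U\to\mathbb{R}$ is analytic and $f=J\nabla H$. Notation: $f_0=f(y_0)$, $f_0'=f'(y_0)$ (Jacobian), $f_0''=f''(y_0)$ (second derivative, as an $\mathbb{R}^m$-valued bilinear map); $g=\nabla C$, $g_0'=g'(y_0)$, $g_0''=g''(y_0)$. Fix an integer $s\ge2$. $\{P_j\}_{j\ge0}$ are the Legendre polynomials orthonormal on $[0,1]$ ($\deg P_j=j$, positive leading coefficient). $c_1<\dots<c_s$ are the zeros of $P_s$ and $b_i=\int_0^1\prod_{j\ne i}\frac{x-c_j}{c_i-c_j}dx$. $\mathcal{P}_s\in\mathbb{R}^{s\times s}$ has $(i,j)$ entry $P_{j-1}(c_i)$, and $\Omega=\mathrm{diag}(b_1,\dots,b_s)$. With $\xi_i=\frac{1}{2\sqrt{|4i^2-1|}}$, $X_s$ is the $s\times s$ tridiagonal matrix with $(1,1)$ entry $\xi_0$, all other diagonal entries $0$, $(i+1,i)$ entry $\xi_i$ and $(i,i+1)$ entry $-\xi_i$ for $i=1,\dots,s-1$. $W_s=e_2e_1^\top-e_1e_2^\top$ ($e_i$ unit vectors of $\mathbb{R}^s$), $A(\alpha)=\mathcal{P}_s(X_s-\alpha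 W_s)\mathcal{P}_s^\top\Omega$. For stepsize $h>0$ the stages are given by $Y_i=y_0+h\sum_{j=1}^sA(\alpha)_{ij}f(Y_j)$ and $y_1=y_0+h\sum_ib_if(Y_i)$. Define $\gamma_j=\sum_{i=1}^sb_iP_j(c_i)f(Y_i)$, $j=0,\dots,s-1$; $(\phi_{i0},\dots,\phi_{i,s-1})^\top=X_s^{-1}e_i$, $i=1,2$; $$\sigma_1(ch)=y_0+h\sum_{j=0}^{s-1}\int_0^cP_j(x)dx\,[\gamma_j-\alpha(\phi_{2j}\gamma_0-\phi_{1j}\gamma_1)],\qquad \sigma_2(t)=y_1+(t-1)\alpha h(\phi_{20}\gamma_0-\phi_{10}\gamma_1),\qquad c,t\in[0,1];$$ $$\rho_j(\sigma_1)=\int_0^1P_j(c)\nabla C(\sigma_1(ch))dc,\quad\bar\rho(\sigma_2)=\int_0^1\nabla C(\sigma_2(c))dc,\quad\gamma_j(\sigma_1)=\int_0^1P_j(c)f(\sigma_1(ch))dc,\quad\bar\gamma(\sigma_2)=\int_0^1f(\sigma_2(c))dc.$$ Standing assumption: $|\alpha|\le c\,h^2$ for a given positive constant $c$. The $O$ symbol refers to $h\to0^+$ with $s$, $y_0$, $f$, $C$ (or $H$) fixed.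
   Formalization: The stages are additionally required to satisfy Y_i(h)→y_0 as h→0+, selecting the usual solution branch of the implicit stage system; spurious branches that blow up as h→0+, for which the claim can fail when s≥3, are excluded. *)

theory Defs
  imports
    "Jordan_Normal_Form.Gauss_Jordan_Elimination"
    "HOL-Computational_Algebra.Polynomial"
    "HOL-Library.Landau_Symbols"
    "HOL-Analysis.Analysis"
begin

text \<open>Matrices and vectors of size $s$ (number of stages) are those of
  \<^theory>\<open>Jordan_Normal_Form.Matrix\<close>; the phase space is \<open>real ^ 'm\<close>. All indices
  start at 0, so the \<open>i\<close>-th node, weight, stage, row or column in the code is the one
  numbered \<open>i + 1\<close> in the usual 1-based notation. The indices of \<open>legendre\<close>, \<open>xi\<close>
  and \<open>phi\<close> are the usual ones.\<close>


subsection \<open>Calculus on \<open>\<real>\<^sup>m\<close>\<close>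

text \<open>\<open>\<nu>\<close> ranges over multi-indices; the convergence is unconditional.\<close>

definition real_analytic_on ::
    "(real ^ 'm \<Rightarrow> 'b :: real_normed_vector) \<Rightarrow> (real ^ 'm) set \<Rightarrow> bool" where
  "real_analytic_on f U \<longleftrightarrow>
     (\<forall>a\<in>U. \<exists>r>0. \<exists>k :: ('m \<Rightarrow> nat) \<Rightarrow> 'b. \<forall>x\<in>ball a r.
        ((\<lambda>\<nu>. (\<Prod>i\<in>UNIV. (vec_nth x i - vec_nth a i) ^ \<nu> i) *\<^sub>R k \<nu>) has_sum f x) UNIV)"

definition grad :: "(real ^ 'm \<Rightarrow> real) \<Rightarrow> real ^ 'm \<Rightarrow> real ^ 'm" where
  "grad C y = (THE D. GDERIV C y :> D)"

definition second_deriv :: "(real ^ 'm \<Rightarrow> real ^ 'm) \<Rightarrow> real ^ 'm \<Rightarrow> real ^ 'm \<Rightarrow> real ^ 'm \<Rightarrow> real ^ 'm" where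
  "second_deriv f y u v =
     frechet_derivative (\<lambda>x. frechet_derivative f (at x) v) (at y) u"

definition symplectic_J :: "real ^ ('d :: finite + 'd) ^ ('d + 'd)" where
  "symplectic_J = (\<chi> i j. case (i, j) of
       (Inl k, Inr l) \<Rightarrow> of_bool (k = l)
     | (Inr k, Inl l) \<Rightarrow> - of_bool (k = l)
     | _ \<Rightarrow> 0)"


subsection \<open>Legendre polynomials and Gauss quadrature on \<open>[0, 1]\<close>\<close>

definition legendre :: "nat \<Rightarrow> real poly" where
  "legendre = (THE P. \<forall>j. degree (P j) = j \<and> lead_coeff (P j) > 0 \<and>
     (\<forall>i. integral {0..1} (\<lambda>x. poly (P i) x * poly (P j) x) = of_bool (i = j)))"

definition gauss_node :: "nat \<Rightarrow> nat \<Rightarrow> real" where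
  "gauss_node s i = sorted_list_of_set {x. poly (legendre s) x = 0} ! i"

definition gauss_weight :: "nat \<Rightarrow> nat \<Rightarrow> real" where
  "gauss_weight s i = integral {0..1} (\<lambda>x.
     \<Prod>j\<in>{..<s} - {i}. (x - gauss_node s j) / (gauss_node s i - gauss_node s j))"


subsection \<open>The one-parameter family of Runge--Kutta methods\<close>

definition P_mat :: "nat \<Rightarrow> real mat" where
  "P_mat s = Matrix.mat s s (\<lambda>(i, j). poly (legendre j) (gauss_node s i))"

definition Omega_mat :: "nat \<Rightarrow> real mat" where
  "Omega_mat s = mat_diag s (gauss_weight s)"

definition xi :: "nat \<Rightarrow> real" where
  "xi i = 1 / (2 * sqrt \<bar>4 * (real i)\<^sup>2 - 1\<bar>)"

definition X_mat :: "nat \<Rightarrow> real mat" where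
  "X_mat s = Matrix.mat s s (\<lambda>(i, j).
     if i = 0 \<and> j = 0 then xi 0
     else if i = j + 1 then xi i
     else if j = i + 1 then - xi j
     else 0)"

definition W_mat :: "nat \<Rightarrow> real mat" where
  "W_mat s = Matrix.mat s s (\<lambda>(i, j).
     if i = 1 \<and> j = 0 then 1 else if i = 0 \<and> j = 1 then - 1 else 0)"

definition A_mat :: "nat \<Rightarrow> real \<Rightarrow> real mat" where
  "A_mat s a = P_mat s * (X_mat s - a \<cdot>\<^sub>m W_mat s) * transpose_mat (P_mat s) * Omega_mat s"

definition phi :: "nat \<Rightarrow> nat \<Rightarrow> nat \<Rightarrow> real" where
  "phi s i j = vec_index (the (mat_inverse (X_mat s)) *\<^sub>v unit_vec s (i - 1)) j"

text \<open>The stage system is implicit and need not determine the stages uniquely. The stages of the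
  method for stepsize \<open>h \<rightarrow> 0\<close> are the solution branch emanating from \<open>y0\<close>; this is expressed
  where the stages occur as functions of \<open>h\<close>, by requiring that they tend to \<open>y0\<close>.\<close>

definition is_stages ::
    "nat \<Rightarrow> (real ^ 'm \<Rightarrow> real ^ 'm) \<Rightarrow> (real ^ 'm) set \<Rightarrow> real ^ 'm \<Rightarrow> real \<Rightarrow> real \<Rightarrow>
     (nat \<Rightarrow> real ^ 'm) \<Rightarrow> bool" where
  "is_stages s f U y0 h a Y \<longleftrightarrow>
     (\<forall>i<s. Y i \<in> U \<and> Y i = y0 + h *\<^sub>R (\<Sum>j<s. (A_mat s a $$ (i, j)) *\<^sub>R f (Y j)))"

definition rk_step ::
    "nat \<Rightarrow> (real ^ 'm \<Rightarrow> real ^ 'm) \<Rightarrow> real ^ 'm \<Rightarrow> real \<Rightarrow> (nat \<Rightarrow> real ^ 'm) \<Rightarrow> real ^ 'm" where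
  "rk_step s f y0 h Y = y0 + h *\<^sub>R (\<Sum>i<s. gauss_weight s i *\<^sub>R f (Y i))"


subsection \<open>The path \<open>\<sigma>\<close> from \<open>y\<^sub>0\<close> to \<open>y\<^sub>1\<close> and the Fourier coefficients along it\<close>

definition gam ::
    "nat \<Rightarrow> (real ^ 'm \<Rightarrow> real ^ 'm) \<Rightarrow> (nat \<Rightarrow> real ^ 'm) \<Rightarrow> nat \<Rightarrow> real ^ 'm" where
  "gam s f Y j =
     (\<Sum>i<s. (gauss_weight s i * poly (legendre j) (gauss_node s i)) *\<^sub>R f (Y i))"

text \<open>\<open>pert s f Y j\<close> is $\phi_{2j}\gamma_0-\phi_{1j}\gamma_1$.\<close>

definition pert ::
    "nat \<Rightarrow> (real ^ 'm \<Rightarrow> real ^ 'm) \<Rightarrow> (nat \<Rightarrow> real ^ 'm) \<Rightarrow> nat \<Rightarrow> real ^ 'm" where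
  "pert s f Y j = phi s 2 j *\<^sub>R gam s f Y 0 - phi s 1 j *\<^sub>R gam s f Y 1"

text \<open>\<open>sigma1 s f y0 h a Y c\<close> is $\sigma_1(ch)$: the argument is \<open>c\<close>, not \<open>c * h\<close>.\<close>

definition sigma1 ::
    "nat \<Rightarrow> (real ^ 'm \<Rightarrow> real ^ 'm) \<Rightarrow> real ^ 'm \<Rightarrow> real \<Rightarrow> real \<Rightarrow> (nat \<Rightarrow> real ^ 'm) \<Rightarrow>
     real \<Rightarrow> real ^ 'm" where
  "sigma1 s f y0 h a Y c = y0 + h *\<^sub>R
     (\<Sum>j<s. integral {0..c} (poly (legendre j)) *\<^sub>R (gam s f Y j - a *\<^sub>R pert s f Y j))"

definition sigma2 ::
    "nat \<Rightarrow> (real ^ 'm \<Rightarrow> real ^ 'm) \<Rightarrow> real ^ 'm \<Rightarrow> real \<Rightarrow> real \<Rightarrow> (nat \<Rightarrow> real ^ 'm) \<Rightarrow>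
     real \<Rightarrow> real ^ 'm" where
  "sigma2 s f y0 h a Y t = rk_step s f y0 h Y + ((t - 1) * a * h) *\<^sub>R pert s f Y 0"

text \<open>With \<open>F\<close> the gradient of \<open>C\<close> these are $\rho_j(\sigma)$ and $\bar\rho(\sigma)$, with
  \<open>F = f\<close> they are $\gamma_j(\sigma)$ and $\bar\gamma(\sigma)$.\<close>

definition path_coeff ::
    "(real ^ 'm \<Rightarrow> real ^ 'm) \<Rightarrow> (real \<Rightarrow> real ^ 'm) \<Rightarrow> nat \<Rightarrow> real ^ 'm" where
  "path_coeff F \<sigma> j = integral {0..1} (\<lambda>c. poly (legendre j) c *\<^sub>R F (\<sigma> c))"

definition path_mean ::
    "(real ^ 'm \<Rightarrow> real ^ 'm) \<Rightarrow> (real \<Rightarrow> real ^ 'm) \<Rightarrow> real ^ 'm" where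
  "path_mean F \<sigma> = integral {0..1} (\<lambda>c. F (\<sigma> c))"


subsection \<open>Numerator and denominator of the equation for \<open>\<alpha>\<close>\<close>

definition num_inv ::
    "nat \<Rightarrow> (real ^ 'm \<Rightarrow> real ^ 'm) \<Rightarrow> (real ^ 'm \<Rightarrow> real) \<Rightarrow> real ^ 'm \<Rightarrow> real \<Rightarrow> real \<Rightarrow>
     (nat \<Rightarrow> real ^ 'm) \<Rightarrow> real" where
  "num_inv s f C y0 h a Y =
     (\<Sum>j<s. path_coeff (grad C) (sigma1 s f y0 h a Y) j \<bullet> gam s f Y j)"

definition den_inv ::
    "nat \<Rightarrow> (real ^ 'm \<Rightarrow> real ^ 'm) \<Rightarrow> (real ^ 'm \<Rightarrow> real) \<Rightarrow> real ^ 'm \<Rightarrow> real \<Rightarrow> real \<Rightarrow>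
     (nat \<Rightarrow> real ^ 'm) \<Rightarrow> real" where
  "den_inv s f C y0 h a Y =
     (path_coeff (grad C) (sigma1 s f y0 h a Y) 0 - path_mean (grad C) (sigma2 s f y0 h a Y))
        \<bullet> pert s f Y 0
     + (\<Sum>j = 1..s - 1. path_coeff (grad C) (sigma1 s f y0 h a Y) j \<bullet> pert s f Y j)"

definition num_ham ::
    "nat \<Rightarrow> (real ^ ('d :: finite + 'd) \<Rightarrow> real ^ ('d + 'd)) \<Rightarrow> real ^ ('d + 'd) \<Rightarrow>
     real \<Rightarrow> real \<Rightarrow> (nat \<Rightarrow> real ^ ('d + 'd)) \<Rightarrow> real" where
  "num_ham s f y0 h a Y =
     (\<Sum>j<s. path_coeff f (sigma1 s f y0 h a Y) j \<bullet> (symplectic_J *v gam s f Y j))"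

definition den_ham ::
    "nat \<Rightarrow> (real ^ ('d :: finite + 'd) \<Rightarrow> real ^ ('d + 'd)) \<Rightarrow> real ^ ('d + 'd) \<Rightarrow>
     real \<Rightarrow> real \<Rightarrow> (nat \<Rightarrow> real ^ ('d + 'd)) \<Rightarrow> real" where
  "den_ham s f y0 h a Y =
     (path_coeff f (sigma1 s f y0 h a Y) 0 - path_mean f (sigma2 s f y0 h a Y))
        \<bullet> (symplectic_J *v pert s f Y 0)
     + (\<Sum>j = 1..s - 1. path_coeff f (sigma1 s f y0 h a Y) j \<bullet> (symplectic_J *v pert s f Y j))"

end

theory Submission
  imports Defs "Jordan_Normal_Form.Determinant"
begin

text \<open>With \<open>g = \<nabla>C\<close> one has \<open>g \<bullet> f = 0\<close>; case (b) is case (a) for \<open>C = H\<close>, since \<open>\<nabla>H = - J f\<close>.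
  By the integration property of \<open>X\<^sub>s\<close> the stages are \<open>Y\<^sub>i = \<sigma>\<^sub>1(c\<^sub>i h)\<close>, so \<open>\<gamma>\<^sub>j\<close> is the Gauss
  approximation of the \<open>j\<close>-th Legendre coefficient of \<open>f \<circ> \<sigma>\<^sub>1\<close>, and the numerator is, up to
  \<open>\<integral> g(\<sigma>\<^sub>1) \<bullet> f(\<sigma>\<^sub>1) = 0\<close>, the defect of a discrete Parseval identity that is exact for polynomials of
  total degree below \<open>2s\<close>. Tracking the coefficients of the powers \<open>c\<^sup>k\<close> in truncated Taylor
  expansions along \<open>\<sigma>\<^sub>1\<close> gives \<open>\<N> = O(h\<^sup>2\<^sup>s + h\<^sup>3 |\<alpha>|)\<close>.
  Integration by parts gives \<open>\<D> = \<xi>\<^sub>1 \<delta> h\<^sup>2 + O(h\<^sup>3)\<close> where \<open>\<delta> \<noteq> 0\<close> is the quantity in the nondegeneracy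
  assumption. Then \<open>\<alpha> \<D> = \<N>\<close> yields the claim.\<close>

subsection \<open>Legendre polynomials\<close>

text \<open>The obstacle is circularity: the stages and both paths depend on \<alpha>, of which only
  |\<alpha>| <= c h^2 is known in advance. Inserting this bound into the estimate of the numerator
  would lose the claim for s >= 3, so |\<alpha>| is carried along as an explicit factor. Because the
  denominator has exact order h^2, a contribution h^3 |\<alpha>| to the numerator can be absorbed
  into |\<alpha>| |D| once h is small; a contribution h^2 |\<alpha>| could not. To reach h^3
  |\<alpha>|, polynomials in c are estimated coefficientwise: the coefficient of c^k has size
  h^min(k,r) + h |\<alpha>| h^e(k). Such weights are submultiplicative up to constants, so they pass
  from the path to every truncated power series in its components. The Parseval defect sees only
  pairs c^k, c^l with k + l >= 2s. A perturbation h \<alpha> enters a path component in degree at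
  most s, so a product reaching degree 2s must raise the degree by at least s >= 2 through other
  factors, and these bring the two missing powers of h.\<close>

definition antideriv :: "real poly \<Rightarrow> real poly" where
  "antideriv p = (\<Sum>i\<le>degree p. monom (coeff p i / (real i + 1)) (i + 1))"

lemma coeff_antideriv:
  "coeff (antideriv p) k = (if k = 0 then 0 else coeff p (k - 1) / real k)"
proof (cases k)
  case (Suc m)
  have "coeff (antideriv p) k = (\<Sum>i\<le>degree p. if i = m then coeff p m / real k else 0)"
    unfolding antideriv_def coeff_sum Suc by (intro sum.cong) auto
  also have "\<dots> = (if m \<le> degree p then coeff p m / real k else 0)"
    by (subst sum.delta) auto
  finally show ?thesis using Suc by (auto simp: coeff_eq_0)
qed (simp add: antideriv_def coeff_sum)

lemma pderiv_antideriv [simp]: "pderiv (antideriv p) = p"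
  by (intro poly_eqI) (simp add: coeff_pderiv coeff_antideriv del: of_nat_Suc)

lemma poly_antideriv_0 [simp]: "poly (antideriv p) 0 = 0"
  by (simp add: poly_0_coeff_0 coeff_antideriv)

lemma degree_antideriv_le: "degree (antideriv p) \<le> degree p + 1"
  by (intro degree_le) (auto simp: coeff_antideriv coeff_eq_0)

lemma antideriv_add: "antideriv (p + q) = antideriv p + antideriv q"
  by (intro poly_eqI) (simp add: coeff_antideriv add_divide_distrib)

lemma antideriv_smult: "antideriv (smult c p) = smult c (antideriv p)"
  by (intro poly_eqI) (simp add: coeff_antideriv)

lemma antideriv_0 [simp]: "antideriv 0 = 0"
  by (intro poly_eqI) (simp add: coeff_antideriv)

lemma antideriv_sum: "antideriv (\<Sum>i\<in>A. p i) = (\<Sum>i\<in>A. antideriv (p i))"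
  by (induction A rule: infinite_finite_induct) (auto simp: antideriv_add)

lemma antideriv_pderiv: "antideriv (pderiv p) = p - [:poly p 0:]"
  by (intro poly_eqI) (auto simp: coeff_antideriv coeff_pderiv poly_0_coeff_0 coeff_pCons split: nat.split)

lemma has_integral_poly:
  assumes "0 \<le> c" shows "(poly p has_integral poly (antideriv p) c) {0..c}"
proof -
  have "(poly p has_integral poly (antideriv p) c - poly (antideriv p) 0) {0..c}"
  proof (rule fundamental_theorem_of_calculus[OF assms])
    fix x
    have "(poly (antideriv p) has_field_derivative poly p x) (at x)"
      using poly_DERIV[of "antideriv p" x] by simp
    then show "(poly (antideriv p) has_vector_derivative poly p x) (at x within {0..c})"
      by (auto simp: has_real_derivative_iff_has_vector_derivative intro: has_vector_derivative_at_within)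
  qed
  then show ?thesis by simp
qed

text \<open>The integral over [0,1] as an algebraic functional: linearity, orthogonality and
  integration by parts stay within polynomial arithmetic, and \<open>has_integral_unit_int\<close>
  is the bridge to the analytic integral.\<close>

definition unit_int :: "real poly \<Rightarrow> real" where
  "unit_int p = poly (antideriv p) 1"

lemma has_integral_unit_int: "(poly p has_integral unit_int p) {0..1}"
  unfolding unit_int_def by (rule has_integral_poly) simp

lemma unit_int_add: "unit_int (p + q) = unit_int p + unit_int q"
  and unit_int_smult: "unit_int (smult c p) = c * unit_int p"
  and unit_int_0 [simp]: "unit_int 0 = 0"
  by (simp_all add: unit_int_def antideriv_add antideriv_smult)

lemma unit_int_diff: "unit_int (p - q) = unit_int p - unit_int q"
  using unit_int_add[of p "smult (-1) q"] unit_int_smult[of "-1" q] by simp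

lemma unit_int_sum: "unit_int (\<Sum>i\<in>A. p i) = (\<Sum>i\<in>A. unit_int (p i))"
  by (simp add: unit_int_def antideriv_sum poly_sum)

lemma unit_int_pderiv: "unit_int (pderiv p) = poly p 1 - poly p 0"
  by (simp add: unit_int_def antideriv_pderiv)

lemma unit_int_by_parts:
  "unit_int (pderiv p * q) = poly p 1 * poly q 1 - poly p 0 * poly q 0 - unit_int (p * pderiv q)"
  using unit_int_pderiv[of "p * q"] by (simp add: pderiv_mult unit_int_add algebra_simps)

lemma poly_eq_0_if_zero_on_unit_interval:
  fixes p :: "real poly"
  assumes "\<And>x. x \<in> {0..1} \<Longrightarrow> poly p x = 0" shows "p = 0"
proof (rule ccontr)
  assume "p \<noteq> 0"
  then have "finite {x. poly p x = 0}" by (rule poly_roots_finite)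
  moreover have "{0..1} \<subseteq> {x. poly p x = 0}" using assms by auto
  ultimately have "finite {0..1::real}" by (rule rev_finite_subset)
  then show False using infinite_Icc[of "0::real" 1] by simp
qed

lemma unit_int_nonneg_eq_0:
  assumes "\<And>x. x \<in> {0..1} \<Longrightarrow> 0 \<le> poly p x" and "unit_int p = 0"
  shows "p = 0"
proof -
  have "integral {0..1} (poly p) = 0"
    using has_integral_unit_int[of p] assms(2) by (simp add: integral_unique)
  then have "\<forall>x\<in>{0..1}. poly p x = 0"
    using integral_eq_0_iff[of 0 1 "poly p"] assms(1) by (simp add: continuous_on_poly)
  then show ?thesis using poly_eq_0_if_zero_on_unit_interval by blast
qed

lemma unit_int_square_pos:
  assumes "p \<noteq> 0" shows "0 < unit_int (p * p)"
proof -
  have "0 \<le> unit_int (p * p)"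
    by (rule has_integral_nonneg[OF has_integral_unit_int]) simp
  moreover have "unit_int (p * p) \<noteq> 0"
    using unit_int_nonneg_eq_0[of "p * p"] assms by auto
  ultimately show ?thesis by simp
qed

section \<open>Orthonormal polynomial families: uniqueness and existence\<close>

definition orthonormal_polys :: "(nat \<Rightarrow> real poly) \<Rightarrow> bool" where
  "orthonormal_polys P \<longleftrightarrow> (\<forall>j. degree (P j) = j \<and> lead_coeff (P j) > 0 \<and>
     (\<forall>i. unit_int (P i * P j) = of_bool (i = j)))"

text \<open>Triangular elimination: a multiple of \<open>P n\<close> cancels the top coefficient and
  leaves a smaller degree. The alternative \<open>p = 0\<close> is stated separately because the
  zero polynomial has degree 0, so that \<open>n = 0\<close> leaves just the empty sum.\<close>

lemma poly_in_span_lower: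
  fixes P :: "nat \<Rightarrow> real poly"
  assumes "\<And>j. j < n \<Longrightarrow> degree (P j) = j" "\<And>j. j < n \<Longrightarrow> P j \<noteq> 0"
    and "p = 0 \<or> degree p < n"
  shows "\<exists>c. p = (\<Sum>j<n. smult (c j) (P j))"
  using assms
proof (induction n arbitrary: p)
  case 0
  then show ?case by auto
next
  case (Suc n)
  let ?r = "coeff p n / lead_coeff (P n)"
  let ?q = "p - smult ?r (P n)"
  have dP: "degree (P n) = n" "P n \<noteq> 0" using Suc.prems by auto
  then have lc: "coeff (P n) n \<noteq> 0" by (metis leading_coeff_0_iff)
  have "degree p \<le> n" using Suc.prems(3) by auto
  have co: "coeff ?q i = 0" if "i \<ge> n" for i
    using that lc dP \<open>degree p \<le> n\<close> by (cases "i = n") (auto simp: coeff_eq_0)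
  have "?q = 0 \<or> degree ?q < n"
    by (metis co leading_coeff_0_iff not_le)
  then obtain c where c: "?q = (\<Sum>j<n. smult (c j) (P j))"
    using Suc.IH[of ?q] Suc.prems by auto
  have "p = (\<Sum>j<Suc n. smult ((c(n := ?r)) j) (P j))"
    using c by (simp add: algebra_simps)
  then show ?case by blast
qed

lemma orthonormal_polysD:
  assumes "orthonormal_polys P"
  shows "degree (P j) = j" "lead_coeff (P j) > 0" "unit_int (P i * P j) = of_bool (i = j)" "P j \<noteq> 0"
proof -
  show "degree (P j) = j" and lc: "lead_coeff (P j) > 0" and "unit_int (P i * P j) = of_bool (i = j)"
    using assms unfolding orthonormal_polys_def by blast+
  show "P j \<noteq> 0" using lc by auto
qed

lemma orthonormal_polys_expansion:
  assumes P: "orthonormal_polys P" and "p = 0 \<or> degree p < n"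
  shows "p = (\<Sum>j<n. smult (unit_int (P j * p)) (P j))"
proof -
  obtain c where c: "p = (\<Sum>j<n. smult (c j) (P j))"
    using poly_in_span_lower[of n P p] orthonormal_polysD[OF P] assms(2) by blast
  have "unit_int (P k * p) = c k" if "k < n" for k
  proof -
    have "unit_int (P k * p) = (\<Sum>j<n. c j * unit_int (P k * P j))"
      unfolding c by (simp add: sum_distrib_left unit_int_sum unit_int_smult)
    also have "\<dots> = (\<Sum>j<n. if j = k then c k else 0)"
      by (intro sum.cong) (auto simp: orthonormal_polysD(3)[OF P])
    finally show ?thesis using that by simp
  qed
  then show ?thesis using c by simp
qed

lemma orthonormal_polys_orth_lower:
  assumes P: "orthonormal_polys P" and "p = 0 \<or> degree p < n"
  shows "unit_int (P n * p) = 0"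
proof -
  have "unit_int (P n * p) = unit_int (P n * (\<Sum>j<n. smult (unit_int (P j * p)) (P j)))"
    using orthonormal_polys_expansion[OF assms] by simp
  also have "\<dots> = (\<Sum>j<n. unit_int (P j * p) * unit_int (P n * P j))"
    by (simp add: sum_distrib_left unit_int_sum unit_int_smult)
  also have "\<dots> = 0"
    by (intro sum.neutral) (auto simp: orthonormal_polysD(3)[OF P])
  finally show ?thesis .
qed

text \<open>After scaling to equal leading coefficients the difference \<open>d\<close> has degree
  below \<open>n\<close>, hence is orthogonal to both \<open>P n\<close> and \<open>Q n\<close> and
  so to itself. Normalisation gives \<open>r * r = 1\<close>, and the positive leading coefficients
  exclude -1.\<close>

lemma orthonormal_polys_unique:
  assumes P: "orthonormal_polys P" and Q: "orthonormal_polys Q"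
  shows "P = Q"
proof
  fix n
  define r where "r = lead_coeff (Q n) / lead_coeff (P n)"
  have "r > 0" using orthonormal_polysD(2)[OF P] orthonormal_polysD(2)[OF Q] by (simp add: r_def)
  define d where "d = Q n - smult r (P n)"
  have co: "coeff d i = 0" if "i \<ge> n" for i
    using that orthonormal_polysD(1,2)[OF P, of n] orthonormal_polysD(1)[OF Q, of n]
    by (cases "i = n") (auto simp: d_def r_def coeff_eq_0)
  have d: "d = 0 \<or> degree d < n"
    by (metis co leading_coeff_0_iff not_le)
  have "d * d = Q n * d - smult r (P n * d)"
    by (subst (1) d_def) (simp add: left_diff_distrib)
  then have "unit_int (d * d) = unit_int (Q n * d) - r * unit_int (P n * d)"
    by (simp add: unit_int_diff unit_int_smult)
  also have "\<dots> = 0"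
    using orthonormal_polys_orth_lower[OF P d] orthonormal_polys_orth_lower[OF Q d] by simp
  finally have "d = 0" using unit_int_square_pos[of d] by auto
  then have Qn: "Q n = smult r (P n)" by (simp add: d_def)
  have "1 = r * r"
    using orthonormal_polysD(3)[OF Q, of n n] orthonormal_polysD(3)[OF P, of n n]
    unfolding Qn by (simp add: unit_int_smult)
  then have "r = 1" using \<open>r > 0\<close> square_eq_1_iff[of r] by auto
  then show "P n = Q n" using Qn by simp
qed

text \<open>Existence witness for the definite description in \<open>legendre_def\<close>. Mapping
  over the list \<open>[0..<n]\<close> makes the recursive calls visibly smaller for the termination
  proof.\<close>

fun gram_schmidt_poly :: "nat \<Rightarrow> real poly" where
  "gram_schmidt_poly n =
     (let q = monom 1 n - (\<Sum>p\<leftarrow>map gram_schmidt_poly [0..<n]. smult (unit_int (monom 1 n * p)) p)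
      in smult (1 / sqrt (unit_int (q * q))) q)"

declare gram_schmidt_poly.simps [simp del]

lemma gram_schmidt_poly_aux:
  "degree (gram_schmidt_poly n) = n \<and> lead_coeff (gram_schmidt_poly n) > 0 \<and>
   unit_int (gram_schmidt_poly n * gram_schmidt_poly n) = 1 \<and>
   (\<forall>i<n. unit_int (gram_schmidt_poly i * gram_schmidt_poly n) = 0)"
proof (induction n rule: less_induct)
  case (less n)
  let ?G = gram_schmidt_poly
  define u where "u = (\<Sum>i<n. smult (unit_int (monom 1 n * ?G i)) (?G i))"
  define q where "q = monom 1 n - u"
  have G: "?G n = smult (1 / sqrt (unit_int (q * q))) q"
    by (subst gram_schmidt_poly.simps)
      (simp add: q_def u_def Let_def o_def sum_list_sum_nth atLeast0LessThan)
  have cu: "coeff u k = 0" if "k \<ge> n" for k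
    unfolding u_def coeff_sum using that less.IH by (intro sum.neutral) (auto simp: coeff_eq_0)
  have cq: "coeff q n = 1" "\<And>k. k > n \<Longrightarrow> coeff q k = 0"
    using cu by (auto simp: q_def)
  have dq: "degree q = n"
    by (metis cq leading_coeff_neq_0 le_degree le_less linorder_neqE_nat zero_neq_one degree_0 not_less0)
  have "q \<noteq> 0" using cq by auto
  then have pos: "unit_int (q * q) > 0" by (rule unit_int_square_pos)
  have orth: "unit_int (?G i * q) = 0" if "i < n" for i
  proof -
    have "unit_int (?G i * u) = (\<Sum>j<n. unit_int (monom 1 n * ?G j) * unit_int (?G i * ?G j))"
      by (simp add: u_def sum_distrib_left unit_int_sum unit_int_smult)
    also have "\<dots> = (\<Sum>j<n. if j = i then unit_int (monom 1 n * ?G i) else 0)"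
    proof (intro sum.cong refl)
      fix j assume "j \<in> {..<n}"
      then consider "j = i" | "j < i" | "i < j" "j < n" by force
      then show "unit_int (monom 1 n * ?G j) * unit_int (?G i * ?G j) =
          (if j = i then unit_int (monom 1 n * ?G i) else 0)"
      proof cases
        case 2
        then have "unit_int (?G j * ?G i) = 0" using less.IH[OF that] by blast
        then show ?thesis using 2 by (simp add: mult.commute[of "?G i" "?G j"])
      qed (use less.IH[of i] less.IH[of j] that in auto)
    qed
    also have "\<dots> = unit_int (monom 1 n * ?G i)" using that by simp
    finally show ?thesis by (simp add: q_def right_diff_distrib unit_int_diff mult.commute)
  qed
  have "unit_int (?G n * ?G n) = 1"
    using pos by (simp add: G unit_int_smult real_sqrt_mult_self)
  moreover have "\<forall>i<n. unit_int (?G i * ?G n) = 0"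
    using orth by (simp add: G unit_int_smult)
  moreover have "lead_coeff (?G n) > 0" "degree (?G n) = n"
    using pos dq cq(1) by (simp_all add: G)
  ultimately show ?case by blast
qed

lemma orthonormal_polys_gram_schmidt: "orthonormal_polys gram_schmidt_poly"
  unfolding orthonormal_polys_def
proof (intro allI conjI)
  fix i j :: nat
  consider "i = j" | "i < j" | "j < i" by force
  then show "unit_int (gram_schmidt_poly i * gram_schmidt_poly j) = of_bool (i = j)"
    using gram_schmidt_poly_aux[of i] gram_schmidt_poly_aux[of j]
    by cases (auto simp: mult.commute)
next
  fix j
  show "degree (gram_schmidt_poly j) = j" "lead_coeff (gram_schmidt_poly j) > 0"
    using gram_schmidt_poly_aux[of j] by blast+
qed

text \<open>Existence and uniqueness together discharge the \<open>THE\<close> in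
  \<open>legendre_def\<close>; from here on only the orthonormality properties are used.\<close>

lemma orthonormal_polys_legendre: "orthonormal_polys legendre"
proof -
  have "integral {0..1} (\<lambda>x. poly p x * poly q x) = unit_int (p * q)" for p q
    using integral_unique[OF has_integral_unit_int[of "p * q"]] by (simp add: poly_mult[abs_def])
  then have "legendre = (THE P. orthonormal_polys P)"
    unfolding legendre_def orthonormal_polys_def by simp
  moreover have "\<exists>!P. orthonormal_polys P"
    using orthonormal_polys_gram_schmidt orthonormal_polys_unique by blast
  ultimately show ?thesis by (metis theI')
qed

lemmas degree_legendre [simp] = orthonormal_polysD(1)[OF orthonormal_polys_legendre]
  and lead_coeff_legendre = orthonormal_polysD(2)[OF orthonormal_polys_legendre]
  and unit_int_legendre = orthonormal_polysD(3)[OF orthonormal_polys_legendre]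
  and legendre_neq_0 [simp] = orthonormal_polysD(4)[OF orthonormal_polys_legendre]
  and legendre_expansion = orthonormal_polys_expansion[OF orthonormal_polys_legendre]
  and legendre_orth_lower = orthonormal_polys_orth_lower[OF orthonormal_polys_legendre]

section \<open>Antiderivatives of Legendre polynomials and values at 1\<close>

lemma unit_int_monom: "unit_int (monom c k) = c / (real k + 1)"
proof -
  have "antideriv (monom c k) = monom (c / (real k + 1)) (k + 1)"
    by (intro poly_eqI) (auto simp: coeff_antideriv)
  then show ?thesis by (simp add: unit_int_def poly_monom)
qed

lemma unit_int_1 [simp]: "unit_int 1 = 1"
  using unit_int_monom[of 1 0] by simp

lemma legendre_0 [simp]: "legendre 0 = 1"
proof -
  obtain a where a: "legendre 0 = [:a:]"
    using degree_legendre[of 0] by (metis degree_0_id of_nat_0)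
  have "[:a:] * [:a:] = smult (a * a) 1" by simp
  then have "a * a = 1"
    using unit_int_legendre[of 0 0] unit_int_smult[of "a * a" 1] unfolding a by simp
  moreover have "a > 0" using lead_coeff_legendre[of 0] unfolding a by simp
  ultimately have "a = 1" using square_eq_1_iff[of a] by auto
  then show ?thesis by (simp add: a)
qed

lemma unit_int_legendre_eq: "unit_int (legendre j) = of_bool (j = 0)"
  using unit_int_legendre[of 0 j] by auto

lemma antideriv_legendre_1: "poly (antideriv (legendre j)) 1 = of_bool (j = 0)"
  using unit_int_legendre_eq[of j] by (simp add: unit_int_def)

text \<open>The left side is the integral of the derivative of a product of two antiderivatives.
  Both factors vanish at 0, and at 1 each vanishes unless its index is 0. This is why
  \<open>X_mat\<close> is skew except for its corner entry.\<close>

lemma antideriv_legendre_skew: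
  "unit_int (legendre k * antideriv (legendre j)) + unit_int (legendre j * antideriv (legendre k))
     = of_bool (j = 0 \<and> k = 0)"
  using unit_int_pderiv[of "antideriv (legendre j) * antideriv (legendre k)"]
  by (simp add: pderiv_mult unit_int_add antideriv_legendre_1 mult.commute)

text \<open>The first integral vanishes for degree reasons, the second then follows by
  skew-symmetry.\<close>

lemma antideriv_legendre_orth:
  assumes "k > j + 1"
  shows "unit_int (legendre k * antideriv (legendre j)) = 0"
    and "unit_int (legendre j * antideriv (legendre k)) = 0"
proof -
  show 1: "unit_int (legendre k * antideriv (legendre j)) = 0"
    using legendre_orth_lower[of "antideriv (legendre j)" k] degree_antideriv_le[of "legendre j"] assms
    by simp
  show "unit_int (legendre j * antideriv (legendre k)) = 0"
    using antideriv_legendre_skew[of k j] 1 assms by simp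
qed

text \<open>The recurrence coefficient before its value is known; \<open>legendre_eta_eq_xi\<close>
  identifies it with \<open>xi\<close>. Only positive indices are meaningful, since at 0 the
  truncated subtraction pairs \<open>legendre 0\<close> with its own antiderivative.\<close>

definition legendre_eta :: "nat \<Rightarrow> real" where
  "legendre_eta j = unit_int (legendre j * antideriv (legendre (j - 1)))"

text \<open>The antiderivative has degree at most j + 1 and is orthogonal to everything below j - 1.
  The diagonal coordinate vanishes by skew-symmetry, except that it is 1/2 for j = 0.\<close>

lemma antideriv_legendre_eta:
  "antideriv (legendre j) =
     (if j = 0 then smult (1/2) (legendre 0) else smult (- legendre_eta j) (legendre (j - 1)))
     + smult (legendre_eta (j + 1)) (legendre (j + 1))"
proof -
  let ?L = "antideriv (legendre j)"
  have "?L = (\<Sum>k<j+2. smult (unit_int (legendre k * ?L)) (legendre k))"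
    using degree_antideriv_le[of "legendre j"] by (intro legendre_expansion) simp
  also have "\<dots> = (\<Sum>k\<le>j. smult (unit_int (legendre k * ?L)) (legendre k))
      + smult (legendre_eta (j + 1)) (legendre (j + 1))"
    by (simp add: legendre_eta_def lessThan_Suc_atMost)
  also have "(\<Sum>k\<le>j. smult (unit_int (legendre k * ?L)) (legendre k)) =
     (if j = 0 then smult (1/2) (legendre 0) else smult (- legendre_eta j) (legendre (j - 1)))"
  proof (cases j)
    case 0
    then show ?thesis using antideriv_legendre_skew[of 0 0] by simp
  next
    case (Suc m)
    have "unit_int (legendre j * ?L) = 0"
      using antideriv_legendre_skew[of j j] Suc by simp
    moreover have "unit_int (legendre m * ?L) = - legendre_eta j"
      using antideriv_legendre_skew[of m j] Suc by (simp add: legendre_eta_def)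
    moreover have "(\<Sum>k<m. smult (unit_int (legendre k * ?L)) (legendre k)) = 0"
      using antideriv_legendre_orth(2) Suc by (intro sum.neutral) simp
    ultimately show ?thesis
      by (simp add: Suc lessThan_Suc_atMost[symmetric])
  qed
  finally show ?thesis .
qed

text \<open>Comparison of the coefficients of degree j + 1 in \<open>antideriv_legendre_eta\<close>,
  both leading coefficients being positive.\<close>

lemma legendre_eta_pos: "legendre_eta (j + 1) > 0"
proof -
  have "coeff (antideriv (legendre j)) (j + 1) = legendre_eta (j + 1) * lead_coeff (legendre (j + 1))"
    by (subst antideriv_legendre_eta) (simp add: coeff_eq_0)
  then have "lead_coeff (legendre j) / real (j + 1) = legendre_eta (j + 1) * lead_coeff (legendre (j + 1))"
    by (simp add: coeff_antideriv)
  then have "0 < legendre_eta (j + 1) * lead_coeff (legendre (j + 1))"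
    using lead_coeff_legendre[of j] by (metis divide_pos_pos of_nat_0_less_iff zero_less_Suc Suc_eq_plus1)
  then show ?thesis
    using lead_coeff_legendre[of "j + 1"] by (simp add: zero_less_mult_iff)
qed

text \<open>Since x P' - j P has degree below j, the integral of P x P' equals j. Integrating (x
  P^2)' = P^2 + 2 x P P' over [0,1] then gives 1 + 2j as boundary value.\<close>

lemma legendre_1_square: "(poly (legendre j) 1)\<^sup>2 = 2 * real j + 1"
proof -
  let ?P = "legendre j"
  define r where "r = [:0, 1:] * pderiv ?P - smult (real j) ?P"
  have co: "coeff r i = 0" if "i \<ge> j" for i
  proof (cases "i = j")
    case True
    then show ?thesis by (cases j) (auto simp: r_def coeff_pCons coeff_pderiv split: nat.splits)
  next
    case False
    then have "coeff ?P i = 0" "coeff (pderiv ?P) (i - 1) = 0"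
      using that by (auto simp: coeff_eq_0 coeff_pderiv)
    then show ?thesis using False that
      by (auto simp: r_def coeff_pCons split: nat.splits)
  qed
  have "r = 0 \<or> degree r < j"
    by (metis co leading_coeff_0_iff not_le)
  then have "unit_int (?P * r) = 0" by (rule legendre_orth_lower)
  then have e: "unit_int (?P * ([:0, 1:] * pderiv ?P)) = real j"
    using unit_int_legendre[of j j]
    by (simp add: r_def right_diff_distrib unit_int_diff unit_int_smult)
  define x where "x = [:0, 1::real:]"
  have x: "pderiv x = 1" "poly x 1 = 1" "poly x 0 = 0"
    by (simp_all add: x_def pderiv_pCons)
  have "pderiv (x * (?P * ?P)) = ?P * ?P + (?P * (x * pderiv ?P) + ?P * (x * pderiv ?P))"
    by (simp add: pderiv_mult x(1) algebra_simps)
  then have "unit_int (pderiv (x * (?P * ?P))) = 1 + (real j + real j)"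
    by (simp only: unit_int_add e[folded x_def] unit_int_legendre) simp
  then have "poly x 1 * (poly ?P 1 * poly ?P 1) = 1 + (real j + real j)"
    unfolding unit_int_pderiv by (simp add: x)
  then show ?thesis by (simp add: x power2_eq_square)
qed

text \<open>Evaluation of \<open>antideriv_legendre_eta\<close> at 1, where the antiderivative is 1
  for index 0 and 0 otherwise.\<close>

lemma legendre_1_recursion:
  "legendre_eta 1 * poly (legendre 1) 1 = 1 / 2"
  "legendre_eta (j + 2) * poly (legendre (j + 2)) 1 = legendre_eta (j + 1) * poly (legendre j) 1"
proof -
  show "legendre_eta 1 * poly (legendre 1) 1 = 1 / 2"
    using antideriv_legendre_1[of 0] arg_cong[OF antideriv_legendre_eta[of 0], of "\<lambda>p. poly p 1"]
    by simp
  show "legendre_eta (j + 2) * poly (legendre (j + 2)) 1 = legendre_eta (j + 1) * poly (legendre j) 1"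
    using antideriv_legendre_1[of "j + 1"]
      arg_cong[OF antideriv_legendre_eta[of "j + 1"], of "\<lambda>p. poly p 1"]
    by simp
qed

text \<open>Selects the positive square root in \<open>legendre_1_square\<close>. The recursion at 1
  has step two, hence the two base cases.\<close>

lemma legendre_1_pos: "poly (legendre j) 1 > 0"
proof (induction j rule: less_induct)
  case (less j)
  consider "j = 0" | "j = 1" | m where "j = m + 2"
    by (metis One_nat_def add_2_eq_Suc' not0_implies_Suc)
  then show ?case
  proof cases
    case 2
    then show ?thesis using legendre_1_recursion(1) legendre_eta_pos[of 0]
      by (smt (verit) add_0 mult_nonneg_nonpos half_gt_zero_iff)
  next
    case 3
    then have "legendre_eta (m + 2) * poly (legendre j) 1 > 0"
      using legendre_1_recursion(2)[of m] legendre_eta_pos[of m] less.IH[of m] by simp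
    then show ?thesis using legendre_eta_pos[of "m + 1"] by (simp add: zero_less_mult_iff)
  qed simp
qed

lemma poly_legendre_1: "poly (legendre j) 1 = sqrt (2 * real j + 1)"
  using legendre_1_square[of j] legendre_1_pos[of j] real_sqrt_unique by fastforce

lemma xi_0 [simp]: "xi 0 = 1 / 2"
  by (simp add: xi_def)

lemma xi_Suc: "xi (j + 1) = 1 / (2 * (sqrt (2 * real j + 1) * sqrt (2 * real j + 3)))"
proof -
  have "\<bar>4 * (real (j + 1))\<^sup>2 - 1\<bar> = (2 * real j + 1) * (2 * real j + 3)"
    by (simp add: power2_eq_square algebra_simps)
  then show ?thesis unfolding xi_def by (simp add: real_sqrt_mult)
qed

lemma xi_pos: "xi j > 0"
proof (cases j)
  case (Suc m)
  then show ?thesis using xi_Suc[of m] by simp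
qed simp

text \<open>With P_j(1) = sqrt(2j + 1) the recursion at 1 determines each coefficient from the
  previous one, and \<open>xi\<close> obeys the same recursion.\<close>

lemma legendre_eta_eq_xi: "legendre_eta (j + 1) = xi (j + 1)"
proof (induction j)
  case 0
  have "legendre_eta 1 * sqrt 3 = 1 / 2"
    using legendre_1_recursion(1) by (simp add: poly_legendre_1)
  then have "legendre_eta 1 = 1 / (2 * sqrt 3)" by (simp add: field_simps)
  then show ?case using xi_Suc[of 0] by simp
next
  case (Suc j)
  define a b c where "a = sqrt (2 * real j + 1)" and "b = sqrt (2 * real j + 3)"
    and "c = sqrt (2 * real j + 5)"
  have pos: "a > 0" "b > 0" "c > 0" by (simp_all add: a_def b_def c_def)
  have "poly (legendre (j + 2)) 1 = c"
    unfolding poly_legendre_1 c_def by (rule arg_cong[where f = sqrt]) simp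
  then have "legendre_eta (j + 2) * c = xi (j + 1) * a"
    using legendre_1_recursion(2)[of j] Suc by (simp add: poly_legendre_1 a_def)
  moreover have "xi (j + 1) = 1 / (2 * (a * b))"
    unfolding xi_Suc a_def b_def ..
  moreover have "xi (j + 2) = 1 / (2 * (b * c))"
    using xi_Suc[of "Suc j"] by (simp add: b_def c_def add.commute)
  ultimately have "legendre_eta (j + 2) * c = xi (j + 2) * c"
    using pos by simp
  then show ?case using pos by simp
qed

lemma antideriv_legendre:
  "antideriv (legendre j) =
     (if j = 0 then smult (xi 0) (legendre 0) else smult (- xi j) (legendre (j - 1)))
     + smult (xi (j + 1)) (legendre (j + 1))"
  using antideriv_legendre_eta[of j] legendre_eta_eq_xi[of j] legendre_eta_eq_xi[of "j - 1"]
  by (cases j) simp_all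

text \<open>The integration property: column j of \<open>X_mat s\<close> holds the Legendre
  coordinates of the antiderivative of P_j. Cutting off at size s loses only a multiple of P_s in
  the last column, and that vanishes at the Gauss nodes.\<close>

lemma antideriv_legendre_X_mat:
  assumes "j < s"
  shows "antideriv (legendre j) = (\<Sum>k<s. smult (X_mat s $$ (k, j)) (legendre k))
     + (if j = s - 1 then smult (xi s) (legendre s) else 0)"
proof -
  have "(\<Sum>k<s. smult (X_mat s $$ (k, j)) (legendre k)) =
    (\<Sum>k<s. (if k = j + 1 then smult (xi (j + 1)) (legendre (j + 1)) else 0)
      + (if k = j - 1 then (if j = 0 then smult (xi 0) (legendre 0) else smult (- xi j) (legendre (j - 1))) else 0))"
    using assms by (intro sum.cong) (auto simp: X_mat_def)
  also have "\<dots> = (if j + 1 < s then smult (xi (j + 1)) (legendre (j + 1)) else 0)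
      + (if j = 0 then smult (xi 0) (legendre 0) else smult (- xi j) (legendre (j - 1)))"
    unfolding sum.distrib sum.delta[OF finite_lessThan] using assms by auto
  finally show ?thesis using assms antideriv_legendre[of j] by (cases "j + 1 < s") auto
qed

subsection \<open>Gauss quadrature\<close>

lemma poly_no_root_const_sign:
  fixes p :: "real poly"
  assumes "\<And>x. 0 < x \<Longrightarrow> x < 1 \<Longrightarrow> poly p x \<noteq> 0"
  shows "(\<forall>x\<in>{0..1}. 0 \<le> poly p x) \<or> (\<forall>x\<in>{0..1}. poly p x \<le> 0)"
proof (rule ccontr)
  assume "\<not> ?thesis"
  then obtain x y where xy: "x \<in> {0..1}" "y \<in> {0..1}" "poly p x < 0" "0 < poly p y"
    by (auto simp: not_le)
  then consider "x < y" | "y < x" by fastforce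
  then show False
  proof cases
    case 1
    then obtain z where "x < z" "z < y" "poly p z = 0" using poly_IVT_pos[of x y p] xy by auto
    then show False using assms[of z] xy by auto
  next
    case 2
    then obtain z where "y < z" "z < x" "poly p z = 0" using poly_IVT_neg[of y x p] xy by auto
    then show False using assms[of z] xy by auto
  qed
qed

text \<open>\<open>R\<close> consists of the roots of odd multiplicity; splitting off one linear factor at a time
  toggles membership.\<close>

lemma sign_change_roots:
  fixes p :: "real poly"
  assumes "p \<noteq> 0"
  shows "\<exists>R. finite R \<and> R \<subseteq> {x. poly p x = 0} \<inter> {0<..<1} \<and>
    ((\<forall>x\<in>{0..1}. 0 \<le> poly (p * (\<Prod>r\<in>R. [:- r, 1:])) x) \<or>
     (\<forall>x\<in>{0..1}. poly (p * (\<Prod>r\<in>R. [:- r, 1:])) x \<le> 0))"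
  using assms
proof (induction "degree p" arbitrary: p rule: less_induct)
  case less
  show ?case
  proof (cases "\<exists>r. 0 < r \<and> r < 1 \<and> poly p r = 0")
    case False
    then show ?thesis using poly_no_root_const_sign[of p] by (intro exI[of _ "{}"]) auto
  next
    case True
    then obtain r where r: "0 < r" "r < 1" "poly p r = 0" by blast
    then obtain q where q: "p = [:- r, 1:] * q" by (metis poly_eq_0_iff_dvd dvdE)
    then have "q \<noteq> 0" using less.prems by auto
    then have "degree p = Suc (degree q)" unfolding q by (subst degree_mult_eq) auto
    then obtain R where R: "finite R" "R \<subseteq> {x. poly q x = 0} \<inter> {0<..<1}"
      and sgn: "(\<forall>x\<in>{0..1}. 0 \<le> poly (q * (\<Prod>r\<in>R. [:- r, 1:])) x) \<or>
        (\<forall>x\<in>{0..1}. poly (q * (\<Prod>r\<in>R. [:- r, 1:])) x \<le> 0)"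
      using less.hyps[of q] \<open>q \<noteq> 0\<close> by auto
    show ?thesis
    proof (cases "r \<in> R")
      case True
      then have "(\<Prod>r\<in>R. [:- r, 1:]) = [:- r, 1:] * (\<Prod>r\<in>R - {r}. [:- r, 1:])"
        using R(1) by (simp add: prod.remove)
      then have "p * (\<Prod>r\<in>R - {r}. [:- r, 1:]) = q * (\<Prod>r\<in>R. [:- r, 1:])"
        unfolding q by (simp only: mult_ac)
      then show ?thesis using R sgn by (intro exI[of _ "R - {r}"]) (auto simp: q)
    next
      case False
      then have "(\<Prod>r\<in>insert r R. [:- r, 1:]) = [:- r, 1:] * (\<Prod>r\<in>R. [:- r, 1:])"
        using R(1) by simp
      then have "p * (\<Prod>r\<in>insert r R. [:- r, 1:]) = ([:- r, 1:] * [:- r, 1:]) * (q * (\<Prod>r\<in>R. [:- r, 1:]))"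
        unfolding q by (simp only: mult_ac)
      then have e: "poly (p * (\<Prod>r\<in>insert r R. [:- r, 1:])) x
          = (x - r)\<^sup>2 * poly (q * (\<Prod>r\<in>R. [:- r, 1:])) x" for x
        by (simp only: poly_mult) (simp add: power2_eq_square algebra_simps)
      have "(\<forall>x\<in>{0..1}. 0 \<le> poly (p * (\<Prod>r\<in>insert r R. [:- r, 1:])) x) \<or>
        (\<forall>x\<in>{0..1}. poly (p * (\<Prod>r\<in>insert r R. [:- r, 1:])) x \<le> 0)"
        unfolding e using sgn by (meson mult_nonneg_nonneg mult_nonneg_nonpos zero_le_power2)
      then show ?thesis using R r by (intro exI[of _ "insert r R"]) (auto simp: q)
    qed
  qed
qed

text \<open>Let R be the set of sign changes in (0,1). The product of P_s with the linear factors of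
  R keeps one sign, so its integral cannot be zero; orthogonality to lower degrees would make it
  zero if R had fewer than s elements.\<close>

lemma legendre_roots:
  shows "card {x. poly (legendre s) x = 0} = s"
    and "{x. poly (legendre s) x = 0} \<subseteq> {0<..<1}"
    and "finite {x. poly (legendre s) x = 0}"
proof -
  let ?Z = "{x. poly (legendre s) x = 0}"
  show fin: "finite ?Z" by (simp add: poly_roots_finite)
  have le: "card ?Z \<le> s" using card_poly_roots_bound[of "legendre s"] by simp
  obtain R where R: "finite R" "R \<subseteq> ?Z \<inter> {0<..<1}"
    and sgn: "(\<forall>x\<in>{0..1}. 0 \<le> poly (legendre s * (\<Prod>r\<in>R. [:- r, 1:])) x) \<or>
        (\<forall>x\<in>{0..1}. poly (legendre s * (\<Prod>r\<in>R. [:- r, 1:])) x \<le> 0)"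
    using sign_change_roots[of "legendre s"] by auto
  let ?q = "\<Prod>r\<in>R. [:- r, 1:]"
  have q0: "?q \<noteq> 0" using R(1) by simp
  have degq: "degree ?q = card R"
    by (subst degree_prod_eq_sum_degree) auto
  have "\<not> card R < s"
  proof
    assume "card R < s"
    then have 0: "unit_int (legendre s * ?q) = 0" "unit_int (- (legendre s * ?q)) = 0"
      using legendre_orth_lower[of ?q s] degq unit_int_smult[of "- 1" "legendre s * ?q"] by simp_all
    have "legendre s * ?q = 0"
      using sgn
    proof
      assume "\<forall>x\<in>{0..1}. 0 \<le> poly (legendre s * ?q) x"
      then show ?thesis using unit_int_nonneg_eq_0[OF _ 0(1)] by blast
    next
      assume "\<forall>x\<in>{0..1}. poly (legendre s * ?q) x \<le> 0"
      then have "- (legendre s * ?q) = 0"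
        using unit_int_nonneg_eq_0[OF _ 0(2)] by (simp del: poly_mult)
      then show ?thesis by simp
    qed
    then show False using q0 by simp
  qed
  moreover have "card R \<le> card ?Z" using R fin by (intro card_mono) auto
  ultimately have eq: "card R = card ?Z" and "card ?Z = s" using le by auto
  then show "card ?Z = s" by simp
  have "R = ?Z" using R fin eq by (intro card_subset_eq) auto
  then show "?Z \<subseteq> {0<..<1}" using R by auto
qed

lemma gauss_node_bij: "bij_betw (gauss_node s) {..<s} {x. poly (legendre s) x = 0}"
  using bij_betw_nth[of "sorted_list_of_set {x. poly (legendre s) x = 0}"] legendre_roots[of s]
  unfolding gauss_node_def[abs_def] by simp

lemma poly_legendre_gauss_node: "i < s \<Longrightarrow> poly (legendre s) (gauss_node s i) = 0"
  using gauss_node_bij[of s] by (auto simp: bij_betw_def)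

lemma gauss_node_in_unit_interval: "i < s \<Longrightarrow> gauss_node s i \<in> {0..1}"
  using legendre_roots(2)[of s] poly_legendre_gauss_node[of i s] by fastforce

lemma gauss_node_eq_iff: "i < s \<Longrightarrow> j < s \<Longrightarrow> gauss_node s i = gauss_node s j \<longleftrightarrow> i = j"
  using gauss_node_bij[of s] by (auto simp: bij_betw_def inj_on_def)

section \<open>Exactness of the quadrature and a discrete Parseval identity\<close>

definition gauss_quad :: "nat \<Rightarrow> (real \<Rightarrow> real) \<Rightarrow> real" where
  "gauss_quad s u = (\<Sum>i<s. gauss_weight s i * u (gauss_node s i))"

definition gauss_lagrange :: "nat \<Rightarrow> nat \<Rightarrow> real poly" where
  "gauss_lagrange s i = (\<Prod>j\<in>{..<s} - {i}.
     smult (1 / (gauss_node s i - gauss_node s j)) [:- gauss_node s j, 1:])"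

lemma gauss_weight_eq: "gauss_weight s i = unit_int (gauss_lagrange s i)"
  unfolding gauss_weight_def
  by (rule integral_unique)
    (use has_integral_unit_int[of "gauss_lagrange s i"] in
      \<open>simp add: gauss_lagrange_def[abs_def] poly_prod[abs_def] diff_divide_distrib\<close>)

lemma poly_gauss_lagrange:
  assumes "i < s" "k < s"
  shows "poly (gauss_lagrange s i) (gauss_node s k) = of_bool (i = k)"
proof (cases "i = k")
  case True
  have "poly (smult (1 / (gauss_node s i - gauss_node s j)) [:- gauss_node s j, 1:]) (gauss_node s k) = 1"
    if "j \<in> {..<s} - {i}" for j
  proof -
    have "gauss_node s i - gauss_node s j \<noteq> 0" using that assms gauss_node_eq_iff[of i s j] by auto
    then show ?thesis using True by (simp add: diff_divide_distrib[symmetric])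
  qed
  then show ?thesis unfolding gauss_lagrange_def poly_prod
    using True by (simp only: prod.neutral_const cong: prod.cong) simp
next
  case False
  then have "k \<in> {..<s} - {i}" using assms by auto
  then show ?thesis unfolding gauss_lagrange_def poly_prod
    using False by (auto intro!: prod_zero)
qed

lemma degree_gauss_lagrange:
  assumes "i < s" shows "degree (gauss_lagrange s i) < s"
proof -
  have "degree (gauss_lagrange s i) \<le> (\<Sum>j\<in>{..<s} - {i}. 1)"
    unfolding gauss_lagrange_def
  proof (rule order.trans[OF degree_prod_sum_le])
    show "(\<Sum>j\<in>{..<s} - {i}. (degree \<circ> (\<lambda>j. smult (1 / (gauss_node s i - gauss_node s j))
        [:- gauss_node s j, 1:])) j) \<le> (\<Sum>j\<in>{..<s} - {i}. 1)"
    proof (rule sum_mono)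
      fix j
      have "degree (smult (1 / (gauss_node s i - gauss_node s j)) [:- gauss_node s j, 1:])
          \<le> degree [:- gauss_node s j, 1:]"
        by (rule degree_smult_le)
      then show "(degree \<circ> (\<lambda>j. smult (1 / (gauss_node s i - gauss_node s j)) [:- gauss_node s j, 1:])) j \<le> 1"
        by simp
    qed
  qed simp
  also have "\<dots> = s - 1" using assms by simp
  finally show ?thesis using assms by simp
qed

lemma gauss_quad_sum: "gauss_quad s (\<lambda>x. \<Sum>j\<in>A. c j * u j x) = (\<Sum>j\<in>A. c j * gauss_quad s (u j))"
  unfolding gauss_quad_def
  by (simp add: sum_distrib_left sum.swap[of _ A] mult.left_commute)

text \<open>Interpolation at the s distinct nodes reproduces \<open>p\<close>, and each weight is
  the integral of the corresponding Lagrange polynomial.\<close>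

lemma gauss_quad_exact_lower:
  assumes "degree p < s"
  shows "gauss_quad s (poly p) = unit_int p"
proof -
  have "p = (\<Sum>i<s. smult (poly p (gauss_node s i)) (gauss_lagrange s i))" (is "_ = ?q")
  proof (rule poly_eqI_degree[of "gauss_node s ` {..<s}"])
    have card: "card (gauss_node s ` {..<s}) = s"
      using bij_betw_same_card[OF gauss_node_bij[of s]] gauss_node_bij[of s] legendre_roots(1)[of s]
      by (simp add: bij_betw_def)
    show "degree p < card (gauss_node s ` {..<s})" using assms card by simp
    show "degree ?q < card (gauss_node s ` {..<s})"
      unfolding card using assms degree_gauss_lagrange
      by (intro degree_sum_less) (auto intro: le_less_trans[OF degree_smult_le])
    fix x assume "x \<in> gauss_node s ` {..<s}"
    then obtain k where k: "k < s" "x = gauss_node s k" by auto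
    have "poly ?q x = (\<Sum>i<s. if i = k then poly p x else 0)"
      unfolding poly_sum using k by (intro sum.cong) (auto simp: poly_gauss_lagrange)
    then show "poly p x = poly ?q x" using k by simp
  qed
  then have "unit_int p = (\<Sum>i<s. poly p (gauss_node s i) * gauss_weight s i)"
    by (metis (no_types, lifting) gauss_weight_eq sum.cong unit_int_smult unit_int_sum)
  then show ?thesis by (simp add: gauss_quad_def mult.commute)
qed

text \<open>Division with remainder by P_s: the multiple of P_s vanishes at all nodes, and it also
  integrates to zero because the quotient has degree below s.\<close>

lemma gauss_quad_exact:
  assumes "degree p < 2 * s"
  shows "gauss_quad s (poly p) = unit_int p"
proof -
  define d where "d = p div legendre s"
  define r where "r = p mod legendre s"
  have "s > 0" using assms by simp
  have p: "p = legendre s * d + r" by (simp add: d_def r_def)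
  have r: "degree r < s"
    using degree_mod_less[of "legendre s" p] \<open>s > 0\<close> by (auto simp: r_def)
  have d: "d = 0 \<or> degree d < s"
  proof (cases "d = 0")
    case False
    then have "degree (legendre s * d) = s + degree d" by (simp add: degree_mult_eq)
    then have "degree p = s + degree d" unfolding p using r by (subst degree_add_eq_left) auto
    then show ?thesis using assms by simp
  qed simp
  have "gauss_quad s (poly p) = gauss_quad s (poly r)"
    unfolding gauss_quad_def p by (simp add: poly_legendre_gauss_node)
  also have "\<dots> = unit_int r" using r by (rule gauss_quad_exact_lower)
  also have "\<dots> = unit_int p" unfolding p using legendre_orth_lower[OF d] by (simp add: unit_int_add)
  finally show ?thesis .
qed

text \<open>The two factors are treated differently, one by exact and one by quadrature
  coefficients, but one of them has degree below s. If it is \<open>p\<close>, its Legendre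
  expansion resums under the quadrature, which is exact for \<open>p * q\<close>. If it is
  \<open>q\<close>, its quadrature coefficients are exact and its expansion resums under the
  integral.\<close>

lemma gauss_parseval:
  assumes "degree p + degree q < 2 * s"
  shows "(\<Sum>j<s. unit_int (legendre j * p) * gauss_quad s (poly (legendre j * q))) = unit_int (p * q)"
proof (cases "degree p < s")
  case True
  have "(\<Sum>j<s. unit_int (legendre j * p) * gauss_quad s (poly (legendre j * q)))
      = gauss_quad s (\<lambda>x. \<Sum>j<s. unit_int (legendre j * p) * poly (legendre j * q) x)"
    by (simp only: gauss_quad_sum)
  also have "(\<lambda>x. \<Sum>j<s. unit_int (legendre j * p) * poly (legendre j * q) x)
      = poly ((\<Sum>j<s. smult (unit_int (legendre j * p)) (legendre j)) * q)"
    by (simp add: fun_eq_iff poly_sum sum_distrib_right)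
  also have "(\<Sum>j<s. smult (unit_int (legendre j * p)) (legendre j)) = p"
    using legendre_expansion[of p s] True by simp
  also have "gauss_quad s (poly (p * q)) = unit_int (p * q)"
    using assms degree_mult_le[of p q] by (intro gauss_quad_exact) simp
  finally show ?thesis .
next
  case False
  then have q: "degree q < s" using assms by simp
  have "gauss_quad s (poly (legendre j * q)) = unit_int (legendre j * q)" if "j < s" for j
    using degree_mult_le[of "legendre j" q] that q by (intro gauss_quad_exact) simp
  then have "(\<Sum>j<s. unit_int (legendre j * p) * gauss_quad s (poly (legendre j * q)))
      = (\<Sum>j<s. unit_int (legendre j * q) * unit_int (legendre j * p))"
    by (simp add: mult.commute)
  also have "\<dots> = unit_int ((\<Sum>j<s. smult (unit_int (legendre j * q)) (legendre j)) * p)"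
    by (simp add: sum_distrib_right unit_int_sum unit_int_smult)
  also have "(\<Sum>j<s. smult (unit_int (legendre j * q)) (legendre j)) = q"
    using legendre_expansion[of q s] q by simp
  also have "q * p = p * q" by (rule mult.commute)
  finally show ?thesis .
qed

text \<open>Exactness reduces this to orthogonality. It is the source of the orders in h of the
  \<open>gam\<close> coefficients: a term c^k of the integrand reaches the j-th coefficient only for
  k >= j.\<close>

lemma gauss_quad_legendre_lower:
  assumes "k < j" "j < s"
  shows "gauss_quad s (poly (legendre j * monom 1 k)) = 0"
proof -
  have "gauss_quad s (poly (legendre j * monom 1 k)) = unit_int (legendre j * monom 1 k)"
    using assms degree_mult_le[of "legendre j" "monom 1 k"]
    by (intro gauss_quad_exact) (simp add: degree_monom_eq)
  also have "\<dots> = 0" using assms by (intro legendre_orth_lower) (simp add: degree_monom_eq)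
  finally show ?thesis .
qed

subsection \<open>The matrix \<open>X\<^sub>s\<close>\<close>

lemma X_mat_carrier [simp]: "X_mat s \<in> carrier_mat s s"
  by (simp add: X_mat_def)

lemma X_mat_mult_index:
  assumes "v \<in> carrier_vec s" "k < s"
  shows "(X_mat s *\<^sub>v v) $ k = (\<Sum>j<s. X_mat s $$ (k, j) * v $ j)"
  using assms by (auto simp: scalar_prod_def X_mat_def atLeast0LessThan intro!: sum.cong)

text \<open>\<open>X\<close> is skew up to its first diagonal entry, so \<open>v\<^sup>T X v = v\<^sub>0\<^sup>2 / 2\<close>; the rows then kill the
  remaining entries one after the other.\<close>

lemma X_mat_kernel:
  assumes v: "v \<in> carrier_vec s" and 0: "X_mat s *\<^sub>v v = 0\<^sub>v s"
  shows "v = 0\<^sub>v s"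
proof -
  have row: "(\<Sum>j<s. X_mat s $$ (k, j) * v $ j) = 0" if "k < s" for k
    using X_mat_mult_index[OF v that] 0 that by simp
  let ?S = "\<Sum>k<s. \<Sum>j<s. v $ k * (X_mat s $$ (k, j) * v $ j)"
  have "?S = 0" using row by (simp add: sum_distrib_left[symmetric])
  have v0: "v $ 0 = 0" if "0 < s"
  proof -
    have "?S = (\<Sum>j<s. \<Sum>k<s. v $ k * (X_mat s $$ (k, j) * v $ j))" by (rule sum.swap)
    then have "?S + ?S = (\<Sum>k<s. \<Sum>j<s. v $ k * (X_mat s $$ (k, j) * v $ j))
        + (\<Sum>j<s. \<Sum>k<s. v $ k * (X_mat s $$ (k, j) * v $ j))" by (simp only:)
    also have "\<dots> = (\<Sum>k<s. \<Sum>j<s. v $ k * (X_mat s $$ (k, j) * v $ j) + v $ j * (X_mat s $$ (j, k) * v $ k))"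
      by (simp only: sum.distrib)
    also have "\<dots> = (\<Sum>k<s. \<Sum>j<s. if j = 0 then if k = 0 then (v $ 0)\<^sup>2 else 0 else 0)"
    proof (intro sum.cong refl)
      fix k j assume "k \<in> {..<s}" "j \<in> {..<s}"
      then have kj: "k < s" "j < s" by simp_all
      consider "k = 0 \<and> j = 0" | "j = k + 1" | "k = j + 1" | "\<not> (k = 0 \<and> j = 0)" "j \<noteq> k + 1" "k \<noteq> j + 1"
        by blast
      then show "v $ k * (X_mat s $$ (k, j) * v $ j) + v $ j * (X_mat s $$ (j, k) * v $ k) =
          (if j = 0 then if k = 0 then (v $ 0)\<^sup>2 else 0 else 0)"
        using kj by cases (simp_all add: X_mat_def power2_eq_square)
    qed
    also have "\<dots> = (v $ 0)\<^sup>2" using that by simp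
    finally show ?thesis using \<open>?S = 0\<close> by simp
  qed
  have "v $ k = 0" if "k < s" for k
    using that
  proof (induction k rule: less_induct)
    case (less k)
    show ?case
    proof (cases k)
      case 0
      then show ?thesis using v0 less.prems by simp
    next
      case (Suc m)
      then have m: "m < s" using less.prems by simp
      have "(\<Sum>j<s. X_mat s $$ (m, j) * v $ j) = (\<Sum>j<s. if j = k then - xi k * v $ k else 0)"
        using m Suc less.IH by (intro sum.cong) (auto simp: X_mat_def)
      then show ?thesis using row[OF m] less.prems xi_pos[of k] by simp
    qed
  qed
  then show ?thesis using v by (intro eq_vecI) auto
qed

text \<open>The trivial kernel makes \<open>X_mat s\<close> invertible, so the \<open>the\<close> in
  \<open>phi_def\<close> is applied to an actual inverse and \<open>phi s i\<close> is its i-th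
  column; the 1-based i accounts for the row i - 1.\<close>

lemma X_mat_mult_phi:
  assumes "1 \<le> i" "k < s"
  shows "(\<Sum>j<s. X_mat s $$ (k, j) * phi s i j) = of_bool (k = i - 1)"
proof -
  have "Determinant.det (X_mat s) \<noteq> 0"
    using det_0_iff_vec_prod_zero_field[OF X_mat_carrier] X_mat_kernel by blast
  then have "X_mat s \<in> Units (ring_mat TYPE(real) s ())"
    by (rule det_non_zero_imp_unit[OF X_mat_carrier])
  then obtain B where B: "mat_inverse (X_mat s) = Some B"
    using mat_inverse(1)[OF X_mat_carrier, where b = "()"] by (cases "mat_inverse (X_mat s)") auto
  then have XB: "X_mat s * B = 1\<^sub>m s" and Bc: "B \<in> carrier_mat s s"
    using mat_inverse(2)[OF X_mat_carrier] by auto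
  let ?v = "B *\<^sub>v unit_vec s (i - 1)"
  have "X_mat s *\<^sub>v ?v = (X_mat s * B) *\<^sub>v unit_vec s (i - 1)"
    by (rule assoc_mult_mat_vec[symmetric, OF X_mat_carrier Bc]) simp
  also have "\<dots> = unit_vec s (i - 1)" unfolding XB by simp
  finally have "(X_mat s *\<^sub>v ?v) $ k = of_bool (k = i - 1)" using assms by (simp add: unit_vec_def)
  moreover have "?v \<in> carrier_vec s" using Bc by auto
  ultimately show ?thesis
    using X_mat_mult_index[of ?v s k] assms B by (simp add: phi_def)
qed

lemma W_mat_index: "k < s \<Longrightarrow> j < s \<Longrightarrow>
    W_mat s $$ (k, j) = (if k = 1 \<and> j = 0 then 1 else if k = 0 \<and> j = 1 then - 1 else 0)"
  by (simp add: W_mat_def)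

text \<open>The product is associated to the right so that the factors of index j stand innermost;
  summed against f(Y_j) they become the coefficients \<open>gam\<close>.\<close>

lemma A_mat_index:
  assumes "i < s" "j < s"
  shows "A_mat s a $$ (i, j) = (\<Sum>k<s. poly (legendre k) (gauss_node s i) *
    (\<Sum>l<s. (X_mat s $$ (k, l) - a * W_mat s $$ (k, l)) *
       (gauss_weight s j * poly (legendre l) (gauss_node s j))))"
proof -
  let ?M = "X_mat s - a \<cdot>\<^sub>m W_mat s"
  have d: "P_mat s \<in> carrier_mat s s" "?M \<in> carrier_mat s s" "W_mat s \<in> carrier_mat s s"
      "transpose_mat (P_mat s) \<in> carrier_mat s s" "Omega_mat s \<in> carrier_mat s s"
    by (auto simp: P_mat_def W_mat_def Omega_mat_def X_mat_def)
  have "A_mat s a = P_mat s * (?M * (transpose_mat (P_mat s) * Omega_mat s))"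
    unfolding A_mat_def using d by (simp add: assoc_mult_mat[of _ s s _ s _ s])
  also have "\<dots> $$ (i, j) = (\<Sum>k<s. P_mat s $$ (i, k) * (\<Sum>l<s. ?M $$ (k, l) *
      (\<Sum>m<s. transpose_mat (P_mat s) $$ (l, m) * Omega_mat s $$ (m, j))))"
    using assms d by (simp add: scalar_prod_def atLeast0LessThan)
  also have "\<dots> = (\<Sum>k<s. poly (legendre k) (gauss_node s i) *
    (\<Sum>l<s. (X_mat s $$ (k, l) - a * W_mat s $$ (k, l)) *
       (gauss_weight s j * poly (legendre l) (gauss_node s j))))"
  proof (intro sum.cong arg_cong2[where f = "(*)"] refl)
    fix l assume "l \<in> {..<s}"
    then have "(\<Sum>m<s. transpose_mat (P_mat s) $$ (l, m) * Omega_mat s $$ (m, j)) =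
       (\<Sum>m<s. if m = j then gauss_weight s j * poly (legendre l) (gauss_node s j) else 0)"
      using assms by (intro sum.cong) (auto simp: P_mat_def Omega_mat_def mat_diag_def)
    then show "(\<Sum>m<s. transpose_mat (P_mat s) $$ (l, m) * Omega_mat s $$ (m, j)) =
       gauss_weight s j * poly (legendre l) (gauss_node s j)"
      using assms by simp
  qed (use assms d in \<open>auto simp: P_mat_def X_mat_def W_mat_def\<close>)
  finally show ?thesis .
qed

text \<open>The polynomial whose Legendre coordinates are the i-th column of the inverse of
  \<open>X_mat s\<close>. As \<open>X_mat s\<close> represents integration, this is a derivative of
  P_(i-1) modulo P_s.\<close>

definition phi_poly :: "nat \<Rightarrow> nat \<Rightarrow> real poly" where
  "phi_poly s i = (\<Sum>j<s. smult (phi s i j) (legendre j))"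

lemma unit_int_phi_poly: "s > 0 \<Longrightarrow> unit_int (phi_poly s i) = phi s i 0"
  by (simp add: phi_poly_def unit_int_sum unit_int_smult unit_int_legendre_eq)

lemma antideriv_phi_poly:
  assumes "1 \<le> i" "i \<le> s"
  shows "antideriv (phi_poly s i) = legendre (i - 1) + smult (xi s * phi s i (s - 1)) (legendre s)"
proof -
  have "antideriv (phi_poly s i) = (\<Sum>j<s. smult (phi s i j) (antideriv (legendre j)))"
    by (simp add: phi_poly_def antideriv_sum antideriv_smult)
  also have "\<dots> = (\<Sum>j<s. (\<Sum>k<s. smult (X_mat s $$ (k, j) * phi s i j) (legendre k))
      + (if j = s - 1 then smult (xi s * phi s i (s - 1)) (legendre s) else 0))"
  proof (rule sum.cong[OF refl])
    fix j assume "j \<in> {..<s}"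
    then show "smult (phi s i j) (antideriv (legendre j)) =
        (\<Sum>k<s. smult (X_mat s $$ (k, j) * phi s i j) (legendre k))
      + (if j = s - 1 then smult (xi s * phi s i (s - 1)) (legendre s) else 0)"
      by (subst antideriv_legendre_X_mat[of j s])
        (auto simp: smult_add_right sum_distrib_left[of "[:phi s i j:]", simplified] mult.commute)
  qed
  also have "\<dots> = (\<Sum>j<s. \<Sum>k<s. smult (X_mat s $$ (k, j) * phi s i j) (legendre k))
      + smult (xi s * phi s i (s - 1)) (legendre s)"
    using assms by (simp add: sum.distrib)
  also have "(\<Sum>j<s. \<Sum>k<s. smult (X_mat s $$ (k, j) * phi s i j) (legendre k))
     = (\<Sum>k<s. smult (\<Sum>j<s. X_mat s $$ (k, j) * phi s i j) (legendre k))"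
    by (subst sum.swap) (simp add: smult_sum)
  also have "\<dots> = (\<Sum>k<s. if k = i - 1 then legendre (i - 1) else 0)"
    using assms by (intro sum.cong) (auto simp: X_mat_mult_phi)
  also have "\<dots> = legendre (i - 1)" using assms by simp
  finally show ?thesis .
qed

text \<open>Integration by parts against \<open>antideriv_phi_poly\<close>. The boundary term at 0
  vanishes, the one at 1 is \<open>phi s i 0\<close>, and the P_s part of the antiderivative is
  orthogonal to degree k - 1 < s.\<close>

lemma unit_int_monom_phi_poly:
  assumes "1 \<le> i" "i \<le> s" "0 < k" "k \<le> s"
  shows "unit_int (monom 1 k * phi_poly s i) - phi s i 0
      = - real k * unit_int (legendre (i - 1) * monom 1 (k - 1))"
proof -
  let ?A = "antideriv (phi_poly s i)"
  have "unit_int (phi_poly s i * monom 1 k) = poly ?A 1 - unit_int (?A * pderiv (monom 1 k))"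
    using unit_int_by_parts[of ?A "monom 1 k"] assms(3) by (simp add: poly_monom)
  also have "poly ?A 1 = phi s i 0"
    using unit_int_phi_poly[of s i] assms by (simp add: unit_int_def)
  also have "?A * pderiv (monom 1 k) = smult (real k) (legendre (i - 1) * monom 1 (k - 1)
      + smult (xi s * phi s i (s - 1)) (legendre s * monom 1 (k - 1)))"
  proof -
    have "pderiv (monom 1 k) = smult (real k) (monom (1::real) (k - 1))"
      by (simp add: pderiv_monom smult_monom)
    then show ?thesis using antideriv_phi_poly[OF assms(1,2)] by (simp add: distrib_right)
  qed
  also have "unit_int \<dots> = real k * unit_int (legendre (i - 1) * monom 1 (k - 1))"
    using legendre_orth_lower[of "monom 1 (k - 1)" s] assms
    by (simp add: unit_int_smult unit_int_add degree_monom_eq)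
  finally show ?thesis by (simp add: mult.commute)
qed

lemma unit_int_legendre_1_X: "unit_int (legendre 1 * monom 1 1) = xi 1"
proof -
  have "antideriv (legendre 0) = monom 1 1"
    by (intro poly_eqI) (auto simp: coeff_antideriv)
  then have "unit_int (legendre 1 * monom 1 1) = legendre_eta 1" by (simp add: legendre_eta_def)
  then show ?thesis using legendre_eta_eq_xi[of 0] by simp
qed

text \<open>These two antiderivatives carry the quadratic part of the path. The second one is kept
  multiplied by \<open>xi 1\<close>, which cancels the irrational normalisation of P_1 and matches
  the factor that comes with the coefficient of index 1.\<close>

lemma antideriv_legendre_01:
  "antideriv (legendre 0) = monom 1 1"
  "smult (xi 1) (antideriv (legendre 1)) = smult (1/2) (monom 1 2 - monom 1 1)"
proof -
  show 0: "antideriv (legendre 0) = monom 1 1"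
    by (intro poly_eqI) (auto simp: coeff_antideriv)
  have "monom 1 1 = smult (1/2) 1 + smult (xi 1) (legendre 1)"
    using antideriv_legendre[of 0] 0 by simp
  then have "smult (xi 1) (legendre 1) = monom 1 1 - smult (1/2) 1" by simp
  then have "smult (xi 1) (antideriv (legendre 1)) = antideriv (monom 1 1 - smult (1/2) 1)"
    by (metis antideriv_smult)
  also have "\<dots> = smult (1/2) (monom 1 2 - monom 1 1)"
    by (intro poly_eqI) (auto simp: coeff_antideriv coeff_pCons split: nat.splits)
  finally show "smult (xi 1) (antideriv (legendre 1)) = smult (1/2) (monom 1 2 - monom 1 1)" .
qed

subsection \<open>Multivariate power series\<close>

no_notation vec_index (infixl "$" 100)

definition mpow :: "real ^ 'm \<Rightarrow> ('m \<Rightarrow> nat) \<Rightarrow> real" where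
  "mpow x \<nu> = (\<Prod>i\<in>UNIV. x $ i ^ \<nu> i)"

definition power_series_at :: "(('m \<Rightarrow> nat) \<Rightarrow> real) \<Rightarrow> (real ^ 'm \<Rightarrow> real) \<Rightarrow> real ^ 'm \<Rightarrow> bool" where
  "power_series_at k u a \<longleftrightarrow>
     (\<exists>r>0. \<forall>x\<in>ball a r. ((\<lambda>\<nu>. mpow (x - a) \<nu> * k \<nu>) has_sum u x) UNIV)"

text \<open>Coefficients of the formal partial derivative in direction \<open>i\<close>.\<close>

definition deriv_coeff :: "'m \<Rightarrow> (('m \<Rightarrow> nat) \<Rightarrow> real) \<Rightarrow> ('m \<Rightarrow> nat) \<Rightarrow> real" where
  "deriv_coeff i k \<nu> = real (\<nu> i + 1) * k (\<nu>(i := \<nu> i + 1))"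

lemma mpow_le:
  fixes x :: "real ^ 'm"
  assumes "\<And>i. \<bar>x $ i\<bar> \<le> t"
  shows "\<bar>mpow x \<nu>\<bar> \<le> t ^ sum \<nu> UNIV"
  unfolding mpow_def power_sum abs_prod power_abs
  using assms by (intro prod_mono) (auto intro!: power_mono)

lemma mpow_le_norm: "\<bar>mpow x \<nu>\<bar> \<le> norm x ^ sum \<nu> UNIV"
  by (rule mpow_le) (rule component_le_norm_cart)

text \<open>Unconditional convergence of reals is absolute convergence. Evaluated at the corner a +
  (t,...,t), where every monomial of order n equals t^n, it yields one majorant for all points
  within distance t.\<close>

lemma power_series_at_abs_summable:
  fixes a :: "real ^ 'm"
  assumes "power_series_at k u a"
  obtains t where "t > 0" "(\<lambda>\<nu>. t ^ sum \<nu> UNIV * \<bar>k \<nu>\<bar>) summable_on UNIV"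
    "\<And>x. norm (x - a) \<le> t \<Longrightarrow> ((\<lambda>\<nu>. mpow (x - a) \<nu> * k \<nu>) has_sum u x) UNIV"
proof -
  obtain r where r: "r > 0" "\<And>x. x \<in> ball a r \<Longrightarrow> ((\<lambda>\<nu>. mpow (x - a) \<nu> * k \<nu>) has_sum u x) UNIV"
    using assms unfolding power_series_at_def by blast
  \<comment> \<open>The corner vector has norm at most CARD('m) * t, so dividing r by the dimension
    keeps it in the ball; the factor 2 makes this strict.\<close>
  define t where "t = r / (2 * real CARD('m))"
  have c: "real CARD('m) \<ge> 1" by (simp add: Suc_leI)
  have t: "t > 0" using r c unfolding t_def by (intro divide_pos_pos) auto
  have "1 < 2 * real CARD('m)" using c by linarith
  then have "r * 1 < r * (2 * real CARD('m))" by (rule mult_strict_left_mono[OF _ r(1)])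
  then have tr: "t < r" using c by (simp add: t_def divide_less_eq)
  define e :: "real ^ 'm" where "e = (\<chi> i. t)"
  have "norm e \<le> (\<Sum>i\<in>(UNIV :: 'm set). \<bar>e $ i\<bar>)" by (rule norm_le_l1_cart)
  also have "\<dots> = real CARD('m) * t" using t by (simp add: e_def)
  also have "\<dots> < r" using r c by (simp add: t_def)
  finally have "a + e \<in> ball a r" by (simp add: dist_norm)
  from r(2)[OF this] have "(\<lambda>\<nu>. mpow e \<nu> * k \<nu>) summable_on UNIV"
    by (auto simp: summable_on_def)
  then have "(\<lambda>\<nu>. norm (mpow e \<nu> * k \<nu>)) summable_on UNIV"
    by (subst (asm) summable_on_iff_abs_summable_on_real)
  moreover have "norm (mpow e \<nu> * k \<nu>) = t ^ sum \<nu> UNIV * \<bar>k \<nu>\<bar>" for \<nu>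
    using t by (simp add: abs_mult mpow_def e_def power_sum abs_prod)
  ultimately have "(\<lambda>\<nu>. t ^ sum \<nu> UNIV * \<bar>k \<nu>\<bar>) summable_on UNIV" by simp
  moreover have "((\<lambda>\<nu>. mpow (x - a) \<nu> * k \<nu>) has_sum u x) UNIV" if "norm (x - a) \<le> t" for x
    using that tr by (intro r(2)) (simp add: dist_norm norm_minus_commute)
  ultimately show ?thesis using that t by blast
qed

lemma finite_multi_indices: "finite {\<nu> :: 'm::finite \<Rightarrow> nat. sum \<nu> UNIV \<le> n}"
proof (rule finite_subset)
  show "{\<nu> :: 'm \<Rightarrow> nat. sum \<nu> UNIV \<le> n} \<subseteq> (UNIV :: 'm set) \<rightarrow>\<^sub>E {..n}"
    by (auto intro: order.trans[OF member_le_sum[of _ UNIV]])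
  show "finite ((UNIV :: 'm set) \<rightarrow>\<^sub>E {..n})" by (intro finite_PiE) auto
qed

text \<open>Every index of the tail has order at least n + 1, so the factor (norm (x - a) / t)^(n +
  1) comes out and leaves the absolutely convergent tail at radius t.\<close>

lemma power_series_at_truncate:
  fixes a :: "real ^ 'm"
  assumes "power_series_at k u a"
  obtains K r where "r > 0" "K \<ge> 0" "\<And>x. x \<in> ball a r \<Longrightarrow>
    \<bar>u x - (\<Sum>\<nu> | sum \<nu> UNIV \<le> n. mpow (x - a) \<nu> * k \<nu>)\<bar> \<le> K * norm (x - a) ^ (n + 1)"
proof -
  obtain t where t: "t > 0" "(\<lambda>\<nu>. t ^ sum \<nu> UNIV * \<bar>k \<nu>\<bar>) summable_on UNIV"
    "\<And>x. norm (x - a) \<le> t \<Longrightarrow> ((\<lambda>\<nu>. mpow (x - a) \<nu> * k \<nu>) has_sum u x) UNIV"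
    using power_series_at_abs_summable[OF assms] by blast
  define F where "F = {\<nu> :: 'm \<Rightarrow> nat. sum \<nu> UNIV \<le> n}"
  define S where "S = infsum (\<lambda>\<nu>. t ^ sum \<nu> UNIV * \<bar>k \<nu>\<bar>) (- F)"
  have sumF: "(\<lambda>\<nu>. t ^ sum \<nu> UNIV * \<bar>k \<nu>\<bar>) summable_on (- F)"
    using t(2) by (rule summable_on_subset_banach) simp
  have S: "((\<lambda>\<nu>. t ^ sum \<nu> UNIV * \<bar>k \<nu>\<bar>) has_sum S) (- F)"
    unfolding S_def using sumF by (rule has_sum_infsum)
  have "S \<ge> 0" unfolding S_def using t by (intro infsum_nonneg) auto
  have "\<bar>u x - (\<Sum>\<nu>\<in>F. mpow (x - a) \<nu> * k \<nu>)\<bar> \<le> (S / t ^ (n + 1)) * norm (x - a) ^ (n + 1)"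
    if x: "x \<in> ball a t" for x
  proof -
    let ?d = "norm (x - a)"
    have d: "?d \<le> t" using x by (simp add: dist_norm norm_minus_commute)
    let ?f = "\<lambda>\<nu>. mpow (x - a) \<nu> * k \<nu>"
    have "(?f has_sum (\<Sum>\<nu>\<in>F. ?f \<nu>)) F"
      using finite_multi_indices[of n, where 'm = 'm] unfolding F_def by (rule has_sum_finite)
    then have hs: "(?f has_sum (u x - (\<Sum>\<nu>\<in>F. ?f \<nu>))) (- F)"
      using has_sum_Diff[OF t(3)[OF d], of F "\<Sum>\<nu>\<in>F. ?f \<nu>"] by (simp add: Compl_eq_Diff_UNIV)
    have "norm (u x - (\<Sum>\<nu>\<in>F. ?f \<nu>)) \<le> (?d / t) ^ (n + 1) * S"
    proof (rule norm_infsum_le[OF hs])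
      show "((\<lambda>\<nu>. (?d / t) ^ (n + 1) * (t ^ sum \<nu> UNIV * \<bar>k \<nu>\<bar>)) has_sum (?d / t) ^ (n + 1) * S) (- F)"
        using S by (rule has_sum_cmult_right)
    next
      fix \<nu> assume "\<nu> \<in> - F"
      then have n: "n + 1 \<le> sum \<nu> UNIV" by (auto simp: F_def)
      have "\<bar>mpow (x - a) \<nu>\<bar> \<le> ?d ^ sum \<nu> UNIV" by (rule mpow_le_norm)
      also have "\<dots> = (?d / t) ^ sum \<nu> UNIV * t ^ sum \<nu> UNIV"
        using t(1) by (simp add: power_divide)
      also have "\<dots> \<le> (?d / t) ^ (n + 1) * t ^ sum \<nu> UNIV"
        using t(1) d n by (intro mult_right_mono power_decreasing) auto
      finally have "\<bar>mpow (x - a) \<nu>\<bar> * \<bar>k \<nu>\<bar> \<le> (?d / t) ^ (n + 1) * t ^ sum \<nu> UNIV * \<bar>k \<nu>\<bar>"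
        by (rule mult_right_mono) simp
      then show "norm (?f \<nu>) \<le> (?d / t) ^ (n + 1) * (t ^ sum \<nu> UNIV * \<bar>k \<nu>\<bar>)"
        by (simp add: abs_mult mult.assoc)
    qed
    then show ?thesis by (simp add: power_divide mult.commute)
  qed
  then show ?thesis using that[of t "S / t ^ (n + 1)"] t \<open>S \<ge> 0\<close> by (auto simp: F_def)
qed

lemma power_series_at_constant_term:
  assumes "power_series_at k u a"
  shows "u a = k (\<lambda>_. 0)"
    and "\<exists>r>0. \<exists>K\<ge>0. \<forall>x\<in>ball a r. \<bar>u x - u a\<bar> \<le> K * norm (x - a)"
proof -
  obtain K r where r: "r > 0" "K \<ge> 0" and "\<And>x. x \<in> ball a r \<Longrightarrow>
    \<bar>u x - (\<Sum>\<nu> | sum \<nu> UNIV \<le> 0. mpow (x - a) \<nu> * k \<nu>)\<bar> \<le> K * norm (x - a) ^ (0 + 1)"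
    using power_series_at_truncate[OF assms, of 0] by blast
  moreover have "{\<nu>. sum \<nu> (UNIV :: 'a set) \<le> (0::nat)} = {\<lambda>_. 0}" by auto
  ultimately have *: "\<bar>u x - k (\<lambda>_. 0)\<bar> \<le> K * norm (x - a)" if "x \<in> ball a r" for x
    using that by (force simp: mpow_def)
  from *[of a] r show 1: "u a = k (\<lambda>_. 0)" by simp
  show "\<exists>r>0. \<exists>K\<ge>0. \<forall>x\<in>ball a r. \<bar>u x - u a\<bar> \<le> K * norm (x - a)"
    using * r 1 by (intro exI[of _ r] conjI exI[of _ K]) auto
qed

text \<open>Termwise differentiation for unordered sums. An enumeration of the countable index type
  reduces it to the theorem for sequences of functions, and the majorant \<open>M\<close> makes the
  differentiated series converge uniformly on \<open>S\<close>.\<close>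

lemma has_derivative_has_sum:
  fixes f :: "'i::countable \<Rightarrow> 'a::real_normed_vector \<Rightarrow> real"
  assumes inf: "infinite (UNIV :: 'i set)" and S: "convex S" "open S" "x0 \<in> S"
    and f: "\<And>i x. x \<in> S \<Longrightarrow> (f i has_derivative f' i x) (at x)"
    and M: "\<And>i x v. x \<in> S \<Longrightarrow> \<bar>f' i x v\<bar> \<le> M i * norm v" "M summable_on UNIV"
    and F: "\<And>x. x \<in> S \<Longrightarrow> ((\<lambda>i. f i x) has_sum F x) UNIV"
    and G: "\<And>x v. x \<in> S \<Longrightarrow> ((\<lambda>i. f' i x v) has_sum G x v) UNIV"
  shows "(F has_derivative G x0) (at x0)"
proof -
  define e :: "nat \<Rightarrow> 'i" where "e = from_nat_into UNIV"
  have e: "bij_betw e UNIV UNIV"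
    unfolding e_def by (rule bij_betw_from_nat_into) (use inf in auto)
  have sums: "(\<lambda>n. g (e n)) sums l" if "(g has_sum l) UNIV" for g :: "'i \<Rightarrow> real" and l
    using that has_sum_reindex_bij_betw[OF e, of g l] by (auto intro: has_sum_imp_sums)
  have sM: "summable (\<lambda>n. M (e n))"
    using sums has_sum_infsum[OF M(2)] by (auto simp: summable_def)
  have unif: "\<forall>\<^sub>F n in sequentially. \<forall>x\<in>S. \<forall>h. norm ((\<Sum>i<n. f' (e i) x h) - G x h) \<le> \<epsilon> * norm h"
    if \<epsilon>: "\<epsilon> > 0" for \<epsilon>
  proof -
    obtain N where N: "\<And>n. n \<ge> N \<Longrightarrow> norm (\<Sum>i. M (e (i + n))) < \<epsilon>"
      using suminf_exist_split[OF \<epsilon> sM] by blast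
    have "norm ((\<Sum>i<n. f' (e i) x h) - G x h) \<le> \<epsilon> * norm h" if n: "n \<ge> N" and x: "x \<in> S" for n x h
    proof -
      have s: "(\<lambda>i. f' (e i) x h) sums G x h" using G[OF x] by (rule sums)
      have sMn: "summable (\<lambda>i. M (e (i + n)) * norm h)"
        using sM by (intro summable_mult2) (simp add: summable_iff_shift[of "\<lambda>i. M (e i)"])
      have b: "norm (f' (e (i + n)) x h) \<le> M (e (i + n)) * norm h" for i
        using M(1)[OF x] by simp
      have "G x h - (\<Sum>i<n. f' (e i) x h) = (\<Sum>i. f' (e (i + n)) x h)"
        using suminf_minus_initial_segment[OF sums_summable[OF s], of n] sums_unique[OF s] by simp
      then have "norm ((\<Sum>i<n. f' (e i) x h) - G x h) = norm (\<Sum>i. f' (e (i + n)) x h)"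
        by (metis norm_minus_commute)
      also have "\<dots> \<le> (\<Sum>i. M (e (i + n)) * norm h)"
        using norm_suminf_le[OF b sMn] .
      also have "\<dots> = (\<Sum>i. M (e (i + n))) * norm h"
        using sM by (intro suminf_mult2[symmetric]) (simp add: summable_iff_shift[of "\<lambda>i. M (e i)"])
      also have "\<dots> \<le> \<epsilon> * norm h"
        using N[OF n] by (intro mult_right_mono) auto
      finally show ?thesis .
    qed
    then show ?thesis unfolding eventually_sequentially by blast
  qed
  obtain g where g: "\<And>x. x \<in> S \<Longrightarrow> (\<lambda>n. f (e n) x) sums g x"
    and g': "\<And>x. x \<in> S \<Longrightarrow> (g has_derivative G x) (at x within S)"
    using has_derivative_series[OF S(1), of "\<lambda>n. f (e n)" "\<lambda>n. f' (e n)" G x0 "F x0"]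
      has_derivative_at_withinI[OF f] unif S(3) sums[OF F[OF S(3)]] by blast
  have "g x = F x" if "x \<in> S" for x
    using sums_unique2[OF g[OF that] sums[OF F[OF that]]] .
  then show ?thesis
    using g'[OF S(3)] S(2,3) by (metis at_within_open has_derivative_transform_within_open)
qed

text \<open>When the exponent of coordinate \<open>i\<close> is 0, the truncated exponent is
  harmless because its term carries the factor 0.\<close>

lemma mpow_has_derivative:
  fixes a :: "real ^ 'm"
  shows "((\<lambda>x. mpow (x - a) \<nu>) has_derivative
     (\<lambda>v. \<Sum>i\<in>UNIV. v $ i * (real (\<nu> i) * mpow (x - a) (\<nu>(i := \<nu> i - 1))))) (at x)"
proof -
  have "((\<lambda>x. (x $ i - a $ i) ^ \<nu> i) has_derivative
      (\<lambda>v. real (\<nu> i) * v $ i * (x $ i - a $ i) ^ (\<nu> i - 1))) (at x)" for i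
    by (auto intro!: derivative_eq_intros bounded_linear.has_derivative[OF bounded_linear_vec_nth])
  then have "((\<lambda>x. mpow (x - a) \<nu>) has_derivative
     (\<lambda>v. \<Sum>i\<in>UNIV. real (\<nu> i) * v $ i * (x $ i - a $ i) ^ (\<nu> i - 1) *
        (\<Prod>j\<in>UNIV - {i}. (x $ j - a $ j) ^ \<nu> j))) (at x)"
    unfolding mpow_def vector_minus_component by (intro has_derivative_prod) auto
  moreover have "mpow (x - a) (\<nu>(i := \<nu> i - 1)) = (x $ i - a $ i) ^ (\<nu> i - 1) *
        (\<Prod>j\<in>UNIV - {i}. (x $ j - a $ j) ^ \<nu> j)" for i
    unfolding mpow_def by (subst prod.remove[of _ i]) (auto intro!: prod.cong)
  ultimately show ?thesis by (simp add: mult_ac)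
qed

lemma sum_fun_upd_minus_one:
  fixes \<nu> :: "'m::finite \<Rightarrow> nat"
  assumes "0 < \<nu> i" shows "sum (\<nu>(i := \<nu> i - 1)) UNIV + 1 = sum \<nu> UNIV"
proof -
  have "sum (\<nu>(i := \<nu> i - 1)) UNIV = (\<nu> i - 1) + sum \<nu> (UNIV - {i})"
    by (subst sum.remove[of _ i]) (auto intro!: sum.cong)
  moreover have "sum \<nu> UNIV = \<nu> i + sum \<nu> (UNIV - {i})" by (subst sum.remove[of _ i]) auto
  ultimately show ?thesis using assms by simp
qed

lemma infinite_multi_indices: "infinite (UNIV :: ('m::finite \<Rightarrow> nat) set)"
proof
  assume "finite (UNIV :: ('m \<Rightarrow> nat) set)"
  moreover have "inj (\<lambda>n::nat. (\<lambda>_::'m. n))" by (auto simp: inj_def fun_eq_iff)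
  ultimately show False
    using infinite_UNIV_nat by (metis finite_imageD finite_subset subset_UNIV)
qed

text \<open>The differentiated terms are first summed with their original index, where they are
  dominated by the majorant for \<open>u\<close>, and then reindexed to the series with coefficients
  \<open>deriv_coeff i k\<close>.\<close>

lemma power_series_at_derivative:
  fixes a :: "real ^ 'm"
  assumes "power_series_at k u a"
  obtains r w where "r > 0" "\<And>i. power_series_at (deriv_coeff i k) (w i) a"
    "\<And>x. x \<in> ball a r \<Longrightarrow> (u has_derivative (\<lambda>v. \<Sum>i\<in>UNIV. v $ i * w i x)) (at x)"
proof -
  obtain t where t: "t > 0" "(\<lambda>\<nu>. t ^ sum \<nu> UNIV * \<bar>k \<nu>\<bar>) summable_on UNIV"
    "\<And>x. norm (x - a) \<le> t \<Longrightarrow> ((\<lambda>\<nu>. mpow (x - a) \<nu> * k \<nu>) has_sum u x) UNIV"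
    using power_series_at_abs_summable[OF assms] by blast
  \<comment> \<open>Halving the radius pays for the factor \<open>\<nu> i\<close> produced by
    differentiation, which is at most 2 to the order of the multi-index.\<close>
  define \<rho> where "\<rho> = t / 2"
  have \<rho>: "\<rho> > 0" "\<rho> \<le> t" using t by (auto simp: \<rho>_def)
  define h where "h i x \<nu> = real (\<nu> i) * mpow (x - a) (\<nu>(i := \<nu> i - 1)) * k \<nu>" for i x \<nu>
  have h_bound: "\<bar>h i x \<nu>\<bar> \<le> (1 / \<rho>) * (t ^ sum \<nu> UNIV * \<bar>k \<nu>\<bar>)" if x: "x \<in> ball a \<rho>" for i x \<nu>
  proof (cases "\<nu> i = 0")
    case True
    then show ?thesis using \<rho> t by (simp add: h_def)
  next
    case False
    define n where "n = sum (\<nu>(i := \<nu> i - 1)) UNIV"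
    have n: "sum \<nu> UNIV = n + 1" using sum_fun_upd_minus_one[of \<nu> i] False by (simp add: n_def)
    have xn: "norm (x - a) \<le> \<rho>" using x by (simp add: dist_norm norm_minus_commute)
    have "\<nu> i \<le> n + 1" unfolding n[symmetric] by (rule member_le_sum) auto
    also have "\<dots> \<le> 2 ^ (n + 1)" by (rule less_imp_le) (rule less_exp)
    finally have "real (\<nu> i) \<le> 2 ^ (n + 1)" by (metis of_nat_le_iff of_nat_numeral of_nat_power)
    moreover have "\<bar>mpow (x - a) (\<nu>(i := \<nu> i - 1))\<bar> \<le> \<rho> ^ n"
      unfolding n_def by (rule order.trans[OF mpow_le_norm power_mono[OF xn]]) simp
    ultimately have "real (\<nu> i) * \<bar>mpow (x - a) (\<nu>(i := \<nu> i - 1))\<bar> \<le> 2 ^ (n + 1) * \<rho> ^ n"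
      by (intro mult_mono) auto
    also have "\<dots> = (1 / \<rho>) * t ^ sum \<nu> UNIV"
      using \<rho>(1) unfolding n by (simp add: \<rho>_def power_divide field_simps)
    finally have "real (\<nu> i) * \<bar>mpow (x - a) (\<nu>(i := \<nu> i - 1))\<bar> * \<bar>k \<nu>\<bar> \<le> (1 / \<rho>) * t ^ sum \<nu> UNIV * \<bar>k \<nu>\<bar>"
      by (rule mult_right_mono) simp
    then show ?thesis by (simp add: h_def abs_mult mult.assoc)
  qed
  define w where "w i x = infsum (\<lambda>\<nu>. mpow (x - a) \<nu> * deriv_coeff i k \<nu>) UNIV" for i x
  have sumB: "(\<lambda>\<nu>. c * (t ^ sum \<nu> UNIV * \<bar>k \<nu>\<bar>)) summable_on UNIV" for c
    using t(2) by (rule summable_on_cmult_right)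
  have hw: "(h i x has_sum w i x) UNIV \<and> ((\<lambda>\<nu>. mpow (x - a) \<nu> * deriv_coeff i k \<nu>) has_sum w i x) UNIV"
    if x: "x \<in> ball a \<rho>" for i x
  proof -
    \<comment> \<open>Raising the i-th exponent is injective, and exactly the indices outside its
      range have exponent 0 and hence a zero derivative term.\<close>
    define up where "up \<nu> = \<nu>(i := \<nu> i + 1)" for \<nu> :: "'m \<Rightarrow> nat"
    have inj: "inj up"
    proof (rule inj_on_inverseI)
      fix \<nu> show "(\<lambda>\<mu>. \<mu>(i := \<mu> i - 1)) (up \<nu>) = \<nu>" by (auto simp: up_def)
    qed
    have hup: "h i x (up \<nu>) = mpow (x - a) \<nu> * deriv_coeff i k \<nu>" for \<nu>
      by (simp add: h_def up_def deriv_coeff_def)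
    have "(\<lambda>\<nu>. norm (h i x \<nu>)) summable_on UNIV"
      by (rule summable_on_comparison_test[OF sumB[of "1 / \<rho>"]]) (use h_bound[OF x] in auto)
    then obtain L where L: "(h i x has_sum L) UNIV"
      using abs_summable_summable summable_on_def by blast
    have z: "h i x \<mu> = 0" if "\<mu> \<notin> range up" for \<mu>
    proof (rule ccontr)
      assume "h i x \<mu> \<noteq> 0"
      then have "\<mu> i \<noteq> 0" by (auto simp: h_def)
      then have "\<mu> = up (\<mu>(i := \<mu> i - 1))" by (auto simp: up_def)
      then show False using that by blast
    qed
    have "(h i x has_sum L) (range up)"
      using L has_sum_cong_neutral[of "range up" UNIV "h i x" "h i x" L] z by auto
    then have "((h i x \<circ> up) has_sum L) UNIV"
      using has_sum_reindex[OF inj, of "h i x" L] by simp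
    then have L': "((\<lambda>\<nu>. mpow (x - a) \<nu> * deriv_coeff i k \<nu>) has_sum L) UNIV"
      by (simp add: o_def hup)
    then have "w i x = L" unfolding w_def by (rule infsumI)
    then show ?thesis using L L' by simp
  qed
  have "power_series_at (deriv_coeff i k) (w i) a" for i
    unfolding power_series_at_def using hw \<rho> by blast
  moreover have "(u has_derivative (\<lambda>v. \<Sum>i\<in>UNIV. v $ i * w i x)) (at x)" if x: "x \<in> ball a \<rho>" for x
  proof (rule has_derivative_has_sum[OF infinite_multi_indices convex_ball open_ball x,
        where f = "\<lambda>\<nu> x. mpow (x - a) \<nu> * k \<nu>" and f' = "\<lambda>\<nu> x v. \<Sum>i\<in>UNIV. v $ i * h i x \<nu>"
          and M = "\<lambda>\<nu>. (real CARD('m) * (1 / \<rho>)) * (t ^ sum \<nu> UNIV * \<bar>k \<nu>\<bar>)"])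
    fix \<nu> x
    show "((\<lambda>x. mpow (x - a) \<nu> * k \<nu>) has_derivative (\<lambda>v. \<Sum>i\<in>UNIV. v $ i * h i x \<nu>)) (at x)"
      using has_derivative_mult_left[OF mpow_has_derivative[of a \<nu> x], of "k \<nu>"]
      by (simp add: h_def sum_distrib_right sum_distrib_left mult_ac)
  next
    fix \<nu> x v assume x: "x \<in> ball a \<rho>"
    have "\<bar>\<Sum>i\<in>UNIV. v $ i * h i x \<nu>\<bar> \<le> (\<Sum>i\<in>(UNIV :: 'm set). norm v * ((1 / \<rho>) * (t ^ sum \<nu> UNIV * \<bar>k \<nu>\<bar>)))"
    proof (rule order.trans[OF sum_abs], rule sum_mono)
      fix i
      show "\<bar>v $ i * h i x \<nu>\<bar> \<le> norm v * ((1 / \<rho>) * (t ^ sum \<nu> UNIV * \<bar>k \<nu>\<bar>))"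
        unfolding abs_mult using h_bound[OF x] component_le_norm_cart by (intro mult_mono) auto
    qed
    then show "\<bar>\<Sum>i\<in>UNIV. v $ i * h i x \<nu>\<bar>
        \<le> (real CARD('m) * (1 / \<rho>)) * (t ^ sum \<nu> UNIV * \<bar>k \<nu>\<bar>) * norm v"
      by (simp add: mult_ac)
  next
    show "(\<lambda>\<nu>. (real CARD('m) * (1 / \<rho>)) * (t ^ sum \<nu> UNIV * \<bar>k \<nu>\<bar>)) summable_on UNIV" by (rule sumB)
  next
    fix x assume x: "x \<in> ball a \<rho>"
    then show "((\<lambda>\<nu>. mpow (x - a) \<nu> * k \<nu>) has_sum u x) UNIV"
      using \<rho> by (intro t(3)) (simp add: dist_norm norm_minus_commute)
    fix v
    have "((\<lambda>\<nu>. \<Sum>i\<in>I. v $ i * h i x \<nu>) has_sum (\<Sum>i\<in>I. v $ i * w i x)) UNIV" for I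
    proof (induction I rule: infinite_finite_induct)
      case (insert i I)
      then show ?case
        using has_sum_add[OF has_sum_cmult_right[OF conjunct1[OF hw[OF x, of i]], of "v $ i"] insert.IH]
        by simp
    qed simp_all
    then show "((\<lambda>\<nu>. \<Sum>i\<in>UNIV. v $ i * h i x \<nu>) has_sum (\<Sum>i\<in>UNIV. v $ i * w i x)) UNIV" .
  qed
  ultimately show ?thesis using that \<rho>(1) by blast
qed

lemma power_series_at_cong:
  assumes "power_series_at k u a" "r > 0" "\<And>x. x \<in> ball a r \<Longrightarrow> u x = v x"
  shows "power_series_at k v a"
proof -
  obtain r' where r': "r' > 0" "\<And>x. x \<in> ball a r' \<Longrightarrow> ((\<lambda>\<nu>. mpow (x - a) \<nu> * k \<nu>) has_sum u x) UNIV"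
    using assms(1) unfolding power_series_at_def by blast
  then show ?thesis unfolding power_series_at_def
    using assms(2,3) by (intro exI[of _ "min r r'"]) force
qed

lemma power_series_at_sum:
  assumes "\<And>i. i \<in> I \<Longrightarrow> power_series_at (k i) (u i) a"
  shows "power_series_at (\<lambda>\<nu>. \<Sum>i\<in>I. c i * k i \<nu>) (\<lambda>x. \<Sum>i\<in>I. c i * u i x) a"
  using assms
proof (induction I rule: infinite_finite_induct)
  case (insert i I)
  have "power_series_at (k i) (u i) a" using insert.prems by simp
  then obtain r where r: "r > 0" "\<And>x. x \<in> ball a r \<Longrightarrow> ((\<lambda>\<nu>. mpow (x - a) \<nu> * k i \<nu>) has_sum u i x) UNIV"
    unfolding power_series_at_def by blast
  have "power_series_at (\<lambda>\<nu>. \<Sum>i\<in>I. c i * k i \<nu>) (\<lambda>x. \<Sum>i\<in>I. c i * u i x) a"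
    using insert.IH insert.prems by simp
  then obtain r' where r': "r' > 0" "\<And>x. x \<in> ball a r' \<Longrightarrow>
       ((\<lambda>\<nu>. mpow (x - a) \<nu> * (\<Sum>i\<in>I. c i * k i \<nu>)) has_sum (\<Sum>i\<in>I. c i * u i x)) UNIV"
    unfolding power_series_at_def by blast
  have "((\<lambda>\<nu>. mpow (x - a) \<nu> * (\<Sum>i\<in>insert i I. c i * k i \<nu>)) has_sum (\<Sum>i\<in>insert i I. c i * u i x)) UNIV"
    if "x \<in> ball a (min r r')" for x
    using has_sum_add[OF has_sum_cmult_right[OF r(2), of x "c i"] r'(2)[of x]] that insert.hyps
    by (simp add: distrib_left mult.left_commute)
  then show ?case unfolding power_series_at_def using r(1) r'(1) by (intro exI[of _ "min r r'"]) simp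
qed (auto simp: power_series_at_def intro!: exI[of _ 1])

text \<open>The Taylor remainder with candidate gradient \<open>c\<close> and candidate Hessian
  \<open>d\<close>. With \<open>d\<close> zero it is the first order remainder, so one lemma serves
  for both orders.\<close>

definition quadratic_error ::
    "(real ^ 'm \<Rightarrow> real) \<Rightarrow> ('m \<Rightarrow> real) \<Rightarrow> ('m \<Rightarrow> 'm \<Rightarrow> real) \<Rightarrow> real ^ 'm \<Rightarrow> real ^ 'm \<Rightarrow> real" where
  "quadratic_error u c d a x = u x - u a - (\<Sum>i\<in>UNIV. (x - a) $ i * c i)
      - (\<Sum>i\<in>UNIV. (x - a) $ i * (\<Sum>j\<in>UNIV. (x - a) $ j * d i j)) / 2"

text \<open>Mean value theorem on the segment from \<open>a\<close> to \<open>x\<close>: the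
  derivative of the remainder along it is the inner product of x - a with the linearisation errors
  of the partials \<open>w\<close>, which gains one power of the distance.\<close>

lemma quadratic_taylor:
  fixes a :: "real ^ 'm"
  assumes u: "\<And>x. x \<in> ball a r \<Longrightarrow> (u has_derivative (\<lambda>v. \<Sum>i\<in>UNIV. v $ i * w i x)) (at x)"
    and w: "\<And>i x. x \<in> ball a r \<Longrightarrow>
      \<bar>w i x - c i - (\<Sum>j\<in>UNIV. (x - a) $ j * d i j)\<bar> \<le> K * norm (x - a) ^ n"
    and x: "x \<in> ball a r" and K: "K \<ge> 0"
  shows "\<bar>quadratic_error u c d a x\<bar> \<le> real CARD('m) * K * norm (x - a) ^ (n + 1)"
proof -
  define \<delta> where "\<delta> = x - a"
  define L where "L = (\<Sum>i\<in>UNIV. \<delta> $ i * c i)"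
  define Q where "Q = (\<Sum>i\<in>UNIV. \<delta> $ i * (\<Sum>j\<in>UNIV. \<delta> $ j * d i j))"
  define \<phi> where "\<phi> \<tau> = u (a + \<tau> *\<^sub>R \<delta>) - u a - \<tau> * L - \<tau>\<^sup>2 * (Q / 2)" for \<tau>
  define \<phi>' where "\<phi>' \<tau> = (\<Sum>i\<in>UNIV. \<delta> $ i * w i (a + \<tau> *\<^sub>R \<delta>)) - L - \<tau> * Q" for \<tau>
  have inb: "a + \<tau> *\<^sub>R \<delta> \<in> ball a r" if "0 \<le> \<tau>" "\<tau> \<le> 1" for \<tau>
  proof -
    have "\<tau> * norm \<delta> \<le> 1 * norm \<delta>" using that by (intro mult_right_mono) auto
    then show ?thesis using x that by (simp add: \<delta>_def dist_norm norm_minus_commute)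
  qed
  have der: "(\<phi> has_real_derivative \<phi>' \<tau>) (at \<tau>)" if "0 \<le> \<tau>" "\<tau> \<le> 1" for \<tau>
  proof -
    have "((\<lambda>\<tau>. a + \<tau> *\<^sub>R \<delta>) has_derivative (\<lambda>s. s *\<^sub>R \<delta>)) (at \<tau>)"
      by (auto intro!: derivative_eq_intros)
    from has_derivative_compose[OF this u[OF inb[OF that]]]
    have "((\<lambda>\<tau>. u (a + \<tau> *\<^sub>R \<delta>)) has_derivative (\<lambda>s. s * (\<Sum>i\<in>UNIV. \<delta> $ i * w i (a + \<tau> *\<^sub>R \<delta>)))) (at \<tau>)"
      by (simp add: sum_distrib_left mult.assoc)
    then have "((\<lambda>\<tau>. u (a + \<tau> *\<^sub>R \<delta>)) has_real_derivative (\<Sum>i\<in>UNIV. \<delta> $ i * w i (a + \<tau> *\<^sub>R \<delta>))) (at \<tau>)"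
      by (rule has_derivative_imp_has_field_derivative) simp
    then show ?thesis unfolding \<phi>_def[abs_def] \<phi>'_def
      by (auto intro!: derivative_eq_intros simp: field_simps)
  qed
  obtain \<tau> where \<tau>: "0 < \<tau>" "\<tau> < 1" "\<phi> 1 - \<phi> 0 = (1 - 0) * \<phi>' \<tau>"
    using MVT2[of 0 1 \<phi> \<phi>'] der by auto
  have "\<phi>' \<tau> = (\<Sum>i\<in>UNIV. \<delta> $ i * (w i (a + \<tau> *\<^sub>R \<delta>) - c i - (\<Sum>j\<in>UNIV. (\<tau> *\<^sub>R \<delta>) $ j * d i j)))"
    unfolding \<phi>'_def L_def Q_def
    by (simp add: sum_subtractf[symmetric] sum_distrib_left algebra_simps)
  also have "\<bar>\<dots>\<bar> \<le> (\<Sum>i\<in>(UNIV :: 'm set). norm \<delta> * (K * norm \<delta> ^ n))"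
  proof (rule order.trans[OF sum_abs], rule sum_mono)
    fix i
    have "\<bar>w i (a + \<tau> *\<^sub>R \<delta>) - c i - (\<Sum>j\<in>UNIV. (\<tau> *\<^sub>R \<delta>) $ j * d i j)\<bar> \<le> K * norm (\<tau> *\<^sub>R \<delta>) ^ n"
      using w[OF inb[of \<tau>], of i] \<tau> by simp
    also have "\<dots> \<le> K * norm \<delta> ^ n"
      using \<tau> K by (intro mult_left_mono power_mono) (auto simp: mult_left_le_one_le)
    finally show "\<bar>\<delta> $ i * (w i (a + \<tau> *\<^sub>R \<delta>) - c i - (\<Sum>j\<in>UNIV. (\<tau> *\<^sub>R \<delta>) $ j * d i j))\<bar>
        \<le> norm \<delta> * (K * norm \<delta> ^ n)"
      unfolding abs_mult by (intro mult_mono component_le_norm_cart) auto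
  qed
  finally have "\<bar>\<phi> 1 - \<phi> 0\<bar> \<le> real CARD('m) * K * norm \<delta> ^ (n + 1)"
    using \<tau>(3) by (simp add: mult_ac)
  moreover have "\<phi> 0 = 0" "\<phi> 1 = u x - u a - L - Q / 2"
    by (simp_all add: \<phi>_def \<delta>_def)
  ultimately show ?thesis by (simp add: quadratic_error_def L_def Q_def \<delta>_def)
qed

lemma quadratic_taylor_eventually:
  fixes a :: "real ^ 'm"
  assumes u: "\<forall>\<^sub>F x in nhds a. (u has_derivative (\<lambda>v. \<Sum>i\<in>UNIV. v $ i * w i x)) (at x)"
    and w: "\<And>i. \<exists>K\<ge>0. \<forall>\<^sub>F x in nhds a.
      \<bar>w i x - c i - (\<Sum>j\<in>UNIV. (x - a) $ j * d i j)\<bar> \<le> K * norm (x - a) ^ n"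
  shows "\<exists>K\<ge>0. \<forall>\<^sub>F x in nhds a. \<bar>quadratic_error u c d a x\<bar> \<le> K * norm (x - a) ^ (n + 1)"
proof -
  let ?e = "\<lambda>i x. \<bar>w i x - c i - (\<Sum>j\<in>UNIV. (x - a) $ j * d i j)\<bar>"
  define B where "B i K \<longleftrightarrow> K \<ge> 0 \<and> (\<forall>\<^sub>F x in nhds a. ?e i x \<le> K * norm (x - a) ^ n)" for i K
  have "\<exists>K. B i K" for i using w[of i] by (simp add: B_def)
  then obtain K where "\<And>i. B i (K i)" by metis
  then have K: "\<And>i. K i \<ge> 0" and b: "\<And>i. \<forall>\<^sub>F x in nhds a. ?e i x \<le> K i * norm (x - a) ^ n"
    by (simp_all add: B_def)
  have "\<forall>\<^sub>F x in nhds a. \<forall>i. ?e i x \<le> K i * norm (x - a) ^ n"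
    by (rule eventually_all_finite) (rule b)
  from eventually_conj[OF u this] obtain r where r: "r > 0"
    and u': "\<And>x. x \<in> ball a r \<Longrightarrow> (u has_derivative (\<lambda>v. \<Sum>i\<in>UNIV. v $ i * w i x)) (at x)"
    and b': "\<And>x i. x \<in> ball a r \<Longrightarrow> ?e i x \<le> K i * norm (x - a) ^ n"
    by (auto simp: eventually_nhds_metric dist_commute)
  define K' where "K' = (\<Sum>i\<in>UNIV. K i)"
  have K': "K i \<le> K'" "K' \<ge> 0" for i
    unfolding K'_def using K by (auto intro!: member_le_sum sum_nonneg)
  have b'': "?e i x \<le> K' * norm (x - a) ^ n" if "x \<in> ball a r" for x i
    by (rule order.trans[OF b'[OF that] mult_right_mono[OF K'(1)]]) simp
  have "\<forall>\<^sub>F x in nhds a. x \<in> ball a r" using r by (intro eventually_nhds_in_open) auto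
  then have "\<forall>\<^sub>F x in nhds a. \<bar>quadratic_error u c d a x\<bar> \<le> real CARD('m) * K' * norm (x - a) ^ (n + 1)"
    by (rule eventually_mono) (rule quadratic_taylor[OF u' b'' _ K'(2)])
  then show ?thesis using K'(2) by (intro exI[of _ "real CARD('m) * K'"]) simp
qed

text \<open>\<open>quadratic_taylor_eventually\<close> is applied first to the partials of
  \<open>u\<close>, with zero Hessian and exponent 1, and then to \<open>u\<close> itself with the
  resulting linearisations and exponent 2.\<close>

lemma power_series_at_second_order:
  fixes a :: "real ^ 'm"
  assumes "power_series_at k u a"
  obtains w ww K where "\<And>l. power_series_at (deriv_coeff l k) (w l) a"
    "\<forall>\<^sub>F x in nhds a. (u has_derivative (\<lambda>v. \<Sum>l\<in>UNIV. v $ l * w l x)) (at x)"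
    "\<And>l. (w l has_derivative (\<lambda>v. \<Sum>j\<in>UNIV. v $ j * ww l j)) (at a)"
    "K \<ge> 0" "\<forall>\<^sub>F x in nhds a. \<bar>quadratic_error u (\<lambda>l. w l a) ww a x\<bar> \<le> K * norm (x - a) ^ 3"
proof -
  have evb: "\<forall>\<^sub>F x in nhds a. x \<in> ball a r" if "r > 0" for r
    using that by (intro eventually_nhds_in_open) auto
  obtain r w where r: "r > 0" and w: "\<And>l. power_series_at (deriv_coeff l k) (w l) a"
    and u': "\<And>x. x \<in> ball a r \<Longrightarrow> (u has_derivative (\<lambda>v. \<Sum>l\<in>UNIV. v $ l * w l x)) (at x)"
    using power_series_at_derivative[OF assms] by blast
  note u = eventually_mono[OF evb[OF r] u']
  define P where "P l W \<longleftrightarrow> (w l has_derivative (\<lambda>v. \<Sum>j\<in>UNIV. v $ j * W j)) (at a) \<and>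
      (\<exists>K\<ge>0. \<forall>\<^sub>F x in nhds a. \<bar>w l x - w l a - (\<Sum>j\<in>UNIV. (x - a) $ j * W j)\<bar> \<le> K * norm (x - a) ^ 2)" for l W
  have "\<exists>W. P l W" for l
  proof -
    obtain r W where r: "r > 0" and W: "\<And>j. power_series_at (deriv_coeff j (deriv_coeff l k)) (W j) a"
      and d: "\<And>x. x \<in> ball a r \<Longrightarrow> (w l has_derivative (\<lambda>v. \<Sum>j\<in>UNIV. v $ j * W j x)) (at x)"
      using power_series_at_derivative[OF w[of l]] by blast
    have "\<exists>K\<ge>0. \<forall>\<^sub>F x in nhds a. \<bar>W j x - W j a - (\<Sum>i\<in>UNIV. (x - a) $ i * 0)\<bar> \<le> K * norm (x - a) ^ 1" for j
    proof -
      obtain r K where "r > 0" "K \<ge> 0" "\<forall>x\<in>ball a r. \<bar>W j x - W j a\<bar> \<le> K * norm (x - a)"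
        using power_series_at_constant_term(2)[OF W[of j]] by blast
      then show ?thesis using eventually_mono[OF evb[of r]] by (intro exI[of _ K]) auto
    qed
    from quadratic_taylor_eventually[OF eventually_mono[OF evb[OF r] d] this]
    have "P l (\<lambda>j. W j a)"
      using d[of a] r by (simp add: P_def quadratic_error_def power2_eq_square)
    then show ?thesis by blast
  qed
  then obtain W where W: "\<And>l. P l (W l)" by metis
  obtain K where "K \<ge> 0" "\<forall>\<^sub>F x in nhds a. \<bar>quadratic_error u (\<lambda>l. w l a) W a x\<bar> \<le> K * norm (x - a) ^ (2 + 1)"
  proof -
    have "\<exists>K\<ge>0. \<forall>\<^sub>F x in nhds a. \<bar>w l x - w l a - (\<Sum>j\<in>UNIV. (x - a) $ j * W l j)\<bar> \<le> K * norm (x - a) ^ 2" for l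
      using W[of l] unfolding P_def by (rule conjunct2)
    from quadratic_taylor_eventually[OF u this] show ?thesis using that by blast
  qed
  then show ?thesis
    using that[OF w u, of W K] W unfolding P_def by simp
qed

lemma vec_has_derivative_iff:
  fixes F :: "'a::real_normed_vector \<Rightarrow> real ^ 'n"
  shows "(F has_derivative F') (at x) \<longleftrightarrow> (\<forall>i. ((\<lambda>x. F x $ i) has_derivative (\<lambda>v. F' v $ i)) (at x))"
proof
  assume "(F has_derivative F') (at x)"
  then show "\<forall>i. ((\<lambda>x. F x $ i) has_derivative (\<lambda>v. F' v $ i)) (at x)"
    by (auto intro: bounded_linear.has_derivative[OF bounded_linear_vec_nth])
next
  assume h: "\<forall>i. ((\<lambda>x. F x $ i) has_derivative (\<lambda>v. F' v $ i)) (at x)"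
  show "(F has_derivative F') (at x)"
    by (subst has_derivative_componentwise_within)
      (use h in \<open>auto simp: Basis_vec_def inner_axis\<close>)
qed

text \<open>\<open>D2\<close> is assembled componentwise with the argument order of
  \<open>second_deriv\<close>. The formula for the derivative in terms of the coefficients
  \<open>k\<close> is recorded because the Hamiltonian case reads off the symmetry of a Hessian from
  it.\<close>

lemma analytic_second_order:
  fixes F :: "real ^ 'm \<Rightarrow> real ^ 'n"
  assumes F: "\<And>i. power_series_at (k i) (\<lambda>x. F x $ i) a"
  obtains D2 K where "\<forall>\<^sub>F x in nhds a. F differentiable (at x)"
    "\<And>v i. frechet_derivative F (at a) v $ i = (\<Sum>j\<in>UNIV. v $ j * k i ((\<lambda>_. 0)(j := 1)))"
    "(F has_derivative frechet_derivative F (at a)) (at a)"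
    "\<And>v. ((\<lambda>x. frechet_derivative F (at x) v) has_derivative (\<lambda>u. D2 u v)) (at a)"
    "bounded_bilinear D2" "K \<ge> 0"
    "\<forall>\<^sub>F x in nhds a. norm (F x - F a - frechet_derivative F (at a) (x - a) - (1/2) *\<^sub>R D2 (x - a) (x - a))
       \<le> K * norm (x - a) ^ 3"
proof -
  define P where "P i w ww K \<longleftrightarrow> (\<forall>l. power_series_at (deriv_coeff l (k i)) (w l) a) \<and>
    (\<forall>\<^sub>F x in nhds a. ((\<lambda>x. F x $ i) has_derivative (\<lambda>v. \<Sum>l\<in>UNIV. v $ l * w l x)) (at x)) \<and>
    (\<forall>l. (w l has_derivative (\<lambda>v. \<Sum>j\<in>UNIV. v $ j * ww l j)) (at a)) \<and>
    K \<ge> 0 \<and>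
    (\<forall>\<^sub>F x in nhds a. \<bar>quadratic_error (\<lambda>x. F x $ i) (\<lambda>l. w l a) ww a x\<bar> \<le> K * norm (x - a) ^ 3)" for i w ww K
  have "\<exists>w ww K. P i w ww K" for i
    unfolding P_def by (rule power_series_at_second_order[OF F[of i]]) blast
  then obtain w ww K where "\<And>i. P i (w i) (ww i) (K i)" by metis
  then have w: "\<And>i l. power_series_at (deriv_coeff l (k i)) (w i l) a"
    and d: "\<And>i. \<forall>\<^sub>F x in nhds a. ((\<lambda>x. F x $ i) has_derivative (\<lambda>v. \<Sum>l\<in>UNIV. v $ l * w i l x)) (at x)"
    and dd: "\<And>i l. (w i l has_derivative (\<lambda>v. \<Sum>j\<in>UNIV. v $ j * ww i l j)) (at a)"
    and K: "\<And>i. K i \<ge> 0"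
    and b: "\<And>i. \<forall>\<^sub>F x in nhds a. \<bar>quadratic_error (\<lambda>x. F x $ i) (\<lambda>l. w i l a) (ww i) a x\<bar> \<le> K i * norm (x - a) ^ 3"
    unfolding P_def by blast+
  define D where "D x v = (\<chi> i. \<Sum>l\<in>UNIV. v $ l * w i l x)" for x and v :: "real ^ 'm"
  define D2 where "D2 u v = (\<chi> i. \<Sum>l\<in>UNIV. v $ l * (\<Sum>j\<in>UNIV. u $ j * ww i l j))"
    for u v :: "real ^ 'm"
  have "\<forall>\<^sub>F x in nhds a. \<forall>i. ((\<lambda>x. F x $ i) has_derivative (\<lambda>v. \<Sum>l\<in>UNIV. v $ l * w i l x)) (at x)"
    by (rule eventually_all_finite) (rule d)
  then have evD: "\<forall>\<^sub>F x in nhds a. (F has_derivative D x) (at x)"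
    by (rule eventually_mono) (simp add: vec_has_derivative_iff D_def)
  then have evfr: "\<forall>\<^sub>F x in nhds a. frechet_derivative F (at x) = D x"
    by (rule eventually_mono) (rule frechet_derivative_at[symmetric])
  have Da: "frechet_derivative F (at a) = D a" using eventually_nhds_x_imp_x[OF evfr] .
  have c1: "\<forall>\<^sub>F x in nhds a. F differentiable (at x)"
    using evD by (rule eventually_mono) (auto simp: differentiable_def)
  have "w i l a = k i ((\<lambda>_. 0)(l := 1))" for i l
    using power_series_at_constant_term(1)[OF w[of l i]] by (simp add: deriv_coeff_def)
  then have c2: "frechet_derivative F (at a) v $ i = (\<Sum>j\<in>UNIV. v $ j * k i ((\<lambda>_. 0)(j := 1)))" for v i
    by (simp add: Da D_def)
  have c3: "(F has_derivative frechet_derivative F (at a)) (at a)"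
    using eventually_nhds_x_imp_x[OF evD] Da by simp
  have c4: "((\<lambda>x. frechet_derivative F (at x) v) has_derivative (\<lambda>u. D2 u v)) (at a)" for v
  proof -
    have "((\<lambda>x. \<Sum>l\<in>UNIV. v $ l * w i l x) has_derivative
        (\<lambda>u. \<Sum>l\<in>UNIV. v $ l * (\<Sum>j\<in>UNIV. u $ j * ww i l j))) (at a)" for i
      by (intro has_derivative_sum has_derivative_mult_right dd)
    then have "((\<lambda>x. D x v) has_derivative (\<lambda>u. D2 u v)) (at a)"
      unfolding vec_has_derivative_iff by (simp add: D_def D2_def)
    moreover have "\<forall>\<^sub>F x in at a. D x v = frechet_derivative F (at x) v"
      using evfr unfolding eventually_nhds_conv_at by (auto elim!: eventually_mono)
    ultimately show ?thesis
      by (rule has_derivative_transform_eventually) (use Da in simp_all)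
  qed
  have "bilinear D2"
    unfolding bilinear_def
  proof (intro conjI allI linearI)
    fix x y z :: "real ^ 'm" and c :: real
    show "D2 x (y + z) = D2 x y + D2 x z"
      by (simp add: D2_def vec_eq_iff distrib_right sum.distrib)
    show "D2 x (c *\<^sub>R y) = c *\<^sub>R D2 x y"
      by (simp add: D2_def vec_eq_iff sum_distrib_left mult.assoc)
    show "D2 (x + y) z = D2 x z + D2 y z"
      by (simp add: D2_def vec_eq_iff distrib_right distrib_left sum.distrib)
    show "D2 (c *\<^sub>R x) y = c *\<^sub>R D2 x y"
      by (simp add: D2_def vec_eq_iff sum_distrib_left mult_ac)
  qed
  then have c5: "bounded_bilinear D2" using bilinear_conv_bounded_bilinear by blast
  have c6: "\<forall>\<^sub>F x in nhds a. norm (F x - F a - frechet_derivative F (at a) (x - a) - (1/2) *\<^sub>R D2 (x - a) (x - a))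
       \<le> (\<Sum>i\<in>UNIV. K i) * norm (x - a) ^ 3"
  proof -
    have "\<forall>\<^sub>F x in nhds a. \<forall>i. \<bar>quadratic_error (\<lambda>x. F x $ i) (\<lambda>l. w i l a) (ww i) a x\<bar> \<le> K i * norm (x - a) ^ 3"
      by (rule eventually_all_finite) (rule b)
    then show ?thesis
    proof (rule eventually_mono)
      fix x assume h: "\<forall>i. \<bar>quadratic_error (\<lambda>x. F x $ i) (\<lambda>l. w i l a) (ww i) a x\<bar> \<le> K i * norm (x - a) ^ 3"
      show "norm (F x - F a - frechet_derivative F (at a) (x - a) - (1/2) *\<^sub>R D2 (x - a) (x - a))
       \<le> (\<Sum>i\<in>UNIV. K i) * norm (x - a) ^ 3"
        unfolding sum_distrib_right
        by (rule order.trans[OF norm_le_l1_cart], rule sum_mono) (use h in \<open>simp add: Da D_def D2_def quadratic_error_def\<close>)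
    qed
  qed
  show ?thesis using that[OF c1 c2 c3 c4 c5 _ c6] K by (simp add: sum_nonneg)
qed

lemma analytic_eventually_isCont:
  fixes F :: "real ^ 'm \<Rightarrow> real ^ 'n"
  assumes "\<And>i. power_series_at (k i) (\<lambda>x. F x $ i) a"
  shows "\<forall>\<^sub>F x in nhds a. isCont F x"
proof -
  have "\<forall>\<^sub>F x in nhds a. F differentiable (at x)" by (rule analytic_second_order[OF assms])
  then show ?thesis by (rule eventually_mono) (rule differentiable_imp_continuous_within)
qed

text \<open>Near \<open>a\<close> the vector of termwise partials is a gradient, and uniqueness of
  derivatives lets it replace the definite description in \<open>grad\<close>.\<close>

lemma power_series_grad:
  fixes a :: "real ^ 'm"
  assumes "power_series_at k C a"
  shows "power_series_at (deriv_coeff i k) (\<lambda>x. grad C x $ i) a"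
proof -
  obtain r w where r: "r > 0" and w: "\<And>l. power_series_at (deriv_coeff l k) (w l) a"
    and u: "\<And>x. x \<in> ball a r \<Longrightarrow> (C has_derivative (\<lambda>v. \<Sum>l\<in>UNIV. v $ l * w l x)) (at x)"
    using power_series_at_derivative[OF assms] by blast
  have "grad C x = (\<chi> l. w l x)" if "x \<in> ball a r" for x
  proof -
    have *: "GDERIV C x :> (\<chi> l. w l x)"
      unfolding gderiv_def using u[OF that] by (simp add: inner_vec_def)
    show ?thesis unfolding grad_def
    proof (rule the_equality[where P = "\<lambda>D. GDERIV C x :> D", OF *])
      fix D assume "GDERIV C x :> D"
      then have "(\<lambda>h. inner h D) = (\<lambda>h. inner h (\<chi> l. w l x))"
        using * unfolding gderiv_def by (rule has_derivative_unique)
      then show "D = (\<chi> l. w l x)" by (metis inner_commute vector_eq_rdot)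
    qed
  qed
  then show ?thesis
    by (intro power_series_at_cong[OF w r]) simp
qed

lemma real_analytic_on_scalar:
  assumes "real_analytic_on u U" "a \<in> U"
  shows "\<exists>k. power_series_at k u a"
  using assms unfolding real_analytic_on_def power_series_at_def mpow_def by (simp, blast)

lemma real_analytic_on_component:
  fixes f :: "real ^ 'm \<Rightarrow> real ^ 'n"
  assumes "real_analytic_on f U" "a \<in> U"
  shows "\<exists>k. \<forall>i. power_series_at (k i) (\<lambda>x. f x $ i) a"
proof -
  obtain r k where r: "r > 0" and k: "\<forall>x\<in>ball a r.
        ((\<lambda>\<nu>. (\<Prod>i\<in>UNIV. (x $ i - a $ i) ^ \<nu> i) *\<^sub>R k \<nu>) has_sum f x) UNIV"
    using assms unfolding real_analytic_on_def by blast
  have "((\<lambda>\<nu>. mpow (x - a) \<nu> * k \<nu> $ i) has_sum f x $ i) UNIV" if "x \<in> ball a r" for x i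
    using has_sum_bounded_linear[OF bounded_linear_vec_nth[of i] k[rule_format, OF that]]
    by (simp add: mpow_def)
  then show ?thesis using r unfolding power_series_at_def
    by (intro exI[of _ "\<lambda>i \<nu>. k \<nu> $ i"]) blast
qed

subsection \<open>Asymptotics uniform in the path parameter\<close>

text \<open>A bound for h -> 0+ that is uniform in the path parameter c; quantities depending on h
  alone are written as constant in c. The comparison function is arbitrary so that it may contain
  |\<alpha> h|.\<close>

definition unif_bigo :: "(real \<Rightarrow> real) \<Rightarrow> (real \<Rightarrow> real \<Rightarrow> 'b::real_normed_vector) \<Rightarrow> bool" where
  "unif_bigo b u \<longleftrightarrow> (\<exists>K\<ge>0. \<forall>\<^sub>F h in at_right 0. \<forall>c\<in>{0..1}. norm (u h c) \<le> K * b h)"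

abbreviation order_h :: "nat \<Rightarrow> (real \<Rightarrow> real \<Rightarrow> 'b::real_normed_vector) \<Rightarrow> bool" where
  "order_h n \<equiv> unif_bigo (\<lambda>h. h ^ n)"

lemma unif_bigoI:
  assumes "K \<ge> 0" "\<forall>\<^sub>F h in at_right 0. \<forall>c\<in>{0..1}. norm (u h c) \<le> K * b h"
  shows "unif_bigo b u"
  using assms unfolding unif_bigo_def by blast

lemma unif_bigoE:
  assumes "unif_bigo b u"
  obtains K where "K \<ge> 0" "\<forall>\<^sub>F h in at_right 0. \<forall>c\<in>{0..1}. norm (u h c) \<le> K * b h"
  using assms unfolding unif_bigo_def by blast

lemma eventually_at_right_unit: "\<forall>\<^sub>F h in at_right (0::real). 0 < h \<and> h < 1"
  using eventually_at_right_real[of 0 1] by simp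

lemma unif_bigo_cong:
  assumes "unif_bigo b u" "\<forall>\<^sub>F h in at_right 0. \<forall>c\<in>{0..1}. v h c = u h c"
  shows "unif_bigo b v"
proof -
  obtain K where K: "K \<ge> 0" "\<forall>\<^sub>F h in at_right 0. \<forall>c\<in>{0..1}. norm (u h c) \<le> K * b h"
    using assms(1) by (rule unif_bigoE)
  show ?thesis
    by (rule unif_bigoI[OF K(1)], use K(2) assms(2) in eventually_elim) simp
qed

lemma unif_bigo_add:
  assumes "unif_bigo b u" "unif_bigo b v"
  shows "unif_bigo b (\<lambda>h c. u h c + v h c)"
proof -
  obtain K L where K: "K \<ge> 0" "\<forall>\<^sub>F h in at_right 0. \<forall>c\<in>{0..1}. norm (u h c) \<le> K * b h"
    and L: "L \<ge> 0" "\<forall>\<^sub>F h in at_right 0. \<forall>c\<in>{0..1}. norm (v h c) \<le> L * b h"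
    using assms by (blast elim: unif_bigoE)
  have "\<forall>\<^sub>F h in at_right 0. \<forall>c\<in>{0..1}. norm (u h c + v h c) \<le> (K + L) * b h"
    using K(2) L(2) by eventually_elim (auto simp: distrib_right intro: norm_triangle_le add_mono)
  then show ?thesis using K(1) L(1) by (intro unif_bigoI[of "K + L"]) auto
qed

lemma unif_bigo_0 [simp]: "unif_bigo b (\<lambda>h c. 0)"
  by (rule unif_bigoI[of 0]) auto

lemma unif_bigo_minus: "unif_bigo b u \<Longrightarrow> unif_bigo b (\<lambda>h c. - u h c)"
  unfolding unif_bigo_def by simp

lemma unif_bigo_diff:
  "unif_bigo b u \<Longrightarrow> unif_bigo b v \<Longrightarrow> unif_bigo b (\<lambda>h c. u h c - v h c)"
  using unif_bigo_add[of b u "\<lambda>h c. - v h c"] unif_bigo_minus[of b v] by simp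

lemma unif_bigo_sum:
  assumes "\<And>i. i \<in> I \<Longrightarrow> unif_bigo b (u i)"
  shows "unif_bigo b (\<lambda>h c. \<Sum>i\<in>I. u i h c)"
  using assms by (induction I rule: infinite_finite_induct) (auto intro: unif_bigo_add)

lemma unif_bigo_bilinear:
  assumes "bounded_bilinear B" "unif_bigo a u" "unif_bigo b v"
  shows "unif_bigo (\<lambda>h. a h * b h) (\<lambda>h c. B (u h c) (v h c))"
proof -
  obtain C where C: "C \<ge> 0" "\<And>x y. norm (B x y) \<le> norm x * norm y * C"
    using bounded_bilinear.nonneg_bounded[OF assms(1)] by blast
  obtain K L where K: "K \<ge> 0" "\<forall>\<^sub>F h in at_right 0. \<forall>c\<in>{0..1}. norm (u h c) \<le> K * a h"
    and L: "L \<ge> 0" "\<forall>\<^sub>F h in at_right 0. \<forall>c\<in>{0..1}. norm (v h c) \<le> L * b h"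
    using assms by (blast elim: unif_bigoE)
  have "\<forall>\<^sub>F h in at_right 0. \<forall>c\<in>{0..1}. norm (B (u h c) (v h c)) \<le> (K * L * C) * (a h * b h)"
    using K(2) L(2)
  proof eventually_elim
    case (elim h)
    show ?case
    proof
      fix c :: real assume c: "c \<in> {0..1}"
      \<comment> \<open>The comparison function carries no sign condition; nonnegativity of its
        multiple is inherited from the norm it bounds.\<close>
      have "0 \<le> K * a h" using elim(1) c norm_ge_zero order.trans by blast
      then have "norm (u h c) * norm (v h c) * C \<le> (K * a h) * (L * b h) * C"
        using elim c C(1) by (intro mult_right_mono mult_mono) auto
      then show "norm (B (u h c) (v h c)) \<le> (K * L * C) * (a h * b h)"
        using C(2)[of "u h c" "v h c"] by (simp add: mult_ac)
    qed
  qed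
  then show ?thesis using K(1) L(1) C(1) by (intro unif_bigoI[of "K * L * C"]) auto
qed

lemmas unif_bigo_mult = unif_bigo_bilinear[OF bounded_bilinear_mult]
lemmas unif_bigo_scaleR = unif_bigo_bilinear[OF bounded_bilinear_scaleR]

text \<open>An instance of the bilinear estimate for (r, x) |-> r B x at the constant r = 1.\<close>

lemma unif_bigo_linear:
  assumes "bounded_linear B" "unif_bigo b v"
  shows "unif_bigo b (\<lambda>h c. B (v h c))"
proof -
  have "bounded_bilinear (\<lambda>(r::real) x. r *\<^sub>R B x)"
    by (rule bounded_bilinear.comp[OF bounded_bilinear_scaleR bounded_linear_ident assms(1)])
  moreover have "unif_bigo (\<lambda>_. 1) (\<lambda>h c. 1::real)" by (rule unif_bigoI[of 1]) auto
  ultimately show ?thesis using unif_bigo_bilinear[of _ "\<lambda>_. 1" "\<lambda>h c. 1" b v] assms(2) by fastforce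
qed

lemma unif_bigo_const [simp]: "unif_bigo (\<lambda>_. 1) (\<lambda>h c. x)"
  by (rule unif_bigoI[of "norm x"]) auto

lemma unif_bigo_h [simp]: "order_h n (\<lambda>h c. h ^ n)"
  by (rule unif_bigoI[of 1]) (use eventually_at_right_unit in \<open>auto elim!: eventually_mono\<close>)

lemma unif_bigo_mono:
  assumes "unif_bigo a u" "L \<ge> 0" "\<forall>\<^sub>F h in at_right 0. a h \<le> L * b h"
  shows "unif_bigo b u"
proof -
  obtain K where K: "K \<ge> 0" "\<forall>\<^sub>F h in at_right 0. \<forall>c\<in>{0..1}. norm (u h c) \<le> K * a h"
    using assms(1) by (rule unif_bigoE)
  have "\<forall>\<^sub>F h in at_right 0. \<forall>c\<in>{0..1}. norm (u h c) \<le> (K * L) * b h"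
    using K(2) assms(3)
  proof eventually_elim
    case (elim h)
    then have "K * a h \<le> (K * L) * b h" using K(1) by (metis mult.assoc mult_left_mono)
    then show ?case using elim(1) by fastforce
  qed
  then show ?thesis using K(1) assms(2) by (intro unif_bigoI[of "K * L"]) auto
qed

lemma unif_bigo_power_mono:
  assumes "order_h n u" "m \<le> n" shows "order_h m u"
  by (rule unif_bigo_mono[OF assms(1), of 1], simp, use eventually_at_right_unit in eventually_elim)
    (use assms(2) in \<open>simp add: power_decreasing\<close>)

lemma unif_bigo_scale:
  assumes "unif_bigo b u" shows "unif_bigo b (\<lambda>h c. r *\<^sub>R u h c)"
  using unif_bigo_linear[OF bounded_linear_scaleR_right assms] .

lemma unif_bigo_cmult:
  fixes u :: "real \<Rightarrow> real \<Rightarrow> real"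
  assumes "unif_bigo b u" shows "unif_bigo b (\<lambda>h c. r * u h c)"
  using unif_bigo_scale[OF assms, of r] by simp

lemma unif_bigo_eval:
  assumes "unif_bigo b u" "x \<in> {0..1}" shows "unif_bigo b (\<lambda>h c. u h x)"
  using assms unfolding unif_bigo_def by (auto elim!: eventually_mono)

lemma unif_bigo_continuous:
  assumes "continuous_on {0..1} p" shows "unif_bigo (\<lambda>_. 1) (\<lambda>h c. p c)"
proof -
  have "bounded (p ` {0..1})"
    using compact_continuous_image[OF assms compact_Icc] by (rule compact_imp_bounded)
  then obtain B where B: "\<forall>x\<in>p ` {0..1}. norm x \<le> B" unfolding bounded_iff by blast
  then have "B \<ge> 0" by (meson atLeastAtMost_iff dual_order.refl image_eqI norm_ge_zero order.trans zero_le_one)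
  then show ?thesis using B by (intro unif_bigoI[of B]) auto
qed

lemma unif_bigo_poly: "unif_bigo (\<lambda>_. 1) (\<lambda>h c. poly p c)"
  by (rule unif_bigo_continuous) (simp add: continuous_on_poly)

lemma unif_bigo_integral:
  fixes u :: "real \<Rightarrow> real \<Rightarrow> 'b::banach"
  assumes "unif_bigo b u" shows "unif_bigo b (\<lambda>h c. integral {0..1} (u h))"
proof -
  obtain K where K: "K \<ge> 0" "\<forall>\<^sub>F h in at_right 0. \<forall>c\<in>{0..1}. norm (u h c) \<le> K * b h"
    using assms by (rule unif_bigoE)
  have "\<forall>\<^sub>F h in at_right 0. norm (integral {0..1} (u h)) \<le> K * b h"
    using K(2)
  proof eventually_elim
    case (elim h)
    \<comment> \<open>Serves the case of a function that is not integrable, whose integral is 0 by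
      convention.\<close>
    have nn: "0 \<le> K * b h" using order.trans[OF norm_ge_zero bspec[OF elim, of 0]] by simp
    show ?case
    proof (cases "u h integrable_on {0..1}")
      case True
      have "norm (integral {0..1} (u h)) \<le> integral {0..1} (\<lambda>c::real. K * b h)"
        by (rule integral_norm_bound_integral[OF True]) (use elim in auto)
      then show ?thesis by simp
    qed (use nn in \<open>simp add: not_integrable_integral\<close>)
  qed
  then show ?thesis by (intro unif_bigoI[OF K(1)]) auto
qed

lemma unif_bigo_tendsto:
  assumes "(u \<longlongrightarrow> l) (at_right 0)" shows "unif_bigo (\<lambda>_. 1) (\<lambda>h c. u h)"
proof -
  have "\<forall>\<^sub>F h in at_right 0. norm (u h) < norm l + 1"
    using order_tendstoD(2)[OF tendsto_norm[OF assms], of "norm l + 1"] by simp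
  then show ?thesis by (intro unif_bigoI[of "norm l + 1"]) (auto elim!: eventually_mono)
qed

lemma unif_bigo_gauss_quad:
  assumes "unif_bigo b u" shows "unif_bigo b (\<lambda>h c. gauss_quad s (u h))"
  unfolding gauss_quad_def
  using assms gauss_node_in_unit_interval by (intro unif_bigo_sum unif_bigo_cmult unif_bigo_eval) auto

text \<open>Submultiplicativity up to constants is what makes coefficientwise bounds survive
  products; the condition on \<open>b 0\<close> admits the constant polynomial 1.\<close>

definition graded_weight :: "(nat \<Rightarrow> real \<Rightarrow> real) \<Rightarrow> bool" where
  "graded_weight b \<longleftrightarrow> (\<exists>L\<ge>0. \<forall>\<^sub>F h in at_right 0. 1 \<le> L * b 0 h) \<and>
     (\<forall>k l. \<exists>L\<ge>0. \<forall>\<^sub>F h in at_right 0. b k h * b l h \<le> L * b (k + l) h)"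

text \<open>The degree bound is uniform in h, so that expansions into monomials are sums over a
  fixed finite range.\<close>

definition graded_poly :: "(nat \<Rightarrow> real \<Rightarrow> real) \<Rightarrow> (real \<Rightarrow> real poly) \<Rightarrow> bool" where
  "graded_poly b p \<longleftrightarrow> (\<exists>n. \<forall>h. degree (p h) \<le> n) \<and> (\<forall>k. unif_bigo (b k) (\<lambda>h c. coeff (p h) k))"

lemma graded_poly_sum:
  assumes "\<And>i. i \<in> I \<Longrightarrow> graded_poly b (p i)"
  shows "graded_poly b (\<lambda>h. \<Sum>i\<in>I. p i h)"
  using assms
proof (induction I rule: infinite_finite_induct)
  case (insert i I)
  then obtain n m where n: "\<And>h. degree (p i h) \<le> n" and m: "\<And>h. degree (\<Sum>i\<in>I. p i h) \<le> m"
    unfolding graded_poly_def by (metis insertCI)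
  have "degree (\<Sum>i\<in>insert i I. p i h) \<le> max n m" for h
    using degree_add_le[OF order.trans[OF n max.cobounded1] order.trans[OF m max.cobounded2]] insert.hyps
    by simp
  moreover have "unif_bigo (b k) (\<lambda>h c. coeff (\<Sum>i\<in>insert i I. p i h) k)" for k
    using insert unif_bigo_add[of "b k" "\<lambda>h c. coeff (p i h) k" "\<lambda>h c. coeff (\<Sum>i\<in>I. p i h) k"]
    unfolding graded_poly_def by simp
  ultimately show ?case unfolding graded_poly_def by blast
qed (auto simp: graded_poly_def)

lemma graded_poly_smult:
  assumes "graded_poly b p" shows "graded_poly b (\<lambda>h. smult r (p h))"
  using assms unfolding graded_poly_def
  by (auto intro: unif_bigo_cmult order.trans[OF degree_smult_le])

lemma graded_poly_mult:
  assumes "graded_weight b" "graded_poly b p" "graded_poly b q"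
  shows "graded_poly b (\<lambda>h. p h * q h)"
proof -
  obtain n m where n: "\<And>h. degree (p h) \<le> n" and m: "\<And>h. degree (q h) \<le> m"
    using assms unfolding graded_poly_def by blast
  have "degree (p h * q h) \<le> n + m" for h
    using degree_mult_le[of "p h" "q h"] n[of h] m[of h] by linarith
  moreover have "unif_bigo (b k) (\<lambda>h c. coeff (p h * q h) k)" for k
    unfolding coeff_mult
  proof (rule unif_bigo_sum)
    fix i assume i: "i \<in> {..k}"
    obtain L where L: "L \<ge> 0" "\<forall>\<^sub>F h in at_right 0. b i h * b (k - i) h \<le> L * b k h"
      using assms(1) i unfolding graded_weight_def by (metis atMost_iff le_add_diff_inverse)
    show "unif_bigo (b k) (\<lambda>h c. coeff (p h) i * coeff (q h) (k - i))"
      using assms(2,3) unfolding graded_poly_def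
      by (intro unif_bigo_mono[OF unif_bigo_mult L]) auto
  qed
  ultimately show ?thesis unfolding graded_poly_def by blast
qed

lemma graded_poly_1:
  assumes "graded_weight b" shows "graded_poly b (\<lambda>h. 1)"
proof -
  obtain L where L: "L \<ge> 0" "\<forall>\<^sub>F h in at_right 0. 1 \<le> L * b 0 h"
    using assms unfolding graded_weight_def by blast
  have "unif_bigo (b k) (\<lambda>h c. coeff (1 :: real poly) k)" for k
    using unif_bigo_mono[OF unif_bigo_const[of "1::real"] L] by (cases "k = 0") simp_all
  then show ?thesis unfolding graded_poly_def by (intro conjI exI[of _ 0] allI) simp_all
qed

lemma graded_poly_power:
  assumes "graded_weight b" "graded_poly b p" shows "graded_poly b (\<lambda>h. p h ^ n)"
  by (induction n) (simp_all add: graded_poly_1 graded_poly_mult assms)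

lemma graded_poly_prod:
  assumes "graded_weight b" "\<And>i. i \<in> I \<Longrightarrow> graded_poly b (p i)"
  shows "graded_poly b (\<lambda>h. \<Prod>i\<in>I. p i h)"
  using assms(2)
  by (induction I rule: infinite_finite_induct)
    (auto simp: graded_poly_1 assms(1) intro: graded_poly_mult[OF assms(1)])

subsection \<open>Orders of the stages and Fourier coefficients\<close>

lemma poly_sum_monoms:
  fixes p :: "real poly"
  assumes "degree p \<le> n" shows "p = (\<Sum>k\<le>n. smult (coeff p k) (monom 1 k))"
  using poly_as_sum_of_monoms'[OF assms] by (simp add: smult_monom)

lemma gauss_quad_expand:
  assumes "degree p \<le> n"
  shows "gauss_quad s (poly (q * p)) = (\<Sum>k\<le>n. coeff p k * gauss_quad s (poly (q * monom 1 k)))"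
proof -
  have "poly (q * p) = (\<lambda>x. \<Sum>k\<le>n. coeff p k * poly (q * monom 1 k) x)"
    by (subst poly_sum_monoms[OF assms]) (simp add: fun_eq_iff poly_sum sum_distrib_left mult.left_commute)
  then show ?thesis by (simp only: gauss_quad_sum)
qed

lemma unit_int_expand:
  assumes "degree p \<le> n"
  shows "unit_int (q * p) = (\<Sum>k\<le>n. coeff p k * unit_int (q * monom 1 k))"
  by (subst poly_sum_monoms[OF assms]) (simp add: sum_distrib_left unit_int_sum unit_int_smult)

lemma unif_bigo_vec:
  fixes u :: "real \<Rightarrow> real \<Rightarrow> real ^ 'n"
  assumes "\<And>i. unif_bigo b (\<lambda>h c. u h c $ i)"
  shows "unif_bigo b u"
proof -
  have "unif_bigo b (\<lambda>h c. \<Sum>i\<in>UNIV. \<bar>u h c $ i\<bar>)"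
  proof (rule unif_bigo_sum)
    fix i show "unif_bigo b (\<lambda>h c. \<bar>u h c $ i\<bar>)"
      using assms[of i] unfolding unif_bigo_def by simp
  qed
  then obtain K where K: "K \<ge> 0"
    "\<forall>\<^sub>F h in at_right 0. \<forall>c\<in>{0..1}. norm (\<Sum>i\<in>UNIV. \<bar>u h c $ i\<bar>) \<le> K * b h"
    by (rule unif_bigoE)
  show ?thesis
  proof (rule unif_bigoI[OF K(1)], use K(2) in eventually_elim)
    case (elim h)
    show ?case
    proof
      fix c :: real assume "c \<in> {0..1}"
      then have "\<bar>\<Sum>i\<in>UNIV. \<bar>u h c $ i\<bar>\<bar> \<le> K * b h" using elim by simp
      then show "norm (u h c) \<le> K * b h" using norm_le_l1_cart[of "u h c"] by linarith
    qed
  qed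
qed

lemma unif_bigo_component:
  "unif_bigo b u \<Longrightarrow> unif_bigo b (\<lambda>h c. u h c $ i)"
  by (rule unif_bigo_linear[OF bounded_linear_vec_nth])

text \<open>Transfers local facts at \<open>a\<close> to a whole path: a path within O(h) of
  \<open>a\<close> eventually lies in any given neighbourhood, for all c at once.\<close>

lemma tendsto_of_unif_bigo:
  assumes u: "order_h 1 (\<lambda>h c. u h c - (a :: 'b :: real_normed_vector))"
    and P: "\<forall>\<^sub>F x in nhds a. P x"
  shows "\<forall>\<^sub>F h in at_right 0. \<forall>c\<in>{0..1}. P (u h c)"
proof -
  obtain r where r: "r > 0" "\<And>x. dist x a < r \<Longrightarrow> P x" using P by (auto simp: eventually_nhds_metric)
  obtain K where K: "K \<ge> 0" "\<forall>\<^sub>F h in at_right 0. \<forall>c\<in>{0..1}. norm (u h c - a) \<le> K * h ^ 1"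
    using u by (rule unif_bigoE)
  have "((\<lambda>h. K * h) \<longlongrightarrow> K * 0) (at_right 0)" by (intro tendsto_intros)
  then have "\<forall>\<^sub>F h in at_right 0. K * h < r" using order_tendstoD(2)[of _ "K * 0"] r(1) by force
  with K(2) show ?thesis
    by eventually_elim (use r(2) in \<open>force simp: dist_norm\<close>)
qed

text \<open>Common setting of both cases: \<open>g\<close> is the gradient of \<open>C\<close> in
  (a) and the field - J f in (b), and \<kappa> is the constant of the standing assumption. The
  relation between \<open>f\<close> and \<open>g\<close> enters through \<open>orth\<close>.\<close>

locale gauss_family =
  fixes s :: nat and f g :: "real ^ 'm \<Rightarrow> real ^ 'm" and y0 :: "real ^ 'm" and U :: "(real ^ 'm) set"
    and \<alpha> :: "real \<Rightarrow> real" and Y :: "real \<Rightarrow> nat \<Rightarrow> real ^ 'm" and \<kappa> :: real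
    and kf kg :: "'m \<Rightarrow> ('m \<Rightarrow> nat) \<Rightarrow> real"
  assumes s2: "2 \<le> s" and \<kappa>0: "0 \<le> \<kappa>"
    and kf: "\<And>i. power_series_at (kf i) (\<lambda>x. f x $ i) y0"
    and kg: "\<And>i. power_series_at (kg i) (\<lambda>x. g x $ i) y0"
    and stages: "\<forall>\<^sub>F h in at_right 0. is_stages s f U y0 h (\<alpha> h) (Y h)"
    and Y_tendsto: "\<And>i. i < s \<Longrightarrow> ((\<lambda>h. Y h i) \<longlongrightarrow> y0) (at_right 0)"
    and \<alpha>_le: "\<forall>\<^sub>F h in at_right 0. \<bar>\<alpha> h\<bar> \<le> \<kappa> * h\<^sup>2"
    and orth: "\<forall>\<^sub>F y in nhds y0. inner (g y) (f y) = 0"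
begin

abbreviation "\<gamma> h j \<equiv> gam s f (Y h) j"
abbreviation "\<pi> h j \<equiv> pert s f (Y h) j"
abbreviation "\<sigma> h \<equiv> sigma1 s f y0 h (\<alpha> h) (Y h)"
abbreviation "\<rho> h \<equiv> path_coeff g (\<sigma> h)"

text \<open>The path is polynomial in c for c >= 0, where the integrals in \<open>sigma1\<close> are
  values of antiderivatives; in this form its coefficients can be graded.\<close>

definition sigma_poly :: "'m \<Rightarrow> real \<Rightarrow> real poly" where
  "sigma_poly i h = smult h (\<Sum>j<s. smult ((\<gamma> h j - \<alpha> h *\<^sub>R \<pi> h j) $ i) (antideriv (legendre j)))"

lemma sigma_eq:
  assumes "0 \<le> c"
  shows "\<sigma> h c = y0 + h *\<^sub>R (\<Sum>j<s. poly (antideriv (legendre j)) c *\<^sub>R (\<gamma> h j - \<alpha> h *\<^sub>R \<pi> h j))"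
  using integral_unique[OF has_integral_poly[OF assms]] by (simp add: sigma1_def)

lemma poly_sigma_poly:
  assumes "0 \<le> c" shows "poly (sigma_poly i h) c = (\<sigma> h c - y0) $ i"
  unfolding sigma_eq[OF assms] by (simp add: sigma_poly_def poly_sum mult.commute)

lemma degree_sigma_poly: "degree (sigma_poly i h) \<le> s"
  unfolding sigma_poly_def
proof (rule order.trans[OF degree_smult_le degree_sum_le])
  fix j assume "j \<in> {..<s}"
  then show "degree (smult ((\<gamma> h j - \<alpha> h *\<^sub>R \<pi> h j) $ i) (antideriv (legendre j))) \<le> s"
    using order.trans[OF degree_smult_le degree_antideriv_le[of "legendre j"]]
    by (metis Suc_eq_plus1 Suc_leI degree_legendre lessThan_iff order.trans)
qed simp

lemma isCont_f: "isCont f y0"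
  using eventually_nhds_x_imp_x[OF analytic_eventually_isCont[OF kf]] .

lemma unif_bigo_gamma: "unif_bigo (\<lambda>_. 1) (\<lambda>h c. \<gamma> h j)"
proof -
  have "((\<lambda>h. f (Y h i)) \<longlongrightarrow> f y0) (at_right 0)" if "i < s" for i
    using isCont_tendsto_compose[OF isCont_f Y_tendsto[OF that]] .
  then have "((\<lambda>h. \<gamma> h j) \<longlongrightarrow> (\<Sum>i<s. (gauss_weight s i * poly (legendre j) (gauss_node s i)) *\<^sub>R f y0)) (at_right 0)"
    unfolding gam_def by (intro tendsto_intros) auto
  then show ?thesis by (rule unif_bigo_tendsto)
qed

lemma unif_bigo_pert: "unif_bigo (\<lambda>_. 1) (\<lambda>h c. \<pi> h j)"
  unfolding pert_def by (intro unif_bigo_diff unif_bigo_scale unif_bigo_gamma)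

lemma unif_bigo_alpha_abs: "unif_bigo (\<lambda>h. \<bar>\<alpha> h\<bar>) (\<lambda>h c. \<alpha> h)"
  by (rule unif_bigoI[of 1]) auto

lemma unif_bigo_alpha: "order_h 2 (\<lambda>h c. \<alpha> h)"
  by (rule unif_bigo_mono[OF unif_bigo_alpha_abs \<kappa>0 \<alpha>_le])

lemma unif_bigo_sigma: "order_h 1 (\<lambda>h c. \<sigma> h c - y0)"
proof (rule unif_bigo_cong)
  have "unif_bigo (\<lambda>_. 1) (\<lambda>h c. \<gamma> h j - \<alpha> h *\<^sub>R \<pi> h j)" for j
    using unif_bigo_scaleR[OF unif_bigo_power_mono[OF unif_bigo_alpha, of 0] unif_bigo_pert]
    by (intro unif_bigo_diff unif_bigo_gamma) simp
  then have "unif_bigo (\<lambda>_. 1 * 1) (\<lambda>h c. poly (antideriv (legendre j)) c *\<^sub>R (\<gamma> h j - \<alpha> h *\<^sub>R \<pi> h j))" for j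
    by (rule unif_bigo_scaleR[OF unif_bigo_poly])
  then have "unif_bigo (\<lambda>_. 1) (\<lambda>h c. (\<Sum>j<s. poly (antideriv (legendre j)) c *\<^sub>R (\<gamma> h j - \<alpha> h *\<^sub>R \<pi> h j)))"
    by (intro unif_bigo_sum) simp
  from unif_bigo_scaleR[OF unif_bigo_h[of 1] this]
  show "order_h 1 (\<lambda>h c. h *\<^sub>R (\<Sum>j<s. poly (antideriv (legendre j)) c *\<^sub>R (\<gamma> h j - \<alpha> h *\<^sub>R \<pi> h j)))"
    by simp
qed (auto simp: sigma_eq)

lemmas eventually_sigma = tendsto_of_unif_bigo[OF unif_bigo_sigma]

text \<open>The vector of the \<pi> is the inverse of X_s applied to W_s \<gamma>, because W_s
  \<gamma> has only the entries -\<gamma>_1 and \<gamma>_0 in its first two rows.\<close>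

lemma sum_X_mat_pert:
  assumes "k < s"
  shows "(\<Sum>j<s. X_mat s $$ (k, j) *\<^sub>R \<pi> h j) = (\<Sum>l<s. W_mat s $$ (k, l) *\<^sub>R \<gamma> h l)"
proof -
  have "(\<Sum>j<s. X_mat s $$ (k, j) *\<^sub>R \<pi> h j) =
      (\<Sum>j<s. X_mat s $$ (k, j) * phi s 2 j) *\<^sub>R \<gamma> h 0 - (\<Sum>j<s. X_mat s $$ (k, j) * phi s 1 j) *\<^sub>R \<gamma> h 1"
    by (simp add: pert_def scaleR_diff_right sum_subtractf scaleR_sum_left)
  also have "\<dots> = of_bool (k = 1) *\<^sub>R \<gamma> h 0 - of_bool (k = 0) *\<^sub>R \<gamma> h 1"
    using X_mat_mult_phi[of 2 k s] X_mat_mult_phi[of 1 k s] assms by simp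
  also have "\<dots> = (\<Sum>l<s. (if l = 0 then of_bool (k = 1) *\<^sub>R \<gamma> h 0 else 0)
      + (if l = 1 then - (of_bool (k = 0) *\<^sub>R \<gamma> h 1) else 0))"
    using s2 by (simp add: sum.distrib)
  also have "\<dots> = (\<Sum>l<s. W_mat s $$ (k, l) *\<^sub>R \<gamma> h l)"
    using assms by (intro sum.cong) (auto simp: W_mat_index)
  finally show ?thesis .
qed

text \<open>In A(\<alpha>) the last two factors turn the values f(Y_j) into the vector \<gamma>.
  Since W_s \<gamma> = X_s \<pi>, the matrix X_s acts on \<gamma> - \<alpha> \<pi>, that is, it
  integrates; the P_s component it drops vanishes at the nodes.\<close>

lemma stage_eq_sigma: "\<forall>\<^sub>F h in at_right 0. \<forall>i<s. Y h i = \<sigma> h (gauss_node s i)"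
  using stages
proof eventually_elim
  case (elim h)
  show ?case
  proof (intro allI impI)
    fix i assume i: "i < s"
    let ?P = "\<lambda>k. poly (legendre k) (gauss_node s i)"
    let ?w = "\<lambda>l j. gauss_weight s j * poly (legendre l) (gauss_node s j)"
    have "(\<Sum>j<s. (A_mat s (\<alpha> h) $$ (i, j)) *\<^sub>R f (Y h j)) =
       (\<Sum>j<s. \<Sum>k<s. \<Sum>l<s. (?P k * ((X_mat s $$ (k, l) - \<alpha> h * W_mat s $$ (k, l)) * ?w l j)) *\<^sub>R f (Y h j))"
      using i by (intro sum.cong refl) (simp add: A_mat_index scaleR_sum_left sum_distrib_left)
    also have "\<dots> = (\<Sum>k<s. \<Sum>l<s. \<Sum>j<s. (?P k * ((X_mat s $$ (k, l) - \<alpha> h * W_mat s $$ (k, l)) * ?w l j)) *\<^sub>R f (Y h j))"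
      by (subst sum.swap) (intro sum.cong refl sum.swap)
    also have "\<dots> = (\<Sum>k<s. \<Sum>l<s. (?P k * (X_mat s $$ (k, l) - \<alpha> h * W_mat s $$ (k, l))) *\<^sub>R \<gamma> h l)"
      by (simp add: gam_def scaleR_sum_right mult.assoc)
    also have "\<dots> = (\<Sum>k<s. ?P k *\<^sub>R ((\<Sum>l<s. X_mat s $$ (k, l) *\<^sub>R \<gamma> h l) - \<alpha> h *\<^sub>R (\<Sum>l<s. W_mat s $$ (k, l) *\<^sub>R \<gamma> h l)))"
      by (simp add: scaleR_diff_right scaleR_diff_left right_diff_distrib scaleR_sum_right sum_subtractf)
    also have "\<dots> = (\<Sum>k<s. ?P k *\<^sub>R ((\<Sum>l<s. X_mat s $$ (k, l) *\<^sub>R \<gamma> h l) - \<alpha> h *\<^sub>R (\<Sum>l<s. X_mat s $$ (k, l) *\<^sub>R \<pi> h l)))"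
      using sum_X_mat_pert by simp
    also have "\<dots> = (\<Sum>k<s. \<Sum>j<s. (X_mat s $$ (k, j) * ?P k) *\<^sub>R (\<gamma> h j - \<alpha> h *\<^sub>R \<pi> h j))"
      by (simp add: scaleR_diff_right scaleR_sum_right sum_subtractf mult_ac)
    also have "\<dots> = (\<Sum>j<s. (\<Sum>k<s. X_mat s $$ (k, j) * ?P k) *\<^sub>R (\<gamma> h j - \<alpha> h *\<^sub>R \<pi> h j))"
      by (subst sum.swap) (simp add: scaleR_sum_left)
    also have "\<dots> = (\<Sum>j<s. poly (antideriv (legendre j)) (gauss_node s i) *\<^sub>R (\<gamma> h j - \<alpha> h *\<^sub>R \<pi> h j))"
    proof (intro sum.cong refl)
      fix j assume "j \<in> {..<s}"
      then show "(\<Sum>k<s. X_mat s $$ (k, j) * ?P k) *\<^sub>R (\<gamma> h j - \<alpha> h *\<^sub>R \<pi> h j)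
          = poly (antideriv (legendre j)) (gauss_node s i) *\<^sub>R (\<gamma> h j - \<alpha> h *\<^sub>R \<pi> h j)"
        using antideriv_legendre_X_mat[of j s] poly_legendre_gauss_node[OF i] by (simp add: poly_sum)
    qed
    finally show "Y h i = \<sigma> h (gauss_node s i)"
      using elim i gauss_node_in_unit_interval[OF i] by (simp add: is_stages_def sigma_eq)
  qed
qed

lemma gamma_eq_gauss_quad:
  "\<forall>\<^sub>F h in at_right 0. \<forall>i j. \<gamma> h j $ i
     = gauss_quad s (\<lambda>c. poly (legendre j) c * f (\<sigma> h c) $ i)"
  using stage_eq_sigma by eventually_elim (simp add: gam_def gauss_quad_def mult.assoc)

text \<open>The size expected of the coefficient of c^k: the first term is the unperturbed order,
  saturating at r, and the second is the influence of \<alpha>, with \<open>e k\<close> counting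
  additional powers of h.\<close>

definition sigma_weight :: "nat \<Rightarrow> (nat \<Rightarrow> nat) \<Rightarrow> nat \<Rightarrow> real \<Rightarrow> real" where
  "sigma_weight r e k h = h ^ min k r + h * \<bar>\<alpha> h\<bar> * h ^ e k"

text \<open>In a product of two weights the cross terms are controlled by the first condition on
  \<open>e\<close>. The product of two perturbations uses h |\<alpha>| <= \<kappa> h^3, which
  \<open>e k <= 2\<close> turns into a further factor \<kappa> h^(e k).\<close>

lemma graded_sigma_weight:
  assumes e: "\<And>k l. e (k + l) \<le> min k r + e l" "\<And>k. e k \<le> 2"
  shows "graded_weight (sigma_weight r e)"
  unfolding graded_weight_def
proof (intro conjI allI)
  show "\<exists>L\<ge>0. \<forall>\<^sub>F h in at_right 0. 1 \<le> L * sigma_weight r e 0 h"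
    by (rule exI[of _ 1], use eventually_at_right_unit in \<open>auto simp: sigma_weight_def elim!: eventually_mono\<close>)
next
  fix k l
  \<comment> \<open>The constant counts the two cross terms, contributing 2, and the product of the
    perturbations, contributing \<kappa>.\<close>
  have "\<forall>\<^sub>F h in at_right 0. sigma_weight r e k h * sigma_weight r e l h \<le> (2 + \<kappa>) * sigma_weight r e (k + l) h"
    using eventually_at_right_unit \<alpha>_le
  proof eventually_elim
    case (elim h)
    define \<epsilon> where "\<epsilon> = h * \<bar>\<alpha> h\<bar>"
    have h: "0 < h" "h < 1" and \<epsilon>0: "0 \<le> \<epsilon>" using elim by (auto simp: \<epsilon>_def)
    have pd: "h ^ a \<le> h ^ b" if "b \<le> a" for a b using h that by (simp add: power_decreasing)
    have "\<epsilon> \<le> h * (\<kappa> * h ^ 2)" unfolding \<epsilon>_def using elim by (intro mult_left_mono) auto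
    also have "\<dots> = \<kappa> * h ^ 3" by (simp add: power2_eq_square power3_eq_cube)
    also have "\<dots> \<le> \<kappa> * h ^ e (k + l)"
      using e(2)[of "k + l"] \<kappa>0 by (intro mult_left_mono pd) auto
    finally have \<epsilon>: "\<epsilon> \<le> \<kappa> * h ^ e (k + l)" .
    have 1: "h ^ min k r * h ^ min l r \<le> h ^ min (k + l) r"
      unfolding power_add[symmetric] by (rule pd) auto
    have 2: "h ^ min k r * h ^ e l \<le> h ^ e (k + l)" "h ^ e k * h ^ min l r \<le> h ^ e (k + l)"
      unfolding power_add[symmetric] using e(1)[of k l] e(1)[of l k] by (auto intro!: pd simp: add.commute)
    have "h ^ e k * h ^ e l \<le> 1" using h by (simp add: mult_le_one power_le_one)
    then have "\<epsilon> * (h ^ e k * h ^ e l) \<le> \<epsilon> * 1" using \<epsilon>0 by (rule mult_left_mono)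
    then have 3: "\<epsilon> * (h ^ e k * h ^ e l) \<le> \<kappa> * h ^ e (k + l)" using \<epsilon> by simp
    have "sigma_weight r e k h * sigma_weight r e l h =
        h ^ min k r * h ^ min l r + \<epsilon> * (h ^ min k r * h ^ e l + h ^ e k * h ^ min l r + \<epsilon> * (h ^ e k * h ^ e l))"
      by (simp add: sigma_weight_def \<epsilon>_def[symmetric] algebra_simps)
    also have "\<dots> \<le> h ^ min (k + l) r + \<epsilon> * (h ^ e (k + l) + h ^ e (k + l) + \<kappa> * h ^ e (k + l))"
      using 1 2 3 \<epsilon>0 by (intro add_mono mult_left_mono) auto
    also have "\<dots> \<le> (2 + \<kappa>) * h ^ min (k + l) r + \<epsilon> * (h ^ e (k + l) + h ^ e (k + l) + \<kappa> * h ^ e (k + l))"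
    proof -
      have "1 * h ^ min (k + l) r \<le> (2 + \<kappa>) * h ^ min (k + l) r" using \<kappa>0 h by (intro mult_right_mono) auto
      then show ?thesis by simp
    qed
    also have "\<dots> = (2 + \<kappa>) * sigma_weight r e (k + l) h"
      by (simp add: sigma_weight_def \<epsilon>_def[symmetric] algebra_simps)
    finally show ?case .
  qed
  then show "\<exists>L\<ge>0. \<forall>\<^sub>F h in at_right 0. sigma_weight r e k h * sigma_weight r e l h \<le> L * sigma_weight r e (k + l) h"
    using \<kappa>0 by (intro exI[of _ "2 + \<kappa>"]) auto
qed

text \<open>The Taylor polynomial of order n with the path substituted, hence a polynomial in c
  whose coefficients depend on h.\<close>

definition taylor_poly :: "(('m \<Rightarrow> nat) \<Rightarrow> real) \<Rightarrow> nat \<Rightarrow> real \<Rightarrow> real poly" where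
  "taylor_poly k n h = (\<Sum>\<nu> | sum \<nu> UNIV \<le> n. smult (k \<nu>) (\<Prod>l\<in>UNIV. sigma_poly l h ^ \<nu> l))"

lemma graded_taylor_poly:
  assumes "graded_weight b" "\<And>l. graded_poly b (sigma_poly l)"
  shows "graded_poly b (taylor_poly k n)"
  unfolding taylor_poly_def[abs_def]
  by (intro graded_poly_sum graded_poly_smult graded_poly_prod graded_poly_power assms)

lemma taylor_poly_remainder:
  assumes "power_series_at k u y0"
  shows "order_h (n + 1) (\<lambda>h c. u (\<sigma> h c) - poly (taylor_poly k n h) c)"
proof -
  obtain K r where r: "r > 0" "K \<ge> 0" "\<And>x. x \<in> ball y0 r \<Longrightarrow>
    \<bar>u x - (\<Sum>\<nu> | sum \<nu> UNIV \<le> n. mpow (x - y0) \<nu> * k \<nu>)\<bar> \<le> K * norm (x - y0) ^ (n + 1)"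
    using power_series_at_truncate[OF assms] by blast
  obtain L where L: "L \<ge> 0" "\<forall>\<^sub>F h in at_right 0. \<forall>c\<in>{0..1}. norm (\<sigma> h c - y0) \<le> L * h ^ 1"
    using unif_bigo_sigma by (rule unif_bigoE)
  have b: "\<forall>\<^sub>F h in at_right 0. \<forall>c\<in>{0..1}. \<sigma> h c \<in> ball y0 r"
    by (rule eventually_sigma, rule eventually_nhds_in_open) (use r in auto)
  have "\<forall>\<^sub>F h in at_right 0. \<forall>c\<in>{0..1}. norm (u (\<sigma> h c) - poly (taylor_poly k n h) c) \<le> (K * L ^ (n + 1)) * h ^ (n + 1)"
    using L(2) b
  proof eventually_elim
    case (elim h)
    show ?case
    proof
      fix c :: real assume c: "c \<in> {0..1}"
      have p: "poly (taylor_poly k n h) c = (\<Sum>\<nu> | sum \<nu> UNIV \<le> n. mpow (\<sigma> h c - y0) \<nu> * k \<nu>)"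
        using c by (simp add: taylor_poly_def poly_sum poly_prod poly_sigma_poly mpow_def mult.commute)
      have "\<bar>u (\<sigma> h c) - poly (taylor_poly k n h) c\<bar> \<le> K * norm (\<sigma> h c - y0) ^ (n + 1)"
        unfolding p using r(3) elim(2) c by blast
      also have "\<dots> \<le> K * (L * h) ^ (n + 1)"
        using elim(1) c r(2) by (intro mult_left_mono power_mono) auto
      finally show "norm (u (\<sigma> h c) - poly (taylor_poly k n h) c) \<le> (K * L ^ (n + 1)) * h ^ (n + 1)"
        by (simp add: power_mult_distrib mult_ac)
    qed
  qed
  then show ?thesis using r(2) L(1) by (intro unif_bigoI[of "K * L ^ (n + 1)"]) auto
qed

text \<open>The antiderivative of P_j has degree j + 1 and no constant term, and the path carries
  one more factor h. The unperturbed order therefore saturates at r + 1 instead of r.\<close>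

lemma graded_sigma_poly:
  assumes "\<And>j. j < s \<Longrightarrow> unif_bigo (\<lambda>h. h ^ min j r + h * \<bar>\<alpha> h\<bar>) (\<lambda>h c. \<gamma> h j)"
  shows "graded_poly (sigma_weight (r + 1) (\<lambda>_. 0)) (sigma_poly i)"
  unfolding graded_poly_def
proof (intro conjI allI)
  show "\<exists>n. \<forall>h. degree (sigma_poly i h) \<le> n" using degree_sigma_poly by blast
next
  fix k
  have "unif_bigo (sigma_weight (r + 1) (\<lambda>_. 0) k)
      (\<lambda>h c. h * ((\<gamma> h j - \<alpha> h *\<^sub>R \<pi> h j) $ i * coeff (antideriv (legendre j)) k))" if j: "j < s" for j
  proof (cases "coeff (antideriv (legendre j)) k = 0")
    case False
    then have "k \<noteq> 0" "k \<le> j + 1"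
      using degree_antideriv_le[of "legendre j"] le_degree[of "antideriv (legendre j)" k]
      by (auto simp: coeff_antideriv split: if_splits)
    then have kj: "min k (r + 1) \<le> min j r + 1" by auto
    have "unif_bigo (\<lambda>h. h ^ 1 * (h ^ min j r + h * \<bar>\<alpha> h\<bar>)) (\<lambda>h c. h ^ 1 * \<gamma> h j $ i)"
      by (intro unif_bigo_mult unif_bigo_h unif_bigo_component assms j)
    moreover have "\<forall>\<^sub>F h in at_right 0. h ^ 1 * (h ^ min j r + h * \<bar>\<alpha> h\<bar>) \<le> 1 * sigma_weight (r + 1) (\<lambda>_. 0) k h"
      using eventually_at_right_unit
    proof eventually_elim
      case (elim h)
      have "h ^ (min j r + 1) \<le> h ^ min k (r + 1)" using elim kj by (intro power_decreasing) auto
      moreover have "h * (h * \<bar>\<alpha> h\<bar>) \<le> 1 * (h * \<bar>\<alpha> h\<bar>)" using elim by (intro mult_right_mono) auto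
      ultimately show ?case by (simp add: sigma_weight_def distrib_left)
    qed
    ultimately have 1: "unif_bigo (sigma_weight (r + 1) (\<lambda>_. 0) k) (\<lambda>h c. h ^ 1 * \<gamma> h j $ i)"
      by (rule unif_bigo_mono[OF _ zero_le_one])
    have "unif_bigo (\<lambda>h. h ^ 1 * (\<bar>\<alpha> h\<bar> * 1)) (\<lambda>h c. h ^ 1 * (\<alpha> h * \<pi> h j $ i))"
      by (intro unif_bigo_mult unif_bigo_h unif_bigo_component unif_bigo_alpha_abs unif_bigo_pert)
    moreover have "\<forall>\<^sub>F h in at_right 0. h ^ 1 * (\<bar>\<alpha> h\<bar> * 1) \<le> 1 * sigma_weight (r + 1) (\<lambda>_. 0) k h"
      using eventually_at_right_unit by eventually_elim (simp add: sigma_weight_def)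
    ultimately have 2: "unif_bigo (sigma_weight (r + 1) (\<lambda>_. 0) k) (\<lambda>h c. h ^ 1 * (\<alpha> h * \<pi> h j $ i))"
      by (rule unif_bigo_mono[OF _ zero_le_one])
    show ?thesis
      using unif_bigo_cmult[OF unif_bigo_diff[OF 1 2], of "coeff (antideriv (legendre j)) k"]
      by (rule unif_bigo_cong) (simp add: algebra_simps)
  qed simp
  then have "unif_bigo (sigma_weight (r + 1) (\<lambda>_. 0) k)
      (\<lambda>h c. \<Sum>j<s. h * ((\<gamma> h j - \<alpha> h *\<^sub>R \<pi> h j) $ i * coeff (antideriv (legendre j)) k))"
    by (intro unif_bigo_sum) auto
  then show "unif_bigo (sigma_weight (r + 1) (\<lambda>_. 0) k) (\<lambda>h c. coeff (sigma_poly i h) k)"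
    by (simp add: sigma_poly_def coeff_sum sum_distrib_left)
qed

end

subsection \<open>The numerator\<close>

lemma unif_bigo_if_eventually_le:
  assumes "unif_bigo a u" "\<And>h. 0 < h \<Longrightarrow> h < 1 \<Longrightarrow> a h \<le> b h"
  shows "unif_bigo b u"
  by (rule unif_bigo_mono[OF assms(1), of 1], simp, use eventually_at_right_unit in eventually_elim)
    (use assms(2) in simp)

context gauss_family
begin

text \<open>The quadrature against P_j annihilates the monomials below degree j, so only weights
  with k >= j have to be compared with \<open>a\<close>.\<close>

lemma unif_bigo_gauss_quad_graded:
  assumes p: "graded_poly b p" and j: "j < s"
    and b: "\<And>k. j \<le> k \<Longrightarrow> \<exists>L\<ge>0. \<forall>\<^sub>F h in at_right 0. b k h \<le> L * a h"
  shows "unif_bigo a (\<lambda>h c. gauss_quad s (poly (legendre j * p h)))"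
proof -
  obtain n where n: "\<And>h. degree (p h) \<le> n" using p unfolding graded_poly_def by blast
  have "unif_bigo a (\<lambda>h c. coeff (p h) k * gauss_quad s (poly (legendre j * monom 1 k)))" for k
  proof (cases "k < j")
    case True
    then show ?thesis using gauss_quad_legendre_lower[OF True j] by simp
  next
    case False
    then obtain L where L: "L \<ge> 0" "\<forall>\<^sub>F h in at_right 0. b k h \<le> L * a h" using b[of k] by auto
    have "unif_bigo a (\<lambda>h c. coeff (p h) k)"
      using p unfolding graded_poly_def by (intro unif_bigo_mono[OF _ L]) auto
    from unif_bigo_cmult[OF this, of "gauss_quad s (poly (legendre j * monom 1 k))"]
    show ?thesis by (simp add: mult.commute)
  qed
  then show ?thesis unfolding gauss_quad_expand[OF n] by (intro unif_bigo_sum)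
qed

lemma gamma_minus_quad:
  "order_h (n + 1) (\<lambda>h c. \<gamma> h j $ i
      - gauss_quad s (poly (legendre j * taylor_poly (kf i) n h)))"
proof -
  have "unif_bigo (\<lambda>h. 1 * h ^ (n + 1)) (\<lambda>h c. poly (legendre j) c *
      (f (\<sigma> h c) $ i - poly (taylor_poly (kf i) n h) c))"
    by (intro unif_bigo_mult unif_bigo_poly taylor_poly_remainder kf)
  from unif_bigo_gauss_quad[OF this, of s] show ?thesis
    unfolding mult_1
    by (rule unif_bigo_cong, use gamma_eq_gauss_quad in eventually_elim)
      (simp add: gauss_quad_def right_diff_distrib sum_subtractf mult.assoc)
qed

text \<open>One sweep through \<open>\<gamma> \<mapsto> \<sigma> \<mapsto> f \<circ> \<sigma> \<mapsto> \<gamma>\<close> gains one order.\<close>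

lemma gamma_order_aux:
  assumes "j < s"
  shows "unif_bigo (\<lambda>h. h ^ min j r + h * \<bar>\<alpha> h\<bar>) (\<lambda>h c. \<gamma> h j)"
  using assms
proof (induction r arbitrary: j)
  case 0
  show ?case by (rule unif_bigo_if_eventually_le[OF unif_bigo_gamma]) simp
next
  case (Suc r)
  let ?b = "\<lambda>h. h ^ min j (Suc r) + h * \<bar>\<alpha> h\<bar>"
  have w: "graded_weight (sigma_weight (r + 1) (\<lambda>_. 0))"
    by (rule graded_sigma_weight) auto
  have T: "graded_poly (sigma_weight (r + 1) (\<lambda>_. 0)) (taylor_poly (kf i) r)" for i
    by (intro graded_taylor_poly w graded_sigma_poly Suc.IH)
  show ?case
  proof (rule unif_bigo_vec)
    fix i
    have "unif_bigo ?b (\<lambda>h c. gauss_quad s (poly (legendre j * taylor_poly (kf i) r h)))"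
    proof (rule unif_bigo_gauss_quad_graded[OF T Suc.prems])
      fix k assume jk: "j \<le> k"
      have "\<forall>\<^sub>F h in at_right 0. sigma_weight (r + 1) (\<lambda>_. 0) k h \<le> 1 * ?b h"
        using eventually_at_right_unit by eventually_elim (use jk in \<open>auto simp: sigma_weight_def intro!: power_decreasing\<close>)
      then show "\<exists>L\<ge>0. \<forall>\<^sub>F h in at_right 0. sigma_weight (r + 1) (\<lambda>_. 0) k h \<le> L * ?b h"
        by (intro exI[of _ 1]) simp
    qed
    moreover have "unif_bigo ?b (\<lambda>h c. \<gamma> h j $ i
      - gauss_quad s (poly (legendre j * taylor_poly (kf i) r h)))"
    proof (rule unif_bigo_if_eventually_le[OF gamma_minus_quad])
      fix h :: real assume h: "0 < h" "h < 1"
      then have "h ^ (r + 1) \<le> h ^ min j (Suc r)" by (intro power_decreasing) auto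
      then show "h ^ (r + 1) \<le> ?b h" using h by (simp add: add_increasing2)
    qed
    ultimately show "unif_bigo ?b (\<lambda>h c. \<gamma> h j $ i)"
      using unif_bigo_add by fastforce
  qed
qed

text \<open>The cap 2 is what \<open>graded_sigma_weight\<close> admits, and it suffices: with h
  |\<alpha>| it yields h^3 |\<alpha>|. It is attained in every degree from 2s on, because s >=
  2.\<close>

definition excess :: "nat \<Rightarrow> nat" where
  "excess k = min 2 (k - s)"

text \<open>Up to degree \<open>s\<close> the coefficients of \<open>\<sigma>\<close> carry perturbations of order \<open>h \<alpha>\<close>; in products
  such a perturbation can occur in degree \<open>s + d\<close> only together with a factor \<open>h\<^sup>d\<close>.\<close>

lemma graded_sigma_poly_excess: "graded_poly (sigma_weight (2 * s) excess) (sigma_poly i)"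
proof -
  have g: "graded_poly (sigma_weight (s + 1) (\<lambda>_. 0)) (sigma_poly i)"
    by (rule graded_sigma_poly) (rule gamma_order_aux)
  have "unif_bigo (sigma_weight (2 * s) excess k) (\<lambda>h c. coeff (sigma_poly i h) k)" for k
  proof (cases "k \<le> s")
    case True
    then have "sigma_weight (2 * s) excess k = sigma_weight (s + 1) (\<lambda>_. 0) k"
      by (simp add: sigma_weight_def excess_def fun_eq_iff)
    then show ?thesis using g by (simp add: graded_poly_def)
  next
    case False
    then have "coeff (sigma_poly i h) k = 0" for h
      using degree_sigma_poly[of i h] by (intro coeff_eq_0) simp
    then show ?thesis by simp
  qed
  then show ?thesis using g unfolding graded_poly_def by blast
qed

lemma graded_weight_excess: "graded_weight (sigma_weight (2 * s) excess)"
  using s2 by (intro graded_sigma_weight) (auto simp: excess_def)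

text \<open>The defect of \<open>gauss_parseval\<close>. The first argument takes exact coefficients
  and the second quadrature ones, as in the numerator, where \<rho> is an integral and \<gamma> a
  quadrature sum.\<close>

definition quad_defect :: "real poly \<Rightarrow> real poly \<Rightarrow> real" where
  "quad_defect p q = (\<Sum>j<s. unit_int (legendre j * p) * gauss_quad s (poly (legendre j * q))) - unit_int (p * q)"

text \<open>By bilinearity the defect is a sum over pairs of monomials. Those with k + l < 2s vanish
  by \<open>gauss_parseval\<close>, and for the others the product of the weights is bounded by the
  weight of degree k + l.\<close>

lemma quad_defect_graded:
  assumes p: "graded_poly (sigma_weight (2 * s) excess) p" and q: "graded_poly (sigma_weight (2 * s) excess) q"
  shows "unif_bigo (\<lambda>h. h ^ (2 * s) + h ^ 3 * \<bar>\<alpha> h\<bar>) (\<lambda>h c. quad_defect (p h) (q h))"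
proof -
  let ?b = "sigma_weight (2 * s) excess"
  obtain n m where n: "\<And>h. degree (p h) \<le> n" and m: "\<And>h. degree (q h) \<le> m"
    using p q unfolding graded_poly_def by blast
  have e: "quad_defect (p h) (q h) =
    (\<Sum>k\<le>n. \<Sum>l\<le>m. coeff (p h) k * coeff (q h) l * quad_defect (monom 1 k) (monom 1 l))" for h
  proof -
    have "unit_int (p h * q h) = (\<Sum>l\<le>m. coeff (q h) l * unit_int (monom 1 l * p h))"
      unfolding unit_int_expand[OF m] by (simp add: mult.commute)
    also have "\<dots> = (\<Sum>l\<le>m. \<Sum>k\<le>n. coeff (p h) k * coeff (q h) l * unit_int (monom 1 k * monom 1 l))"
      unfolding unit_int_expand[OF n] by (simp add: sum_distrib_left mult_ac)
    also have "\<dots> = (\<Sum>k\<le>n. \<Sum>l\<le>m. coeff (p h) k * coeff (q h) l * unit_int (monom 1 k * monom 1 l))"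
      by (rule sum.swap)
    finally have 1: "unit_int (p h * q h) = \<dots>" .
    have "(\<Sum>j<s. unit_int (legendre j * p h) * gauss_quad s (poly (legendre j * q h)))
      = (\<Sum>j<s. \<Sum>k\<le>n. \<Sum>l\<le>m. coeff (p h) k * coeff (q h) l *
          (unit_int (legendre j * monom 1 k) * gauss_quad s (poly (legendre j * monom 1 l))))"
      unfolding unit_int_expand[OF n, of "legendre _"] gauss_quad_expand[OF m]
      by (simp add: sum_product mult_ac)
    also have "\<dots> = (\<Sum>k\<le>n. \<Sum>l\<le>m. \<Sum>j<s. coeff (p h) k * coeff (q h) l *
          (unit_int (legendre j * monom 1 k) * gauss_quad s (poly (legendre j * monom 1 l))))"
      by (subst sum.swap) (intro sum.cong refl sum.swap)
    finally show ?thesis unfolding quad_defect_def 1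
      by (simp add: sum_distrib_left[symmetric] right_diff_distrib sum_subtractf)
  qed
  have "unif_bigo (\<lambda>h. h ^ (2 * s) + h ^ 3 * \<bar>\<alpha> h\<bar>)
    (\<lambda>h c. coeff (p h) k * coeff (q h) l * quad_defect (monom 1 k) (monom 1 l))" for k l
  proof (cases "k + l < 2 * s")
    case True
    then have "quad_defect (monom 1 k) (monom 1 l) = 0"
      using gauss_parseval[of "monom 1 k" "monom 1 l" s]
      by (simp add: quad_defect_def degree_monom_eq)
    then show ?thesis by simp
  next
    case False
    obtain L where L: "L \<ge> 0" "\<forall>\<^sub>F h in at_right 0. ?b k h * ?b l h \<le> L * ?b (k + l) h"
      using graded_weight_excess unfolding graded_weight_def by blast
    have "min (k + l) (2 * s) = 2 * s" "excess (k + l) = 2"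
      using False s2 by (auto simp: excess_def)
    then have "?b (k + l) h = h ^ (2 * s) + h ^ 3 * \<bar>\<alpha> h\<bar>" for h
      by (simp add: sigma_weight_def power2_eq_square power3_eq_cube mult_ac)
    with L have L': "\<forall>\<^sub>F h in at_right 0. ?b k h * ?b l h \<le> L * (h ^ (2 * s) + h ^ 3 * \<bar>\<alpha> h\<bar>)" by simp
    have "unif_bigo (\<lambda>h. ?b k h * ?b l h) (\<lambda>h c. coeff (p h) k * coeff (q h) l)"
      using p q unfolding graded_poly_def by (intro unif_bigo_mult) auto
    from unif_bigo_cmult[OF unif_bigo_mono[OF this L(1) L'], of "quad_defect (monom 1 k) (monom 1 l)"]
    show ?thesis by (simp add: mult.commute)
  qed
  then show ?thesis unfolding e by (intro unif_bigo_sum)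
qed

lemma eventually_continuous_along:
  assumes F: "\<And>i. power_series_at (k i) (\<lambda>x. F x $ i) (y0 :: real ^ 'm)"
    and u: "order_h 1 (\<lambda>h c. u h c - y0)" "\<And>h. continuous_on {0..1} (u h)"
  shows "\<forall>\<^sub>F h in at_right 0. continuous_on {0..1} (\<lambda>c. F (u h c) :: real ^ 'n)"
proof -
  have "\<forall>\<^sub>F x in nhds y0. isCont F x" by (rule analytic_eventually_isCont[OF F])
  from tendsto_of_unif_bigo[OF u(1) this] show ?thesis
  proof eventually_elim
    case (elim h)
    have "continuous_on (u h ` {0..1}) F"
      using elim by (auto intro!: continuous_at_imp_continuous_on)
    from continuous_on_compose[OF u(2) this] show ?case by (simp add: o_def)
  qed
qed

lemma continuous_on_sigma: "continuous_on {0..1} (\<sigma> h)"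
proof -
  have "continuous_on {0..1} (\<lambda>c. y0 + h *\<^sub>R (\<Sum>j<s. poly (antideriv (legendre j)) c *\<^sub>R (\<gamma> h j - \<alpha> h *\<^sub>R \<pi> h j)))"
    by (intro continuous_intros)
  then show ?thesis by (rule continuous_on_eq) (simp add: sigma_eq)
qed

lemmas eventually_continuous_g_sigma =
  eventually_continuous_along[OF kg unif_bigo_sigma continuous_on_sigma]

lemma unif_bigo_along_sigma:
  fixes F :: "real ^ 'm \<Rightarrow> real ^ 'm"
  assumes "\<And>i. power_series_at (k i) (\<lambda>x. F x $ i) y0"
  shows "unif_bigo (\<lambda>_. 1) (\<lambda>h c. F (\<sigma> h c))"
proof -
  have "isCont F y0" using eventually_nhds_x_imp_x[OF analytic_eventually_isCont[OF assms]] .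
  then have "\<forall>\<^sub>F x in nhds y0. norm (F x) < norm (F y0) + 1"
    using order_tendstoD(2)[OF tendsto_norm[of F "F y0" "nhds y0"], of "norm (F y0) + 1"]
    by (simp add: continuous_at tendsto_at_iff_tendsto_nhds)
  from eventually_sigma[OF this] show ?thesis
    by (intro unif_bigoI[of "norm (F y0) + 1"]) (auto elim!: eventually_mono)
qed

lemma unif_bigo_mult_diff:
  fixes u v u' v' :: "real \<Rightarrow> real \<Rightarrow> real"
  assumes "order_h n (\<lambda>h c. u h c - u' h c)" "order_h n (\<lambda>h c. v h c - v' h c)"
    and "unif_bigo (\<lambda>_. 1) u" "unif_bigo (\<lambda>_. 1) v"
  shows "order_h n (\<lambda>h c. u h c * v h c - u' h c * v' h c)"
proof -
  have "unif_bigo (\<lambda>_. 1) (\<lambda>h c. u h c - u' h c)"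
    using unif_bigo_power_mono[OF assms(1), of 0] by simp
  from unif_bigo_diff[OF assms(3) this] have "unif_bigo (\<lambda>_. 1) u'" by simp
  then have "order_h n (\<lambda>h c. (u h c - u' h c) * v h c + u' h c * (v h c - v' h c))"
    using unif_bigo_mult[OF assms(1,4)] unif_bigo_mult[OF _ assms(2), of "\<lambda>_. 1" u']
    by (intro unif_bigo_add) simp_all
  then show ?thesis by (simp add: algebra_simps)
qed

lemma path_coeff_minus_unit_int:
  "order_h (n + 1) (\<lambda>h c. \<rho> h j $ i
      - unit_int (legendre j * taylor_poly (kg i) n h))"
proof -
  have "unif_bigo (\<lambda>h. 1 * h ^ (n + 1)) (\<lambda>h c. poly (legendre j) c *
      (g (\<sigma> h c) $ i - poly (taylor_poly (kg i) n h) c))"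
    by (intro unif_bigo_mult unif_bigo_poly taylor_poly_remainder kg)
  from unif_bigo_integral[OF this] show ?thesis
    unfolding mult_1
  proof (rule unif_bigo_cong, use eventually_continuous_g_sigma in eventually_elim)
    case (elim h)
    have "(\<lambda>c. poly (legendre j) c *\<^sub>R g (\<sigma> h c)) integrable_on {0..1}"
      using elim by (intro integrable_continuous_real continuous_intros)
    from has_integral_linear[OF integrable_integral[OF this] bounded_linear_vec_nth[of i]]
    have "((\<lambda>c. (poly (legendre j) c *\<^sub>R g (\<sigma> h c)) $ i) has_integral \<rho> h j $ i) {0..1}"
      unfolding path_coeff_def by (simp add: o_def)
    from has_integral_diff[OF this has_integral_unit_int[of "legendre j * taylor_poly (kg i) n h"]]
    show ?case by (auto simp: right_diff_distrib dest!: integral_unique)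
  qed
qed

text \<open>Replacing \<open>f\<close> and \<open>g\<close> along the path by Taylor polynomials
  costs O(h^(2s)) in every term. What remains is the quadrature defect plus the integral of the
  product of Taylor polynomials, and the latter is small because g and f are orthogonal along the
  path.\<close>

lemma N_bound: "unif_bigo (\<lambda>h. h ^ (2 * s) + h ^ 3 * \<bar>\<alpha> h\<bar>)
    (\<lambda>h c. \<Sum>j<s. inner (\<rho> h j) (\<gamma> h j))"
proof -
  \<comment> \<open>Truncation order for which all Taylor remainders are of order h^(2s).\<close>
  define n where "n = 2 * s - 1"
  have n: "n + 1 = 2 * s" using s2 by (simp add: n_def)
  let ?b = "\<lambda>h. h ^ (2 * s) + h ^ 3 * \<bar>\<alpha> h\<bar>"
  let ?F = "\<lambda>i. taylor_poly (kf i) n" and ?G = "\<lambda>i. taylor_poly (kg i) n"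
  let ?q = "\<lambda>h i j. gauss_quad s (poly (legendre j * ?F i h))"
  let ?I = "\<lambda>h i j. unit_int (legendre j * ?G i h)"
  have b: "unif_bigo ?b u" if "order_h (2 * s) u" for u :: "real \<Rightarrow> real \<Rightarrow> real"
    by (rule unif_bigo_if_eventually_le[OF that]) simp
  have R: "unif_bigo (\<lambda>_. 1) (\<lambda>h c. \<rho> h j)" for j
    unfolding path_coeff_def
    using unif_bigo_scaleR[OF unif_bigo_poly[of "legendre j"] unif_bigo_along_sigma[OF kg]]
    by (intro unif_bigo_integral) simp
  have 1: "order_h (2 * s) (\<lambda>h c. \<Sum>j<s. \<Sum>i\<in>UNIV. \<rho> h j $ i * \<gamma> h j $ i - ?I h i j * ?q h i j)"
    using path_coeff_minus_unit_int[where n = n] gamma_minus_quad[where n = n] unfolding n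
    by (intro unif_bigo_sum unif_bigo_mult_diff unif_bigo_component R unif_bigo_gamma)
  have "order_h (2 * s) (\<lambda>h c. g (\<sigma> h c) $ i * f (\<sigma> h c) $ i - poly (?G i h) c * poly (?F i h) c)" for i
    using taylor_poly_remainder[OF kf[of i], of n] taylor_poly_remainder[OF kg[of i], of n] unfolding n
    by (intro unif_bigo_mult_diff unif_bigo_component unif_bigo_along_sigma[OF kf] unif_bigo_along_sigma[OF kg])
  then have "order_h (2 * s) (\<lambda>h c. - (\<Sum>i\<in>UNIV. g (\<sigma> h c) $ i * f (\<sigma> h c) $ i - poly (?G i h) c * poly (?F i h) c))"
    by (intro unif_bigo_minus unif_bigo_sum)
  \<comment> \<open>Summed over the components, the exact products give the inner product of g and
    f, which is 0; only the negated difference remains.\<close>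
  then have "order_h (2 * s) (\<lambda>h c. poly (\<Sum>i\<in>UNIV. ?G i h * ?F i h) c)"
    by (rule unif_bigo_cong, use eventually_sigma[OF orth] in eventually_elim)
      (simp add: poly_sum sum_subtractf inner_vec_def)
  from unif_bigo_integral[OF this]
  have 2: "order_h (2 * s) (\<lambda>h c. \<Sum>i\<in>UNIV. unit_int (?G i h * ?F i h))"
    by (simp only: integral_unique[OF has_integral_unit_int] unit_int_sum)
  have 3: "unif_bigo ?b (\<lambda>h c. \<Sum>i\<in>UNIV. quad_defect (?G i h) (?F i h))"
    by (intro unif_bigo_sum quad_defect_graded graded_taylor_poly graded_weight_excess graded_sigma_poly_excess)
  have "(\<Sum>j<s. inner (\<rho> h j) (\<gamma> h j)) =
      (\<Sum>j<s. \<Sum>i\<in>UNIV. \<rho> h j $ i * \<gamma> h j $ i - ?I h i j * ?q h i j)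
      + (\<Sum>i\<in>UNIV. quad_defect (?G i h) (?F i h)) + (\<Sum>i\<in>UNIV. unit_int (?G i h * ?F i h))" for h
  proof -
    have "(\<Sum>j<s. \<Sum>i\<in>UNIV. ?I h i j * ?q h i j) = (\<Sum>i\<in>UNIV. quad_defect (?G i h) (?F i h) + unit_int (?G i h * ?F i h))"
      by (subst sum.swap) (simp add: quad_defect_def)
    then show ?thesis by (simp add: inner_vec_def sum_subtractf sum.distrib)
  qed
  then show ?thesis
    using unif_bigo_add[OF unif_bigo_add[OF b[OF 1] 3] b[OF 2]] by simp
qed

end

subsection \<open>Second order expansions along a path\<close>

lemma taylor_along:
  fixes F :: "real ^ 'm \<Rightarrow> real ^ 'm"
  assumes F: "\<And>i. power_series_at (k i) (\<lambda>x. F x $ i) a"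
    and u: "order_h 1 (\<lambda>h c. u h c - a)"
  shows "bounded_linear (frechet_derivative F (at a))" and "bounded_bilinear (second_deriv F a)"
    and "order_h 3 (\<lambda>h c. F (u h c) - F a - frechet_derivative F (at a) (u h c - a)
           - (1/2) *\<^sub>R second_deriv F a (u h c - a) (u h c - a))"
proof -
  obtain D2 K where d: "(F has_derivative frechet_derivative F (at a)) (at a)"
    and D2: "\<And>v. ((\<lambda>x. frechet_derivative F (at x) v) has_derivative (\<lambda>u. D2 u v)) (at a)" "bounded_bilinear D2"
    and K: "K \<ge> 0"
    and b: "\<forall>\<^sub>F x in nhds a. norm (F x - F a - frechet_derivative F (at a) (x - a) - (1/2) *\<^sub>R D2 (x - a) (x - a))
       \<le> K * norm (x - a) ^ 3"
    by (rule analytic_second_order[OF F]) blast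
  have D2eq: "D2 = second_deriv F a"
    by (simp add: fun_eq_iff second_deriv_def frechet_derivative_at[OF D2(1), symmetric])
  show "bounded_linear (frechet_derivative F (at a))" using d by (rule has_derivative_bounded_linear)
  show "bounded_bilinear (second_deriv F a)" using D2(2) by (simp add: D2eq)
  obtain L where L: "L \<ge> 0" "\<forall>\<^sub>F h in at_right 0. \<forall>c\<in>{0..1}. norm (u h c - a) \<le> L * h ^ 1"
    using u by (rule unif_bigoE)
  have "\<forall>\<^sub>F h in at_right 0. \<forall>c\<in>{0..1}. norm (F (u h c) - F a - frechet_derivative F (at a) (u h c - a)
           - (1/2) *\<^sub>R second_deriv F a (u h c - a) (u h c - a)) \<le> (K * L ^ 3) * h ^ 3"
    using tendsto_of_unif_bigo[OF u b] L(2)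
  proof eventually_elim
    case (elim h)
    show ?case
    proof
      fix c :: real assume c: "c \<in> {0..1}"
      have "K * norm (u h c - a) ^ 3 \<le> K * (L * h) ^ 3"
        using elim(2) c K by (intro mult_left_mono power_mono) auto
      then show "norm (F (u h c) - F a - frechet_derivative F (at a) (u h c - a)
           - (1/2) *\<^sub>R second_deriv F a (u h c - a) (u h c - a)) \<le> (K * L ^ 3) * h ^ 3"
        using bspec[OF elim(1) c] by (simp add: D2eq power_mult_distrib mult.assoc)
    qed
  qed
  then show "order_h 3 (\<lambda>h c. F (u h c) - F a - frechet_derivative F (at a) (u h c - a)
           - (1/2) *\<^sub>R second_deriv F a (u h c - a) (u h c - a))"
    using K L(1) by (intro unif_bigoI[of "K * L ^ 3"]) auto
qed

lemma unif_bigo_bilinear_powers: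
  assumes "bounded_bilinear B" "order_h a u" "order_h b v" "n \<le> a + b"
  shows "order_h n (\<lambda>h c. B (u h c) (v h c))"
proof -
  have "order_h (a + b) (\<lambda>h c. B (u h c) (v h c))"
    using unif_bigo_bilinear[OF assms(1-3)] by (simp add: power_add)
  then show ?thesis using assms(4) by (rule unif_bigo_power_mono)
qed

lemmas unif_bigo_scaleR_powers = unif_bigo_bilinear_powers[OF bounded_bilinear_scaleR]
  and unif_bigo_mult_powers = unif_bigo_bilinear_powers[OF bounded_bilinear_mult]
  and unif_bigo_inner_powers = unif_bigo_bilinear_powers[OF bounded_bilinear_inner]

lemma unif_bigo_power_const: "order_h n (\<lambda>h c. (r * h ^ n) *\<^sub>R x)"
  using unif_bigo_scaleR_powers[OF unif_bigo_cmult[OF unif_bigo_h[of n], of r], of 0 "\<lambda>h c. x" n] by simp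

lemma unif_bigo_power_fun:
  assumes "continuous_on {0..1} (\<theta> :: real \<Rightarrow> real)"
  shows "order_h n (\<lambda>h c. (h ^ n * \<theta> c) *\<^sub>R x)"
proof -
  have "order_h n (\<lambda>h c. h ^ n * \<theta> c)"
    using unif_bigo_mult_powers[OF unif_bigo_h[of n], of 0 "\<lambda>h c. \<theta> c" n] unif_bigo_continuous[OF assms] by simp
  then show ?thesis using unif_bigo_scaleR_powers[of n _ 0 "\<lambda>h c. x" n] by simp
qed

lemma zeroth_order_along:
  fixes F :: "real ^ 'm \<Rightarrow> real ^ 'm"
  assumes F: "\<And>i. power_series_at (k i) (\<lambda>x. F x $ i) a"
    and u: "order_h 1 (\<lambda>h c. u h c - a)"
  shows "order_h 1 (\<lambda>h c. F (u h c) - F a)"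
proof -
  note T = taylor_along[OF F u]
  have "order_h 1 (\<lambda>h c. frechet_derivative F (at a) (u h c - a))"
    by (rule unif_bigo_linear[OF T(1) u])
  moreover have "order_h 1 (\<lambda>h c. (1/2) *\<^sub>R second_deriv F a (u h c - a) (u h c - a))"
    by (rule unif_bigo_scale, rule unif_bigo_bilinear_powers[OF T(2) u u]) simp
  moreover have "order_h 1 (\<lambda>h c. F (u h c) - F a - frechet_derivative F (at a) (u h c - a)
           - (1/2) *\<^sub>R second_deriv F a (u h c - a) (u h c - a))"
    by (rule unif_bigo_power_mono[OF T(3)]) simp
  ultimately have "order_h 1 (\<lambda>h c. (F (u h c) - F a - frechet_derivative F (at a) (u h c - a)
           - (1/2) *\<^sub>R second_deriv F a (u h c - a) (u h c - a)) + frechet_derivative F (at a) (u h c - a)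
           + (1/2) *\<^sub>R second_deriv F a (u h c - a) (u h c - a))"
    by (intro unif_bigo_add)
  then show ?thesis by simp
qed

lemma first_order_along:
  fixes F :: "real ^ 'm \<Rightarrow> real ^ 'm"
  assumes F: "\<And>i. power_series_at (k i) (\<lambda>x. F x $ i) a"
    and \<theta>: "continuous_on {0..1} \<theta>"
    and u: "order_h 2 (\<lambda>h c. u h c - a - (h * \<theta> c) *\<^sub>R v)"
  shows "order_h 2 (\<lambda>h c. F (u h c) - F a - (h * \<theta> c) *\<^sub>R frechet_derivative F (at a) v)"
proof -
  have u1: "order_h 1 (\<lambda>h c. u h c - a)"
    using unif_bigo_add[OF unif_bigo_power_mono[OF u, of 1] unif_bigo_power_fun[OF \<theta>, of 1 v]] by simp
  note T = taylor_along[OF F u1]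
  let ?F' = "frechet_derivative F (at a)"
  have lin: "?F' (x - y) = ?F' x - ?F' y" "?F' (x + y) = ?F' x + ?F' y" "?F' (c *\<^sub>R x) = c *\<^sub>R ?F' x" for x y c
    using T(1) by (auto simp: linear_diff linear_add linear_scale bounded_linear.linear)
  have "order_h 2 (\<lambda>h c. ?F' (u h c - a - (h * \<theta> c) *\<^sub>R v))"
    by (rule unif_bigo_linear[OF T(1) u])
  moreover have "order_h 2 (\<lambda>h c. (1/2) *\<^sub>R second_deriv F a (u h c - a) (u h c - a))"
    by (rule unif_bigo_scale, rule unif_bigo_bilinear_powers[OF T(2) u1 u1]) simp
  moreover have "order_h 2 (\<lambda>h c. F (u h c) - F a - ?F' (u h c - a)
           - (1/2) *\<^sub>R second_deriv F a (u h c - a) (u h c - a))"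
    by (rule unif_bigo_power_mono[OF T(3)]) simp
  ultimately have "order_h 2 (\<lambda>h c. (F (u h c) - F a - ?F' (u h c - a)
           - (1/2) *\<^sub>R second_deriv F a (u h c - a) (u h c - a)) + ?F' (u h c - a - (h * \<theta> c) *\<^sub>R v)
           + (1/2) *\<^sub>R second_deriv F a (u h c - a) (u h c - a))"
    by (intro unif_bigo_add)
  then show ?thesis by (simp add: lin algebra_simps)
qed

text \<open>The path shape a + h \<theta> v + h^2 \<theta>^2 w covers both paths: \<theta> is the
  identity for \<open>sigma1\<close> and the constant 1 for \<open>sigma2\<close>.\<close>

lemma second_order_along:
  fixes F :: "real ^ 'm \<Rightarrow> real ^ 'm"
  assumes F: "\<And>i. power_series_at (k i) (\<lambda>x. F x $ i) a"
    and \<theta>: "continuous_on {0..1} \<theta>"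
    and u: "order_h 3 (\<lambda>h c. u h c - a - (h * \<theta> c) *\<^sub>R v - (h\<^sup>2 * (\<theta> c)\<^sup>2) *\<^sub>R w)"
  shows "order_h 3 (\<lambda>h c. F (u h c) - F a - (h * \<theta> c) *\<^sub>R frechet_derivative F (at a) v
      - (h\<^sup>2 * (\<theta> c)\<^sup>2) *\<^sub>R (frechet_derivative F (at a) w + (1/2) *\<^sub>R second_deriv F a v v))"
proof -
  have \<theta>2: "continuous_on {0..1} (\<lambda>c. (\<theta> c)\<^sup>2)" using \<theta> by (intro continuous_intros)
  have u2: "order_h 2 (\<lambda>h c. u h c - a - (h * \<theta> c) *\<^sub>R v)"
    using unif_bigo_add[OF unif_bigo_power_mono[OF u, of 2] unif_bigo_power_fun[OF \<theta>2, of 2 w]] by simp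
  have v1: "order_h 1 (\<lambda>h c. (h * \<theta> c) *\<^sub>R v)"
    using unif_bigo_power_fun[OF \<theta>, of 1 v] by simp
  have u1: "order_h 1 (\<lambda>h c. u h c - a)"
    using unif_bigo_add[OF unif_bigo_power_mono[OF u2, of 1] v1] by simp
  note T = taylor_along[OF F u1]
  let ?F' = "frechet_derivative F (at a)" and ?B = "second_deriv F a"
  have lin: "?F' (x - y) = ?F' x - ?F' y" "?F' (x + y) = ?F' x + ?F' y" "?F' (c *\<^sub>R x) = c *\<^sub>R ?F' x" for x y c
    using T(1) by (auto simp: linear_diff linear_add linear_scale bounded_linear.linear)
  have "order_h 3 (\<lambda>h c. ?F' (u h c - a - (h * \<theta> c) *\<^sub>R v - (h\<^sup>2 * (\<theta> c)\<^sup>2) *\<^sub>R w))"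
    by (rule unif_bigo_linear[OF T(1) u])
  \<comment> \<open>The difference B(d,d) - B(tv,tv), with d = u - a and t = h \<theta> c, written
    as B(d - tv, d) + B(tv, d - tv) to show that it has order 3.\<close>
  moreover have "order_h 3 (\<lambda>h c. (1/2) *\<^sub>R (?B (u h c - a - (h * \<theta> c) *\<^sub>R v) (u h c - a)
      + ?B ((h * \<theta> c) *\<^sub>R v) (u h c - a - (h * \<theta> c) *\<^sub>R v)))"
    by (intro unif_bigo_scale unif_bigo_add unif_bigo_bilinear_powers[OF T(2) u2 u1]
        unif_bigo_bilinear_powers[OF T(2) v1 u2]) simp_all
  ultimately have "order_h 3 (\<lambda>h c. (F (u h c) - F a - ?F' (u h c - a) - (1/2) *\<^sub>R ?B (u h c - a) (u h c - a))
      + ?F' (u h c - a - (h * \<theta> c) *\<^sub>R v - (h\<^sup>2 * (\<theta> c)\<^sup>2) *\<^sub>R w)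
      + (1/2) *\<^sub>R (?B (u h c - a - (h * \<theta> c) *\<^sub>R v) (u h c - a)
      + ?B ((h * \<theta> c) *\<^sub>R v) (u h c - a - (h * \<theta> c) *\<^sub>R v)))"
    by (intro unif_bigo_add T(3))
  moreover have "(F (u h c) - F a - ?F' (u h c - a) - (1/2) *\<^sub>R ?B (u h c - a) (u h c - a))
      + ?F' (u h c - a - (h * \<theta> c) *\<^sub>R v - (h\<^sup>2 * (\<theta> c)\<^sup>2) *\<^sub>R w)
      + (1/2) *\<^sub>R (?B (u h c - a - (h * \<theta> c) *\<^sub>R v) (u h c - a)
      + ?B ((h * \<theta> c) *\<^sub>R v) (u h c - a - (h * \<theta> c) *\<^sub>R v))
      = F (u h c) - F a - (h * \<theta> c) *\<^sub>R ?F' v - (h\<^sup>2 * (\<theta> c)\<^sup>2) *\<^sub>R (?F' w + (1/2) *\<^sub>R ?B v v)" for h c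
  proof -
    define d where "d = u h c - a"
    define t where "t = h * \<theta> c"
    have "?B (d - t *\<^sub>R v) d + ?B (t *\<^sub>R v) (d - t *\<^sub>R v) = ?B d d - (t * t) *\<^sub>R ?B v v"
      by (simp add: bounded_bilinear.diff_left[OF T(2)] bounded_bilinear.diff_right[OF T(2)]
          bounded_bilinear.scaleR_left[OF T(2)] bounded_bilinear.scaleR_right[OF T(2)])
    note e = this
    show ?thesis unfolding d_def[symmetric] t_def[symmetric] power_mult_distrib[symmetric] e
      by (simp add: lin power2_eq_square scaleR_add_right scaleR_diff_right)
  qed
  ultimately show ?thesis by simp
qed

section \<open>Expansions of the Fourier coefficients and of both paths\<close>

context gauss_family
begin

text \<open>With y the exact solution, \<open>f0\<close> and \<open>F1\<close> are y' and y'' at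
  time 0, while \<open>G1\<close> and \<open>G2\<close> are the first and second time derivatives of
  g(y(t)) there.\<close>

definition "f0 = f y0"
definition "F1 = frechet_derivative f (at y0) f0"
definition "G1 = frechet_derivative g (at y0) f0"
definition "G2 = frechet_derivative g (at y0) F1 + second_deriv g y0 f0 f0"

lemma gamma_approx:
  assumes "unif_bigo b (\<lambda>h c. f (\<sigma> h c) - A h c)"
  shows "unif_bigo b (\<lambda>h c. \<gamma> h j - (\<Sum>i<s. (gauss_weight s i * poly (legendre j) (gauss_node s i)) *\<^sub>R A h (gauss_node s i)))"
proof -
  have "unif_bigo b (\<lambda>h c. \<Sum>i<s. (gauss_weight s i * poly (legendre j) (gauss_node s i)) *\<^sub>R
      (f (\<sigma> h (gauss_node s i)) - A h (gauss_node s i)))"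
  proof (intro unif_bigo_sum unif_bigo_scale)
    fix i assume "i \<in> {..<s}"
    then show "unif_bigo b (\<lambda>h c. f (\<sigma> h (gauss_node s i)) - A h (gauss_node s i))"
      using unif_bigo_eval[OF assms gauss_node_in_unit_interval[of i s]] by simp
  qed
  then show ?thesis
    by (rule unif_bigo_cong, use stage_eq_sigma in eventually_elim)
      (simp add: gam_def scaleR_diff_right sum_subtractf)
qed

text \<open>For j <= 1 the integrands have degree at most 2, within the exactness of the quadrature
  since s >= 2.\<close>

lemma gauss_sum_affine:
  fixes x y :: "real ^ 'm"
  assumes "j \<le> 1"
  shows "(\<Sum>i<s. (gauss_weight s i * poly (legendre j) (gauss_node s i)) *\<^sub>R (x + (t * gauss_node s i) *\<^sub>R y))
    = unit_int (legendre j) *\<^sub>R x + (t * unit_int (legendre j * monom 1 1)) *\<^sub>R y"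
proof -
  have "gauss_quad s (poly (legendre j)) = unit_int (legendre j)"
    using assms s2 by (intro gauss_quad_exact) simp
  moreover have "gauss_quad s (poly (legendre j * monom 1 1)) = unit_int (legendre j * monom 1 1)"
    using assms s2 degree_mult_le[of "legendre j" "monom 1 1"]
    by (intro gauss_quad_exact) (simp add: degree_monom_eq)
  moreover have "(\<Sum>i<s. (gauss_weight s i * poly (legendre j) (gauss_node s i)) *\<^sub>R (x + (t * gauss_node s i) *\<^sub>R y))
     = gauss_quad s (poly (legendre j)) *\<^sub>R x + (t * gauss_quad s (poly (legendre j * monom 1 1))) *\<^sub>R y"
  proof -
    have "(gauss_weight s i * poly (legendre j) (gauss_node s i)) *\<^sub>R (x + (t * gauss_node s i) *\<^sub>R y) =
      (gauss_weight s i * poly (legendre j) (gauss_node s i)) *\<^sub>R x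
      + (t * (gauss_weight s i * poly (legendre j * monom 1 1) (gauss_node s i))) *\<^sub>R y" for i
      by (simp add: scaleR_add_right poly_monom mult_ac)
    then show ?thesis
      by (simp only: gauss_quad_def sum.distrib scaleR_sum_left[symmetric] sum_distrib_left[symmetric])
  qed
  ultimately show ?thesis by simp
qed

lemma gamma_0_order_1: "order_h 1 (\<lambda>h c. \<gamma> h 0 - f0)"
proof -
  have "order_h 1 (\<lambda>h c. f (\<sigma> h c) - f0)"
    unfolding f0_def by (rule zeroth_order_along[OF kf unif_bigo_sigma])
  from gamma_approx[OF this, of 0] show ?thesis
    using gauss_sum_affine[of 0 f0 0 0] by simp
qed

lemma gamma_order:
  assumes "j < s" "m \<le> j" "m \<le> 2"
  shows "order_h m (\<lambda>h c. \<gamma> h j)"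
proof (rule unif_bigo_mono[OF gamma_order_aux[OF assms(1), of s]])
  show "0 \<le> 1 + \<kappa>" using \<kappa>0 by simp
  show "\<forall>\<^sub>F h in at_right 0. h ^ min j s + h * \<bar>\<alpha> h\<bar> \<le> (1 + \<kappa>) * h ^ m"
    using eventually_at_right_unit \<alpha>_le
  proof eventually_elim
    case (elim h)
    have "h ^ min j s \<le> h ^ m" using elim assms by (intro power_decreasing) auto
    moreover have "h * \<bar>\<alpha> h\<bar> \<le> 1 * (\<kappa> * h\<^sup>2)" using elim by (intro mult_mono) auto
    moreover have "\<kappa> * h\<^sup>2 \<le> \<kappa> * h ^ m" using elim assms \<kappa>0 by (intro mult_left_mono power_decreasing) auto
    ultimately show ?case by (simp add: distrib_right)
  qed
qed

lemma sigma_alpha_part: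
  "order_h 3 (\<lambda>h c. (h * poly p c * \<alpha> h) *\<^sub>R \<pi> h j)"
proof -
  have "order_h 3 (\<lambda>h c. (h ^ 1 * poly p c) * \<alpha> h)"
    by (rule unif_bigo_mult_powers[OF unif_bigo_mult_powers[OF unif_bigo_h[of 1], of 0 _ 1] unif_bigo_alpha])
      (use unif_bigo_poly in auto)
  from unif_bigo_scaleR_powers[OF this, of 0 "\<lambda>h c. \<pi> h j" 3] show ?thesis
    using unif_bigo_pert by simp
qed

lemma sigma_minus_gamma_terms:
  assumes c: "0 \<le> c"
  shows "\<sigma> h c - y0 - (h * c) *\<^sub>R \<gamma> h 0 =
     (\<Sum>j=1..<s. (h * poly (antideriv (legendre j)) c) *\<^sub>R \<gamma> h j)
     - (\<Sum>j<s. (h * poly (antideriv (legendre j)) c * \<alpha> h) *\<^sub>R \<pi> h j)"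
proof -
  have "\<sigma> h c - y0 = (\<Sum>j<s. (h * poly (antideriv (legendre j)) c) *\<^sub>R \<gamma> h j)
     - (\<Sum>j<s. (h * poly (antideriv (legendre j)) c * \<alpha> h) *\<^sub>R \<pi> h j)"
    unfolding sigma_eq[OF c] by (simp add: scaleR_sum_right scaleR_diff_right sum_subtractf mult_ac)
  also have "{..<s} = insert 0 {1..<s}" using s2 by auto
  finally show ?thesis
    using antideriv_legendre_01(1) s2 by (simp add: poly_monom lessThan_atLeast0 sum.atLeast_Suc_lessThan)
qed

text \<open>First round of a bootstrap: the path modulo h^2 yields the coefficients of index 0 and 1
  modulo h^2, and these yield the path modulo h^3 in \<open>sigma_order_3\<close>.\<close>

lemma sigma_order_2: "order_h 2 (\<lambda>h c. \<sigma> h c - y0 - (h * c) *\<^sub>R f0)"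
proof (rule unif_bigo_cong)
  have 1: "order_h 2 (\<lambda>h c. (h ^ 1 * poly (antideriv (legendre j)) c) *\<^sub>R \<gamma> h j)"
    if "j \<in> {1..<s}" for j
    using that by (intro unif_bigo_scaleR_powers[OF unif_bigo_mult_powers[OF unif_bigo_h[of 1], of 0 _ 1] gamma_order[of j 1]])
      (use unif_bigo_poly in auto)
  have 2: "order_h 2 (\<lambda>h c. (h * poly (antideriv (legendre j)) c * \<alpha> h) *\<^sub>R \<pi> h j)" for j
    by (rule unif_bigo_power_mono[OF sigma_alpha_part]) simp
  have 3: "order_h 2 (\<lambda>h c. (h ^ 1 * poly (monom 1 1) c) *\<^sub>R (\<gamma> h 0 - f0))"
    by (rule unif_bigo_scaleR_powers[OF unif_bigo_mult_powers[OF unif_bigo_h[of 1], of 0 _ 1] gamma_0_order_1])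
      (use unif_bigo_poly in auto)
  let ?u = "\<lambda>h c. (\<Sum>j=1..<s. (h ^ 1 * poly (antideriv (legendre j)) c) *\<^sub>R \<gamma> h j)
     - (\<Sum>j<s. (h * poly (antideriv (legendre j)) c * \<alpha> h) *\<^sub>R \<pi> h j)
     + (h ^ 1 * poly (monom 1 1) c) *\<^sub>R (\<gamma> h 0 - f0)"
  show "order_h 2 ?u" by (intro unif_bigo_add unif_bigo_diff unif_bigo_sum 1 2 3)
  have "\<sigma> h c - y0 - (h * c) *\<^sub>R f0 =
     (\<sigma> h c - y0 - (h * c) *\<^sub>R \<gamma> h 0) + (h ^ 1 * poly (monom 1 1) c) *\<^sub>R (\<gamma> h 0 - f0)" for h c
    by (simp add: poly_monom scaleR_diff_right)
  then have "\<sigma> h c - y0 - (h * c) *\<^sub>R f0 = ?u h c" if "0 \<le> c" for h c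
    using that by (simp only: sigma_minus_gamma_terms power_one_right)
  then show "\<forall>\<^sub>F h in at_right 0. \<forall>c\<in>{0..1}. \<sigma> h c - y0 - (h * c) *\<^sub>R f0 = ?u h c" by simp
qed

lemma f_sigma_order_2: "order_h 2 (\<lambda>h c. f (\<sigma> h c) - (f0 + (h * c) *\<^sub>R F1))"
  using first_order_along[OF kf continuous_on_id sigma_order_2[unfolded f0_def]]
  unfolding F1_def f0_def by (simp add: diff_diff_eq)

lemma gamma_0_order_2: "order_h 2 (\<lambda>h c. \<gamma> h 0 - (f0 + (h / 2) *\<^sub>R F1))"
proof -
  have "unit_int (legendre 0 * monom 1 1) = 1 / 2" using unit_int_monom[of 1 1] by simp
  note e = this
  show ?thesis
    using gamma_approx[OF f_sigma_order_2, of 0]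
    unfolding gauss_sum_affine[OF zero_le_one] e unit_int_legendre_eq by simp
qed

lemma gamma_1_order_2: "order_h 2 (\<lambda>h c. \<gamma> h 1 - (h * xi 1) *\<^sub>R F1)"
  using gamma_approx[OF f_sigma_order_2, of 1]
  unfolding gauss_sum_affine[OF order_refl] unit_int_legendre_eq unit_int_legendre_1_X by simp

lemma poly_antideriv_legendre_1: "xi 1 * poly (antideriv (legendre 1)) c = (c\<^sup>2 - c) / 2"
  using arg_cong[OF antideriv_legendre_01(2), of "\<lambda>p. poly p c"] by (simp add: poly_monom)

lemma sigma_order_3:
  "order_h 3 (\<lambda>h c. \<sigma> h c - y0 - (h * c) *\<^sub>R f0 - (h\<^sup>2 * c\<^sup>2) *\<^sub>R ((1/2) *\<^sub>R F1))"
proof (rule unif_bigo_cong)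
  let ?L = "\<lambda>j c. poly (antideriv (legendre j)) c"
  have hp: "order_h 1 (\<lambda>h c. h ^ 1 * poly p c)" for p
    by (rule unif_bigo_mult_powers[OF unif_bigo_h[of 1], of 0 _ 1]) (use unif_bigo_poly in auto)
  have 1: "order_h 3 (\<lambda>h c. (h ^ 1 * ?L j c) *\<^sub>R \<gamma> h j)"
    if "j \<in> {2..<s}" for j
    using that by (intro unif_bigo_scaleR_powers[OF hp gamma_order[of j 2]]) auto
  have 2: "order_h 3 (\<lambda>h c. (h ^ 1 * ?L 1 c) *\<^sub>R (\<gamma> h 1 - (h * xi 1) *\<^sub>R F1))"
    by (intro unif_bigo_scaleR_powers[OF hp gamma_1_order_2]) auto
  have 3: "order_h 3 (\<lambda>h c. (h ^ 1 * poly (monom 1 1) c) *\<^sub>R (\<gamma> h 0 - (f0 + (h / 2) *\<^sub>R F1)))"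
    by (intro unif_bigo_scaleR_powers[OF hp gamma_0_order_2]) auto
  let ?u = "\<lambda>h c. (\<Sum>j=2..<s. (h ^ 1 * ?L j c) *\<^sub>R \<gamma> h j)
     - (\<Sum>j<s. (h * ?L j c * \<alpha> h) *\<^sub>R \<pi> h j)
     + (h ^ 1 * ?L 1 c) *\<^sub>R (\<gamma> h 1 - (h * xi 1) *\<^sub>R F1)
     + (h ^ 1 * poly (monom 1 1) c) *\<^sub>R (\<gamma> h 0 - (f0 + (h / 2) *\<^sub>R F1))"
  show "order_h 3 ?u"
    by (intro unif_bigo_add unif_bigo_diff unif_bigo_sum sigma_alpha_part 1 2 3)
  show "\<forall>\<^sub>F h in at_right 0. \<forall>c\<in>{0..1}. \<sigma> h c - y0 - (h * c) *\<^sub>R f0 - (h\<^sup>2 * c\<^sup>2) *\<^sub>R ((1/2) *\<^sub>R F1) = ?u h c"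
  proof (intro always_eventually allI ballI)
    fix h c :: real assume "c \<in> {0..1}"
    then have c: "0 \<le> c" by simp
    have sp: "(\<Sum>j=1..<s. (h * ?L j c) *\<^sub>R \<gamma> h j) = (h * ?L 1 c) *\<^sub>R \<gamma> h 1 + (\<Sum>j=2..<s. (h * ?L j c) *\<^sub>R \<gamma> h j)"
      using s2 by (subst sum.atLeast_Suc_lessThan) (auto simp: numeral_2_eq_2)
    \<comment> \<open>Index 1 contributes h^2 (c^2 - c)/2 and index 0 contributes h^2 c/2 to the
      coefficient of \<open>F1\<close>; together they form the pure square required by
      \<open>second_order_along\<close>.\<close>
    have "(h * ?L 1 c) *\<^sub>R ((h * xi 1) *\<^sub>R F1) = (h * h * (xi 1 * ?L 1 c)) *\<^sub>R F1" by (simp add: mult_ac)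
    also have "\<dots> = (h * h * ((c\<^sup>2 - c) / 2)) *\<^sub>R F1" by (simp only: poly_antideriv_legendre_1)
    finally have "(h * ?L 1 c) *\<^sub>R ((h * xi 1) *\<^sub>R F1) + (h * c) *\<^sub>R ((h / 2) *\<^sub>R F1)
        = (h * h * ((c\<^sup>2 - c) / 2) + h * c * (h / 2)) *\<^sub>R F1"
      by (simp only: scaleR_add_left scaleR_scaleR)
    also have "h * h * ((c\<^sup>2 - c) / 2) + h * c * (h / 2) = h\<^sup>2 * c\<^sup>2 * (1/2)"
      by (simp add: power2_eq_square field_simps)
    finally have e: "(h * ?L 1 c) *\<^sub>R ((h * xi 1) *\<^sub>R F1) + (h * c) *\<^sub>R ((h / 2) *\<^sub>R F1) = (h\<^sup>2 * c\<^sup>2) *\<^sub>R ((1/2) *\<^sub>R F1)"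
      by simp
    have "\<sigma> h c - y0 = (h * c) *\<^sub>R \<gamma> h 0 + ((h * ?L 1 c) *\<^sub>R \<gamma> h 1 + (\<Sum>j=2..<s. (h * ?L j c) *\<^sub>R \<gamma> h j))
      - (\<Sum>j<s. (h * ?L j c * \<alpha> h) *\<^sub>R \<pi> h j)"
      using sigma_minus_gamma_terms[OF c, of h] unfolding sp by (simp add: algebra_simps)
    then show "\<sigma> h c - y0 - (h * c) *\<^sub>R f0 - (h\<^sup>2 * c\<^sup>2) *\<^sub>R ((1/2) *\<^sub>R F1) = ?u h c"
      unfolding e[symmetric] by (simp add: poly_monom scaleR_diff_right scaleR_add_right)
  qed
qed

subsection \<open>The denominator\<close>

abbreviation "\<sigma>2 h \<equiv> sigma2 s f y0 h (\<alpha> h) (Y h)"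

lemma frechet_g_linear: "linear (frechet_derivative g (at y0))"
  using taylor_along(1)[OF kg unif_bigo_sigma] by (rule bounded_linear.linear)

lemma second_order_g_along:
  assumes "continuous_on {0..1} \<theta>"
    and "order_h 3 (\<lambda>h c. u h c - y0 - (h * \<theta> c) *\<^sub>R f0 - (h\<^sup>2 * (\<theta> c)\<^sup>2) *\<^sub>R ((1/2) *\<^sub>R F1))"
  shows "order_h 3 (\<lambda>h c. g (u h c) - (g y0 + (h * \<theta> c) *\<^sub>R G1 + (h\<^sup>2 * (\<theta> c)\<^sup>2) *\<^sub>R ((1/2) *\<^sub>R G2)))"
  using second_order_along[OF kg assms]
  by (simp add: G1_def G2_def linear_scale[OF frechet_g_linear] scaleR_add_right diff_diff_eq add.assoc)

lemmas g_sigma_order_3 = second_order_g_along[OF continuous_on_id sigma_order_3]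

text \<open>The parameter t enters only together with \<alpha> h = O(h^3), so to this order the path
  stays at its end point, hence \<theta> = 1.\<close>

lemma sigma2_order_3:
  "order_h 3 (\<lambda>h t. \<sigma>2 h t - y0 - (h * 1) *\<^sub>R f0 - (h\<^sup>2 * 1\<^sup>2) *\<^sub>R ((1/2) *\<^sub>R F1))"
proof -
  have "order_h 3 (\<lambda>h c. h ^ 1 *\<^sub>R (\<gamma> h 0 - (f0 + (h / 2) *\<^sub>R F1)))"
    by (rule unif_bigo_scaleR_powers[OF unif_bigo_h gamma_0_order_2]) simp
  from unif_bigo_add[OF this sigma_alpha_part[of "[:- 1, 1:]" 0]]
  show ?thesis
    by (rule unif_bigo_cong)
      (simp add: sigma2_def rk_step_def gam_def scaleR_diff_right scaleR_add_right power2_eq_square algebra_simps)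
qed

lemmas g_sigma2_order_3 = second_order_g_along[where \<theta> = "\<lambda>_. 1", OF continuous_on_const sigma2_order_3]

lemma unif_bigo_sigma2: "order_h 1 (\<lambda>h t. \<sigma>2 h t - y0)"
proof -
  have "order_h 1 (\<lambda>h c. (1 * h ^ 1) *\<^sub>R f0)"
    "order_h 1 (\<lambda>h c. (1 * h ^ 2) *\<^sub>R ((1/2) *\<^sub>R F1))"
    by (rule unif_bigo_power_const) (rule unif_bigo_power_mono[OF unif_bigo_power_const], simp)
  moreover have "order_h 1 (\<lambda>h t. \<sigma>2 h t - y0 - (h * 1) *\<^sub>R f0 - (h\<^sup>2 * 1\<^sup>2) *\<^sub>R ((1/2) *\<^sub>R F1))"
    by (rule unif_bigo_power_mono[OF sigma2_order_3]) simp
  ultimately have "order_h 1 (\<lambda>h t. (\<sigma>2 h t - y0 - (h * 1) *\<^sub>R f0 - (h\<^sup>2 * 1\<^sup>2) *\<^sub>R ((1/2) *\<^sub>R F1))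
      + (1 * h ^ 1) *\<^sub>R f0 + (1 * h ^ 2) *\<^sub>R ((1/2) *\<^sub>R F1))"
    by (intro unif_bigo_add)
  then show ?thesis by simp
qed

lemma continuous_on_sigma2: "continuous_on {0..1} (\<sigma>2 h)"
  unfolding sigma2_def[abs_def] by (intro continuous_intros)

definition Q :: "real \<Rightarrow> real ^ 'm" where
  "Q h = g y0 + h *\<^sub>R G1 + h\<^sup>2 *\<^sub>R ((1/2) *\<^sub>R G2)"

lemma path_mean_order_3: "order_h 3 (\<lambda>h c. path_mean g (\<sigma>2 h) - Q h)"
proof (rule unif_bigo_cong)
  show "order_h 3 (\<lambda>h c. integral {0..1} (\<lambda>t. g (\<sigma>2 h t) - Q h))"
    using g_sigma2_order_3 by (intro unif_bigo_integral) (simp add: Q_def)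
  show "\<forall>\<^sub>F h in at_right 0. \<forall>c\<in>{0..1}. path_mean g (\<sigma>2 h) - Q h = integral {0..1} (\<lambda>t. g (\<sigma>2 h t) - Q h)"
    using eventually_continuous_along[OF kg unif_bigo_sigma2 continuous_on_sigma2]
    by eventually_elim (simp add: path_mean_def integral_diff integrable_continuous_real)
qed

definition rho_approx :: "real \<Rightarrow> nat \<Rightarrow> real ^ 'm" where
  "rho_approx h j = unit_int (legendre j) *\<^sub>R g y0
     + unit_int (legendre j * monom 1 1) *\<^sub>R (h *\<^sub>R G1)
     + unit_int (legendre j * monom 1 2) *\<^sub>R (h\<^sup>2 *\<^sub>R ((1/2) *\<^sub>R G2))"

lemma path_coeff_order_3: "order_h 3 (\<lambda>h c. \<rho> h j - rho_approx h j)"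
proof -
  let ?T = "\<lambda>h c. g y0 + (h * c) *\<^sub>R G1 + (h\<^sup>2 * c\<^sup>2) *\<^sub>R ((1/2) *\<^sub>R G2)"
  have "order_h 3 (\<lambda>h c. integral {0..1} (\<lambda>c. poly (legendre j) c *\<^sub>R (g (\<sigma> h c) - ?T h c)))"
    using unif_bigo_scaleR_powers[of 0 "\<lambda>h c. poly (legendre j) c", OF _ g_sigma_order_3, of 3] unif_bigo_poly[of "legendre j"]
    by (intro unif_bigo_integral) simp
  then show ?thesis
  proof (rule unif_bigo_cong, use eventually_continuous_g_sigma in eventually_elim)
    case (elim h)
    have "(\<lambda>c. poly (legendre j) c *\<^sub>R g (\<sigma> h c)) integrable_on {0..1}"
      using elim by (intro integrable_continuous_real continuous_intros)
    then have "((\<lambda>c. poly (legendre j) c *\<^sub>R g (\<sigma> h c)) has_integral \<rho> h j) {0..1}"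
      unfolding path_coeff_def by (rule integrable_integral)
    from has_integral_diff[OF this has_integral_add[OF has_integral_add[OF
        has_integral_scaleR_left[OF has_integral_unit_int[of "legendre j"], of "g y0"]
        has_integral_scaleR_left[OF has_integral_unit_int[of "legendre j * monom 1 1"], of "h *\<^sub>R G1"]]
        has_integral_scaleR_left[OF has_integral_unit_int[of "legendre j * monom 1 2"], of "h\<^sup>2 *\<^sub>R ((1/2) *\<^sub>R G2)"]]]
    have "((\<lambda>c. poly (legendre j) c *\<^sub>R (g (\<sigma> h c) - ?T h c)) has_integral \<rho> h j - rho_approx h j) {0..1}"
      unfolding rho_approx_def
      by (rule has_integral_eq[rotated])
        (simp add: poly_monom scaleR_diff_right scaleR_add_right mult_ac power2_eq_square)
    then show ?case by (simp add: integral_unique)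
  qed
qed

text \<open>The vector paired with \<gamma>_0 (i = 2) or, up to sign, with \<gamma>_1 (i = 1) when
  the denominator is sorted by these two; \<open>Q h\<close> replaces the mean of g along the second
  path.\<close>

definition V :: "nat \<Rightarrow> real \<Rightarrow> real ^ 'm" where
  "V i h = (\<Sum>j<s. phi s i j *\<^sub>R \<rho> h j) - phi s i 0 *\<^sub>R Q h"

text \<open>Since \<open>\<integral> \<Phi>\<^sub>i\<close> is \<open>P\<^sub>i\<^sub>-\<^sub>1\<close> up to a multiple of \<open>P\<^sub>s\<close>, integration by parts turns \<open>V i h\<close> into
  minus the \<open>(i - 1)\<close>-st Legendre coefficient of the derivative of \<open>g \<circ> \<sigma>\<close>.\<close>

lemma V_order_3:
  assumes "1 \<le> i" "i \<le> 2"
  shows "order_h 3 (\<lambda>h c. V i h + of_bool (i = 1) *\<^sub>R (h *\<^sub>R G1)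
     + (2 * unit_int (legendre (i - 1) * monom 1 1)) *\<^sub>R (h\<^sup>2 *\<^sub>R ((1/2) *\<^sub>R G2)))"
proof -
  have "order_h 3 (\<lambda>h c. \<Sum>j<s. phi s i j *\<^sub>R (\<rho> h j - rho_approx h j))"
    by (intro unif_bigo_sum unif_bigo_scale path_coeff_order_3)
  moreover have "(\<Sum>j<s. phi s i j *\<^sub>R (\<rho> h j - rho_approx h j)) =
      V i h + of_bool (i = 1) *\<^sub>R (h *\<^sub>R G1)
     + (2 * unit_int (legendre (i - 1) * monom 1 1)) *\<^sub>R (h\<^sup>2 *\<^sub>R ((1/2) *\<^sub>R G2))" for h
  proof -
    have i_le_s: "i \<le> s" using assms s2 by simp
    have a: "(\<Sum>j<s. phi s i j * unit_int (legendre j * p)) = unit_int (p * phi_poly s i)" for p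
      by (simp add: phi_poly_def sum_distrib_left unit_int_sum unit_int_smult mult.commute)
    have a0: "(\<Sum>j<s. phi s i j * unit_int (legendre j)) = phi s i 0"
      using a[of 1] unit_int_phi_poly[of s i] s2 by simp
    have a1: "(\<Sum>j<s. phi s i j * unit_int (legendre j * monom 1 1)) = phi s i 0 - of_bool (i = 1)"
    proof -
      have "unit_int (legendre (i - 1) * monom 1 0) = of_bool (i = 1)"
        using assms by (auto simp: unit_int_legendre_eq)
      then show ?thesis
        unfolding a using unit_int_monom_phi_poly[OF assms(1) i_le_s, of 1] s2 by simp
    qed
    have a2: "(\<Sum>j<s. phi s i j * unit_int (legendre j * monom 1 2)) = phi s i 0 - 2 * unit_int (legendre (i - 1) * monom 1 1)"
      unfolding a using unit_int_monom_phi_poly[OF assms(1) i_le_s, of 2] s2 by simp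
    have "(\<Sum>j<s. phi s i j *\<^sub>R rho_approx h j) =
       (\<Sum>j<s. phi s i j * unit_int (legendre j)) *\<^sub>R g y0
     + (\<Sum>j<s. phi s i j * unit_int (legendre j * monom 1 1)) *\<^sub>R (h *\<^sub>R G1)
     + (\<Sum>j<s. phi s i j * unit_int (legendre j * monom 1 2)) *\<^sub>R (h\<^sup>2 *\<^sub>R ((1/2) *\<^sub>R G2))"
    proof -
      have "(\<Sum>j<s. phi s i j *\<^sub>R (u j *\<^sub>R x + v j *\<^sub>R y + w j *\<^sub>R z)) =
          (\<Sum>j<s. phi s i j * u j) *\<^sub>R x + (\<Sum>j<s. phi s i j * v j) *\<^sub>R y + (\<Sum>j<s. phi s i j * w j) *\<^sub>R z"
        for u v w and x y z :: "real ^ 'm"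
        by (simp add: scaleR_add_right sum.distrib scaleR_sum_left)
      then show ?thesis unfolding rho_approx_def .
    qed
    then show ?thesis
      unfolding a0 a1 a2 V_def Q_def
      by (simp only: scaleR_diff_right sum_subtractf scaleR_diff_left scaleR_add_right) (simp add: algebra_simps)
  qed
  ultimately show ?thesis by simp
qed

lemma V_1_order_2: "order_h 2 (\<lambda>h c. V 1 h + h *\<^sub>R G1)"
proof -
  have "unit_int (legendre 0 * monom 1 1) = 1 / 2" using unit_int_monom[of 1 1] by simp
  note e = this
  have "order_h 3 (\<lambda>h c. V 1 h + h *\<^sub>R G1 + h\<^sup>2 *\<^sub>R ((1/2) *\<^sub>R G2))"
    using V_order_3[of 1, unfolded diff_self_eq_0 e] by simp
  then have "order_h 2 (\<lambda>h c. V 1 h + h *\<^sub>R G1 + h\<^sup>2 *\<^sub>R ((1/2) *\<^sub>R G2))"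
    by (rule unif_bigo_power_mono) simp
  from unif_bigo_diff[OF this unif_bigo_power_const[of 2 1 "(1/2) *\<^sub>R G2"]] show ?thesis by simp
qed

lemma V_2_order_3: "order_h 3 (\<lambda>h c. V 2 h + (xi 1 * h\<^sup>2) *\<^sub>R G2)"
  using V_order_3[of 2] unit_int_legendre_1_X by simp

definition "denom h = inner (\<rho> h 0 - path_mean g (\<sigma>2 h)) (\<pi> h 0)
     + (\<Sum>j = 1..s - 1. inner (\<rho> h j) (\<pi> h j))"

lemma denom_eq: "denom h = inner (V 2 h) (\<gamma> h 0) - inner (V 1 h) (\<gamma> h 1)
    - inner (path_mean g (\<sigma>2 h) - Q h) (\<pi> h 0)"
proof -
  have "{..<s} = insert 0 {1..s - 1}" using s2 by auto
  then have "denom h = (\<Sum>j<s. inner (\<rho> h j) (\<pi> h j)) - inner (path_mean g (\<sigma>2 h)) (\<pi> h 0)"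
    by (simp add: denom_def inner_diff_left)
  also have "(\<Sum>j<s. inner (\<rho> h j) (\<pi> h j)) =
      inner (\<Sum>j<s. phi s 2 j *\<^sub>R \<rho> h j) (\<gamma> h 0) - inner (\<Sum>j<s. phi s 1 j *\<^sub>R \<rho> h j) (\<gamma> h 1)"
    by (simp add: pert_def inner_diff_right inner_sum_left sum_subtractf)
  finally show ?thesis
    by (simp add: V_def pert_def inner_diff_left inner_diff_right algebra_simps)
qed

text \<open>Leading terms: V_2 is -\<xi>_1 h^2 G2 against \<gamma>_0, which is f0, and V_1 is -h G1
  against \<gamma>_1, which is \<xi>_1 h F1. Hence V_1 is needed only modulo h^2, the missing order
  being supplied by \<gamma>_1.\<close>

lemma denom_order:
  "order_h 3 (\<lambda>h c. denom h - xi 1 * h\<^sup>2 * (inner G1 F1 - inner G2 f0))"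
proof -
  have 1: "order_h 3 (\<lambda>h c. inner (V 2 h + (xi 1 * h\<^sup>2) *\<^sub>R G2) (\<gamma> h 0))"
    by (rule unif_bigo_inner_powers[OF V_2_order_3, of 0]) (use unif_bigo_gamma in auto)
  have 2: "order_h 3 (\<lambda>h c. inner ((xi 1 * h\<^sup>2) *\<^sub>R G2) (\<gamma> h 0 - f0))"
    by (rule unif_bigo_inner_powers[OF unif_bigo_power_const gamma_0_order_1]) simp
  have 3: "order_h 3 (\<lambda>h c. inner (V 1 h + h *\<^sub>R G1) (\<gamma> h 1))"
    by (rule unif_bigo_inner_powers[OF V_1_order_2 gamma_order[of 1 1]]) (use s2 in auto)
  have 4: "order_h 3 (\<lambda>h c. inner ((1 * h ^ 1) *\<^sub>R G1) (\<gamma> h 1 - (h * xi 1) *\<^sub>R F1))"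
    by (rule unif_bigo_inner_powers[OF unif_bigo_power_const gamma_1_order_2]) simp
  have 5: "order_h 3 (\<lambda>h c. inner (path_mean g (\<sigma>2 h) - Q h) (\<pi> h 0))"
    by (rule unif_bigo_inner_powers[OF path_mean_order_3, of 0]) (use unif_bigo_pert in auto)
  have "denom h - xi 1 * h\<^sup>2 * (inner G1 F1 - inner G2 f0) =
     inner (V 2 h + (xi 1 * h\<^sup>2) *\<^sub>R G2) (\<gamma> h 0) - inner ((xi 1 * h\<^sup>2) *\<^sub>R G2) (\<gamma> h 0 - f0)
     - inner (V 1 h + h *\<^sub>R G1) (\<gamma> h 1) + inner ((1 * h ^ 1) *\<^sub>R G1) (\<gamma> h 1 - (h * xi 1) *\<^sub>R F1)
     - inner (path_mean g (\<sigma>2 h) - Q h) (\<pi> h 0)" for h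
    unfolding denom_eq
    by (simp add: inner_add_left inner_diff_right power2_eq_square algebra_simps)
  then show ?thesis
    using unif_bigo_diff[OF unif_bigo_add[OF unif_bigo_diff[OF unif_bigo_diff[OF 1 2] 3] 4] 5] by simp
qed

text \<open>From |\<alpha>| |D| <= |N| and D of exact order h^2, the terms h^3 |\<alpha>| from both
  bounds are absorbed into half of the left side, and division by h^2 leaves h^(2s-2).\<close>

lemma alpha_bigo:
  assumes nz: "inner G1 F1 - inner G2 f0 \<noteq> 0"
    and eq: "\<forall>\<^sub>F h in at_right 0. \<alpha> h = (\<Sum>j<s. inner (\<rho> h j) (\<gamma> h j)) / denom h"
  shows "\<alpha> \<in> O[at_right 0](\<lambda>h. h ^ (2 * (s - 1)))"
proof -
  define \<mu> where "\<mu> = xi 1 * \<bar>inner G1 F1 - inner G2 f0\<bar>"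
  have \<mu>: "\<mu> > 0" using nz xi_pos[of 1] by (simp add: \<mu>_def)
  obtain K where K: "K \<ge> 0" "\<forall>\<^sub>F h in at_right 0. \<forall>c\<in>{0..1::real}.
      norm (denom h - xi 1 * h\<^sup>2 * (inner G1 F1 - inner G2 f0)) \<le> K * h ^ 3"
    using denom_order by (rule unif_bigoE)
  obtain L where L: "L \<ge> 0" "\<forall>\<^sub>F h in at_right 0. \<forall>c\<in>{0..1::real}.
      norm (\<Sum>j<s. inner (\<rho> h j) (\<gamma> h j)) \<le> L * (h ^ (2 * s) + h ^ 3 * \<bar>\<alpha> h\<bar>)"
    using N_bound by (rule unif_bigoE)
  have "((\<lambda>h. (K + L) * h) \<longlongrightarrow> (K + L) * 0) (at_right 0)" by (intro tendsto_intros)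
  then have small: "\<forall>\<^sub>F h in at_right 0. (K + L) * h < \<mu> / 2"
    using order_tendstoD(2)[of _ "(K + L) * 0" _ "\<mu> / 2"] \<mu> by simp
  have "\<forall>\<^sub>F h in at_right 0. norm (\<alpha> h) \<le> (2 * L / \<mu>) * norm (h ^ (2 * (s - 1)))"
    using K(2) L(2) small eq eventually_at_right_unit
  proof eventually_elim
    case (elim h)
    define E where "E = h ^ (2 * (s - 1))"
    define D N a where "D = denom h" and "N = (\<Sum>j<s. inner (\<rho> h j) (\<gamma> h j))" and "a = \<bar>\<alpha> h\<bar>"
    have h: "0 < h" "h < 1" and a: "a \<ge> 0" using elim by (auto simp: a_def)
    have Db: "\<bar>D - xi 1 * h\<^sup>2 * (inner G1 F1 - inner G2 f0)\<bar> \<le> K * h ^ 3"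
      using bspec[OF elim(1), of 0] by (simp add: D_def)
    have Nb: "\<bar>N\<bar> \<le> L * (h ^ (2 * s) + h ^ 3 * a)"
      using bspec[OF elim(2), of 0] by (simp add: N_def a_def)
    have "\<bar>xi 1 * h\<^sup>2 * (inner G1 F1 - inner G2 f0)\<bar> = \<mu> * h\<^sup>2"
      using xi_pos[of 1] by (simp add: \<mu>_def abs_mult)
    then have "\<mu> * h\<^sup>2 \<le> \<bar>D\<bar> + K * h ^ 3" using Db by linarith
    then have "a * (\<mu> * h\<^sup>2) \<le> a * (\<bar>D\<bar> + K * h ^ 3)" using a by (rule mult_left_mono)
    \<comment> \<open>Stated as an inequality so that D = 0, where the quotient has its conventional
      value, is covered as well.\<close>
    moreover have "a * \<bar>D\<bar> \<le> \<bar>N\<bar>"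
    proof (cases "D = 0")
      case False
      have "\<alpha> h = N / D" using elim(4) unfolding D_def N_def .
      then have "a = \<bar>N\<bar> / \<bar>D\<bar>" by (simp only: a_def abs_divide)
      then show ?thesis using False by simp
    qed simp
    ultimately have "a * (\<mu> * h\<^sup>2) \<le> L * (h ^ (2 * s) + h ^ 3 * a) + a * (K * h ^ 3)"
      using Nb by (simp add: distrib_left)
    also have "\<dots> = L * h ^ (2 * s) + (a * h\<^sup>2) * ((K + L) * h)"
      by (simp add: power2_eq_square power3_eq_cube algebra_simps)
    also have "\<dots> \<le> L * h ^ (2 * s) + (a * h\<^sup>2) * (\<mu> / 2)"
      using elim(3) a by (intro add_left_mono mult_left_mono) auto
    also have "h ^ (2 * s) = E * h\<^sup>2"
    proof -
      have "2 * s = 2 * (s - 1) + 2" using s2 by simp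
      then show ?thesis unfolding E_def by (metis power_add)
    qed
    finally have "(a * \<mu>) * h\<^sup>2 \<le> (2 * L * E) * h\<^sup>2"
      by (simp add: algebra_simps)
    then have "a * \<mu> \<le> 2 * L * E" using h by simp
    then have "a \<le> (2 * L / \<mu>) * E" using \<mu> by (simp add: field_simps)
    then show ?case using h by (simp add: a_def E_def)
  qed
  then show ?thesis by (rule bigoI)
qed

end

text \<open>Translates the matrix expression of the assumption in (a): with the two Jacobians and x
  = f0 it is G1 . F1 minus the product of g'(F1) with f0, and subtracting the second derivative term
  completes G1 . F1 - G2 . f0.\<close>

lemma matrix_form_eq:
  fixes A B :: "real ^ 'm ^ 'm"
  shows "inner x ((transpose A ** B - transpose (A ** B)) *v x) = inner (A *v x) (B *v x) - inner (A *v (B *v x)) x"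
proof -
  have t: "inner x (transpose M *v y) = inner (M *v x) y" for M :: "real ^ 'm ^ 'm" and y
    by (metis dot_lmul_matrix inner_commute transpose_matrix_vector)
  show ?thesis
    by (simp only: matrix_vector_mult_diff_rdistrib inner_diff_right matrix_vector_mul_assoc[symmetric] t)
qed

section \<open>Algebra of the symplectic matrix\<close>

lemma symplectic_J_mult:
  "(symplectic_J *v x) $ Inl k = x $ Inr k"
  "(symplectic_J *v x) $ Inr k = - x $ Inl k"
proof -
  have sp: "(\<Sum>j\<in>UNIV. u j) = (\<Sum>j\<in>UNIV. u (Inl j)) + (\<Sum>j\<in>UNIV. u (Inr j))" for u :: "'a + 'a \<Rightarrow> real"
    unfolding UNIV_Plus_UNIV[symmetric] by (subst sum.Plus) auto
  show "(symplectic_J *v x) $ Inl k = x $ Inr k"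
    "(symplectic_J *v x) $ Inr k = - x $ Inl k"
    by (simp_all add: matrix_vector_mult_def symplectic_J_def sp of_bool_def if_distrib[of "\<lambda>x. x * _"] sum_negf cong: if_cong)
qed

lemma symplectic_J_skew: "inner (symplectic_J *v x) y = - inner x (symplectic_J *v y)"
proof -
  have sp: "(\<Sum>j\<in>UNIV. u j) = (\<Sum>j\<in>UNIV. u (Inl j)) + (\<Sum>j\<in>UNIV. u (Inr j))" for u :: "'a + 'a \<Rightarrow> real"
    unfolding UNIV_Plus_UNIV[symmetric] by (subst sum.Plus) auto
  show ?thesis by (simp add: inner_vec_def sp symplectic_J_mult sum_negf)
qed

lemma symplectic_J_square: "symplectic_J *v (symplectic_J *v x) = - x"
proof -
  have "(symplectic_J *v (symplectic_J *v x)) $ i = (- x) $ i" for i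
    by (cases i) (simp_all add: symplectic_J_mult)
  then show ?thesis by (simp add: vec_eq_iff)
qed

subsection \<open>The two cases of the theorem\<close>

text \<open>Differentiability on a neighbourhood lets \<open>L\<close> be pulled out of the first
  derivative near \<open>a\<close>, which is what differentiating once more requires.\<close>

lemma analytic_compose_linear:
  fixes F G :: "real ^ 'm \<Rightarrow> real ^ 'm"
  assumes F: "\<And>i. power_series_at (k i) (\<lambda>x. F x $ i) a"
    and L: "bounded_linear L" and G: "\<And>x. G x = L (F x)"
  shows "frechet_derivative G (at a) v = L (frechet_derivative F (at a) v)"
    and "second_deriv G a u v = L (second_deriv F a u v)"
proof -
  obtain D2 where d: "\<forall>\<^sub>F x in nhds a. F differentiable (at x)"
    and D2: "\<And>v. ((\<lambda>x. frechet_derivative F (at x) v) has_derivative (\<lambda>u. D2 u v)) (at a)"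
    by (rule analytic_second_order[OF F]) blast
  have "\<forall>\<^sub>F x in nhds a. frechet_derivative G (at x) = (\<lambda>v. L (frechet_derivative F (at x) v))"
    using d
  proof eventually_elim
    case (elim x)
    then have "(F has_derivative frechet_derivative F (at x)) (at x)" by (simp add: frechet_derivative_works)
    from bounded_linear.has_derivative[OF L this] show ?case
      unfolding G[symmetric] by (rule frechet_derivative_at[symmetric])
  qed
  note fr = this
  show "frechet_derivative G (at a) v = L (frechet_derivative F (at a) v)"
    using eventually_nhds_x_imp_x[OF fr] by simp
  have "((\<lambda>x. L (frechet_derivative F (at x) v)) has_derivative (\<lambda>u. L (D2 u v))) (at a)"
    by (rule bounded_linear.has_derivative[OF L D2])
  moreover have "\<forall>\<^sub>F x in at a. L (frechet_derivative F (at x) v) = frechet_derivative G (at x) v"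
    using fr unfolding eventually_nhds_conv_at by (auto elim!: eventually_mono)
  ultimately have "((\<lambda>x. frechet_derivative G (at x) v) has_derivative (\<lambda>u. L (D2 u v))) (at a)"
    by (rule has_derivative_transform_eventually) (use eventually_nhds_x_imp_x[OF fr] in simp_all)
  then show "second_deriv G a u v = L (second_deriv F a u v)"
    unfolding second_deriv_def frechet_derivative_at[OF D2, symmetric]
    by (simp add: frechet_derivative_at[symmetric])
qed

lemma alpha_order_invariant:
  fixes U :: "(real ^ 'm) set" and C :: "real ^ 'm \<Rightarrow> real"
  assumes s: "2 \<le> s" and \<kappa>: "0 \<le> \<kappa>"
    and U: "open U" "y0 \<in> U" and f: "real_analytic_on f U" and C: "real_analytic_on C U"
    and orth: "\<forall>y\<in>U. inner (grad C y) (f y) = 0"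
    and st: "\<forall>\<^sub>F h in at_right 0. is_stages s f U y0 h (\<alpha> h) (Y h)"
    and Y: "\<forall>i<s. ((\<lambda>h. Y h i) \<longlongrightarrow> y0) (at_right 0)"
    and \<alpha>: "\<forall>\<^sub>F h in at_right 0. \<bar>\<alpha> h\<bar> \<le> \<kappa> * h\<^sup>2"
    and eq: "\<forall>\<^sub>F h in at_right 0. \<alpha> h = num_inv s f C y0 h (\<alpha> h) (Y h) / den_inv s f C y0 h (\<alpha> h) (Y h)"
    and nz: "let g = grad C; f0 = f y0; f0' = jacobian f (at y0); g0' = jacobian g (at y0)
         in inner f0 ((transpose g0' ** f0' - transpose (g0' ** f0')) *v f0)
              - inner (second_deriv g y0 f0 f0) f0 \<noteq> 0"
  shows "\<alpha> \<in> O[at_right 0](\<lambda>h. h ^ (2 * (s - 1)))"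
proof -
  obtain kf where kf: "\<And>i. power_series_at (kf i) (\<lambda>x. f x $ i) y0"
    using real_analytic_on_component[OF f U(2)] by blast
  obtain k where k: "power_series_at k C y0"
    using real_analytic_on_scalar[OF C U(2)] by blast
  interpret gauss_family s f "grad C" y0 U \<alpha> Y \<kappa> kf "\<lambda>i. deriv_coeff i k"
  proof
    show "\<forall>\<^sub>F y in nhds y0. inner (grad C y) (f y) = 0"
      using orth U by (auto simp: eventually_nhds)
  qed (use s \<kappa> kf power_series_grad[OF k] st Y \<alpha> in auto)
  have diff: "f differentiable (at y0)" "grad C differentiable (at y0)"
    by (rule analytic_second_order[OF kf], erule eventually_nhds_x_imp_x)
      (rule analytic_second_order[OF kg], erule eventually_nhds_x_imp_x)
  have jac: "jacobian F (at y0) *v v = frechet_derivative F (at y0) v"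
    if "F differentiable (at y0)" for F :: "real ^ 'm \<Rightarrow> real ^ 'm" and v
    using frechet_derivative_at[OF that[unfolded jacobian_works]] by (rule fun_cong)
  \<comment> \<open>\<open>G2\<close> contains both g'(F1) and g''(f0, f0), so the two terms of the
    assumption combine into this one quantity.\<close>
  have "inner G1 F1 - inner G2 f0 \<noteq> 0"
    using nz unfolding Let_def matrix_form_eq
    by (simp add: jac diff G1_def F1_def G2_def f0_def inner_add_left)
  then show ?thesis
    using eq by (intro alpha_bigo) (simp_all add: num_inv_def den_inv_def denom_def)
qed

lemma alpha_order_hamiltonian:
  fixes U :: "(real ^ ('d :: finite + 'd)) set" and H :: "real ^ ('d + 'd) \<Rightarrow> real"
  assumes s: "2 \<le> s" and \<kappa>: "0 \<le> \<kappa>"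
    and U: "open U" "y0 \<in> U" and H: "real_analytic_on H U"
    and f: "\<forall>y\<in>U. f y = symplectic_J *v grad H y"
    and st: "\<forall>\<^sub>F h in at_right 0. is_stages s f U y0 h (\<alpha> h) (Y h)"
    and Y: "\<forall>i<s. ((\<lambda>h. Y h i) \<longlongrightarrow> y0) (at_right 0)"
    and \<alpha>: "\<forall>\<^sub>F h in at_right 0. \<bar>\<alpha> h\<bar> \<le> \<kappa> * h\<^sup>2"
    and eq: "\<forall>\<^sub>F h in at_right 0. \<alpha> h = num_ham s f y0 h (\<alpha> h) (Y h) / den_ham s f y0 h (\<alpha> h) (Y h)"
    and nz: "inner (second_deriv f y0 (f y0) (f y0)) (symplectic_J *v f y0) \<noteq> 0"
  shows "\<alpha> \<in> O[at_right 0](\<lambda>h. h ^ (2 * (s - 1)))"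
proof -
  obtain k where k: "power_series_at k H y0"
    using real_analytic_on_scalar[OF H U(2)] by blast
  obtain r where r: "r > 0" "ball y0 r \<subseteq> U" using U by (auto simp: open_contains_ball)
  define L where "L x = - (symplectic_J *v x)" for x :: "real ^ ('d + 'd)"
  \<comment> \<open>Defined as - J f everywhere; it agrees with the gradient of H on U. Thus
    orthogonality to f and the relation between the coefficients of g and f hold without reference
    to U.\<close>
  define g where "g y = L (f y)" for y
  have L: "bounded_linear L"
    unfolding L_def by (intro bounded_linear_minus matrix_vector_mul_bounded_linear)
  have L_inner: "inner (L x) y = inner x (symplectic_J *v y)" for x y
    by (simp add: L_def symplectic_J_skew)
  have skew0: "inner (L x) x = 0" for x
  proof -
    have "inner (symplectic_J *v x) x = - inner (symplectic_J *v x) x"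
      using symplectic_J_skew[of x x] by (simp only: inner_commute)
    then show ?thesis by (simp add: L_def)
  qed
  have g_grad: "g y = grad H y" if "y \<in> U" for y
    using f that by (simp add: g_def L_def symplectic_J_square)
  \<comment> \<open>Analyticity of f at y0 comes from that of H, through f = J grad H.\<close>
  define kf where "kf i \<nu> = (\<Sum>j\<in>UNIV. symplectic_J $ i $ j * deriv_coeff j k \<nu>)"
    for i :: "'d + 'd" and \<nu>
  have kf: "power_series_at (kf i) (\<lambda>x. f x $ i) y0" for i
    unfolding kf_def
    by (rule power_series_at_cong[OF power_series_at_sum[OF power_series_grad[OF k]] r(1)])
      (use f r in \<open>auto simp: matrix_vector_mult_def\<close>)
  have kg: "power_series_at (deriv_coeff i k) (\<lambda>x. g x $ i) y0" for i
    by (rule power_series_at_cong[OF power_series_grad[OF k] r(1)]) (use g_grad r in auto)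
  interpret gauss_family s f g y0 U \<alpha> Y \<kappa> kf "\<lambda>i. deriv_coeff i k"
  proof
    show "\<forall>\<^sub>F y in nhds y0. inner (g y) (f y) = 0"
      by (simp add: g_def skew0)
  qed (use s \<kappa> kf kg st Y \<alpha> in auto)
  have g': "frechet_derivative g (at y0) v = L (frechet_derivative f (at y0) v)"
    and g'': "second_deriv g y0 u v = L (second_deriv f y0 u v)" for u v
    using analytic_compose_linear[OF kf L g_def] by auto
  \<comment> \<open>The Jacobian of g at y0 is the Hessian of H. Its entries are second order
    coefficients of H, in which the order of raising two exponents does not matter.\<close>
  define M where "M i j = deriv_coeff i k ((\<lambda>_. 0)(j := 1))" for i j
  have c: "frechet_derivative g (at y0) v $ i = (\<Sum>j\<in>UNIV. v $ j * M i j)" for v i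
    unfolding M_def by (rule analytic_second_order[OF kg]) blast
  have M: "M i j = M j i" for i j
    by (cases "i = j") (auto simp: M_def deriv_coeff_def fun_upd_twist)
  have sym: "inner (frechet_derivative g (at y0) u) v = inner (frechet_derivative g (at y0) v) u" for u v
  proof -
    have "inner (frechet_derivative g (at y0) u) v = (\<Sum>i\<in>UNIV. \<Sum>j\<in>UNIV. u $ j * M i j * v $ i)"
      by (simp add: inner_vec_def c sum_distrib_right)
    also have "\<dots> = (\<Sum>j\<in>UNIV. \<Sum>i\<in>UNIV. u $ j * M i j * v $ i)" by (rule sum.swap)
    also have "\<dots> = (\<Sum>j\<in>UNIV. \<Sum>i\<in>UNIV. v $ i * M j i * u $ j)"
      by (intro sum.cong refl) (simp add: M mult_ac)
    also have "\<dots> = inner (frechet_derivative g (at y0) v) u"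
      by (simp add: inner_vec_def c sum_distrib_right)
    finally show ?thesis .
  qed
  \<comment> \<open>Here G1 = L F1 with L skew. The term g'(F1) . f0 equals F1 . g'(f0) by symmetry
    of the Hessian and vanishes likewise, so only the second derivative survives.\<close>
  have "inner G1 F1 = 0" unfolding G1_def F1_def g' by (rule skew0)
  moreover have "inner (frechet_derivative g (at y0) F1) f0 = 0"
    using sym[of F1 f0] unfolding g' F1_def[symmetric] by (simp add: skew0)
  ultimately have "inner G1 F1 - inner G2 f0 \<noteq> 0"
    using nz unfolding G2_def inner_add_left g'' L_inner f0_def by simp
  then show ?thesis
  proof (rule alpha_bigo)
    have cf: "\<forall>\<^sub>F h in at_right 0. continuous_on {0..1} (\<lambda>c. f (\<sigma> h c))"
      by (rule eventually_continuous_along[OF kf unif_bigo_sigma continuous_on_sigma])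
    have cf2: "\<forall>\<^sub>F h in at_right 0. continuous_on {0..1} (\<lambda>c. f (\<sigma>2 h c))"
      by (rule eventually_continuous_along[OF kf unif_bigo_sigma2 continuous_on_sigma2])
    show "\<forall>\<^sub>F h in at_right 0. \<alpha> h = (\<Sum>j<s. inner (\<rho> h j) (\<gamma> h j)) / denom h"
      using cf cf2 eq
    proof eventually_elim
      case (elim h)
      \<comment> \<open>By linearity L passes through the integrals, and \<open>L_inner\<close> then
        moves it to the other factor as J, which turns the numerator and denominator of (b) into
        those of the common setting.\<close>
      have pc: "\<rho> h j = L (path_coeff f (\<sigma> h) j)" for j
      proof -
        have "(\<lambda>c. poly (legendre j) c *\<^sub>R f (\<sigma> h c)) integrable_on {0..1}"
          using elim(1) by (intro integrable_continuous_real continuous_intros)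
        from integral_linear[OF this L] show ?thesis
          by (simp add: path_coeff_def g_def o_def linear_scale[OF bounded_linear.linear[OF L]])
      qed
      have pm: "path_mean g (\<sigma>2 h) = L (path_mean f (\<sigma>2 h))"
        using integral_linear[OF integrable_continuous_real[OF elim(2)] L]
        by (simp add: path_mean_def g_def o_def)
      have "num_ham s f y0 h (\<alpha> h) (Y h) = (\<Sum>j<s. inner (\<rho> h j) (\<gamma> h j))"
        by (simp add: num_ham_def pc L_inner)
      moreover have "den_ham s f y0 h (\<alpha> h) (Y h) = denom h"
        by (simp add: den_ham_def denom_def pc pm L_inner inner_diff_left)
      ultimately show ?case using elim(3) by simp
    qed
  qed
qed

theorem theorem5:
  fixes s :: nat and \<kappa> :: real
  assumes "s \<ge> 2" and "\<kappa> > 0"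
  shows
    "(\<forall>(U :: (real ^ 'm) set) f (C :: real ^ 'm \<Rightarrow> real) y0 (\<alpha> :: real \<Rightarrow> real)
        (Y :: real \<Rightarrow> nat \<Rightarrow> real ^ 'm).
        open U \<and> y0 \<in> U \<and> real_analytic_on f U \<and> real_analytic_on C U \<and>
        (\<forall>y\<in>U. grad C y \<bullet> f y = 0) \<and>
        (\<forall>\<^sub>F h in at_right 0. is_stages s f U y0 h (\<alpha> h) (Y h)) \<and>
        (\<forall>i<s. ((\<lambda>h. Y h i) \<longlongrightarrow> y0) (at_right 0)) \<and>
        (\<forall>\<^sub>F h in at_right 0. \<bar>\<alpha> h\<bar> \<le> \<kappa> * h\<^sup>2) \<and>
        (\<forall>\<^sub>F h in at_right 0.
           \<alpha> h = num_inv s f C y0 h (\<alpha> h) (Y h) / den_inv s f C y0 h (\<alpha> h) (Y h)) \<and>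
        (let g = grad C; f0 = f y0; f0' = jacobian f (at y0); g0' = jacobian g (at y0)
         in f0 \<bullet> ((transpose g0' ** f0' - transpose (g0' ** f0')) *v f0)
              - second_deriv g y0 f0 f0 \<bullet> f0 \<noteq> 0)
      \<longrightarrow> \<alpha> \<in> O[at_right 0](\<lambda>h. h ^ (2 * (s - 1))))
   \<and>
     (\<forall>(U :: (real ^ ('d :: finite + 'd)) set) f (H :: real ^ ('d + 'd) \<Rightarrow> real) y0
        (\<alpha> :: real \<Rightarrow> real) (Y :: real \<Rightarrow> nat \<Rightarrow> real ^ ('d + 'd)).
        open U \<and> y0 \<in> U \<and> real_analytic_on H U \<and>
        (\<forall>y\<in>U. f y = symplectic_J *v grad H y) \<and>
        (\<forall>\<^sub>F h in at_right 0. is_stages s f U y0 h (\<alpha> h) (Y h)) \<and>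
        (\<forall>i<s. ((\<lambda>h. Y h i) \<longlongrightarrow> y0) (at_right 0)) \<and>
        (\<forall>\<^sub>F h in at_right 0. \<bar>\<alpha> h\<bar> \<le> \<kappa> * h\<^sup>2) \<and>
        (\<forall>\<^sub>F h in at_right 0.
           \<alpha> h = num_ham s f y0 h (\<alpha> h) (Y h) / den_ham s f y0 h (\<alpha> h) (Y h)) \<and>
        second_deriv f y0 (f y0) (f y0) \<bullet> (symplectic_J *v f y0) \<noteq> 0
      \<longrightarrow> \<alpha> \<in> O[at_right 0](\<lambda>h. h ^ (2 * (s - 1))))"
proof (intro conjI allI impI, goal_cases)
  case (1 U f C y0 \<alpha> Y)
  then show ?case
    by (elim conjE)
      (rule alpha_order_invariant[where f = f and U = U and C = C and Y = Y and \<kappa> = \<kappa>]; (assumption | use assms in simp))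
next
  case (2 U f H y0 \<alpha> Y)
  then show ?case
    by (elim conjE)
      (rule alpha_order_hamiltonian[where f = f and U = U and H = H and Y = Y and \<kappa> = \<kappa>]; (assumption | use assms in simp))
qed

end
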